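(* (Dynamic Gradual Guarantee for both variants of $\lambda\mathsf{B}'$.) Consider either Variant 1 or Variant 2 of $\lambda\mathsf{B}'$. Let $\Gamma$ be a typing context and let $M,N$ be GTLC terms with $M\sqsubseteq^G N$, $\Gamma\vdash_G M:A$ and $\Gamma\vdash_G N:B$, and let $\mathcal C'[\![M]\!]$, $\mathcal C'[\![N]\!]$ be their compilations into $\lambda\mathsf{B}'$. Below $V,W$ range over values of $\lambda\mathsf{B}'$. 1. If $\mathcal C'[\![N]\!]\longrightarrow^{*}W$, then $\mathcal C'[\![M]\!]\longrightarrow^{*}V$ and $V\sqsubseteq^C W$ for some $V$. 2. If $\mathcal C'[\![N]\!]$ diverges, so does $\mathcal C'[\![M]\!]$. 3. If $\mathcal C'[\![M]\!]\longrightarrow^{*}V$, then either $\mathcal C'[\![N]\!]\longrightarrow^{*}W$ and $V\sqsubseteq^C W$ for some $W$, or $\mathcal C'[\![N]\!]\longrightarrow^{*}\mathtt{blame}\,\ell$ for some $\ell$. 4. If $\mathcal C'[\![M]\!]$ diverges, then either $\mathcal C'[\![N]\!]$ diverges or $\mathcal C'[\![N]\!]\longrightarrow^{*}\mathtt{blame}\,\ell$ for some $\ell$.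
   Context: **Types.** Base types $b$: $\mathtt{Nat},\mathtt{Bool},\mathtt{Int},\mathtt{Unit},\bot$. Types: $A,B,C::=b\mid\,?\mid A\to B\mid A\times B\mid A+B$; atomic types $a::=b\mid\,?$; ground types $G::=b\mid\,?\to?\mid\,?\times?\mid\,?+?$. Contexts $\Gamma$ are finite sequences of types; variables are de Bruijn indices (index $0$ is the last-added type). Primitive types $P::=b\mid b\to P$; each $b$ denotes a set (naturals, Booleans, integers, one-element set, empty set), $[\![b\to P]\!]$ is the set of functions $[\![b]\!]\to[\![P]\!]$. Blame labels $\ell$ range over a fixed set. Throughout $\otimes\in\{\to,\times,+\}$. *Consistency* $\sim$: $A\sim\,?$; $?\sim B$; $b\sim b$; $A\otimes B\sim A'\otimes B'$ if $A\sim A'$, $B\sim B'$. *Join* of consistent types: $A\sqcup\,?=A$, $?\sqcup B=B$, $b\sqcup b=b$, $(A\otimes B)\sqcup(A'\otimes B')=(A\sqcup A')\otimes(B\sqcup B')$. *Matching*: $A\triangleright A_1\otimes A_2$ iff $A=A_1\otimes A_2$, or $A=A_1=A_2=\,?$. *Type precision* $\sqsubseteq$: $?\sqsubseteq A$; $b\sqsubseteq b$; $A\otimes B\sqsubseteq A'\otimes B'$ if $A\sqsubseteq A'$, $B\sqsubseteq B'$. **GTLC** typing $\Gamma\vdash_G M:A$: $\$k:P$ for $k\in[\![P]\!]$; $`x:A$ if $x$ has type $A$ in $\Gamma$; $\lambda[A]M:A\to B$ if $\Gamma\cdot A\vdash_G M:B$; $(L\,M)_\ell:A_2$ if $L:A$,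 $M:B$, $A\triangleright A_1\to A_2$, $A_1\sim B$; $\mathtt{if}_\ell\,L\,M\,N:B\sqcup C$ if $L:A$, $M:B$, $N:C$, $A\sim\mathtt{Bool}$, $B\sim C$; $\mathtt{cons}\,M\,N:A\times B$ if $M:A$, $N:B$; $\pi_i^\ell M:A_i$ if $M:A$, $A\triangleright A_1\times A_2$; $\mathtt{inl}[B]M:A+B$ if $M:A$; $\mathtt{inr}[A]M:A+B$ if $M:B$; $\mathtt{case}_\ell[B_1,C_1]\,L\,M\,N:B_2\sqcup C_2$ if $\Gamma\vdash_G L:A$, $\Gamma\cdot B_1\vdash_G M:B_2$, $\Gamma\cdot C_1\vdash_G N:C_2$, $A\sim B_1+C_1$, $B_2\sim C_2$. *GTLC term precision* $M\sqsubseteq^G M'$: $\$k\sqsubseteq^G\$k$; $`x\sqsubseteq^G`x$; otherwise same outermost constructor (labels may differ), corresponding subterms related by $\sqsubseteq^G$ and corresponding type annotations ($[A]$ in $\lambda$, $[B]$ in $\mathtt{inl}$, $[A]$ in $\mathtt{inr}$, $B_1$ and $C_1$ in $\mathtt{case}$) related by $\sqsubseteq$. **Casts of $\lambda\mathsf{B}'$**: $c=(A\Rightarrow^\ell B)$ with $A\sim B$, a cast from $A$ to $B$. It is a *cross* cast if $A=A_1\otimes A_2$ and $B=B_1\otimes B_2$. Operations on cross casts: for $c=(A\to B\Rightarrow^\ell C\to D)$: $\mathsf{dom}\,c=(C\Rightarrow^\ell A)$, $\mathsf{cod}\,c=(B\Rightarrow^\ell D)$; for $c=(A\times B\Rightarrow^\ell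 C\times D)$: $\mathsf{fst}\,c=(A\Rightarrow^\ell C)$, $\mathsf{snd}\,c=(B\Rightarrow^\ell D)$; for $c=(A+B\Rightarrow^\ell C+D)$: $\mathsf{inl}\,c=(A\Rightarrow^\ell C)$, $\mathsf{inr}\,c=(B\Rightarrow^\ell D)$. *Variant 1*: inert casts are $G\Rightarrow^\ell\,?$ ($G$ ground) and all cross casts. *Variant 2*: inert casts are $G\Rightarrow^\ell\,?$ and casts between function types. Active casts in both variants: $a\Rightarrow^\ell a$; $A\Rightarrow^\ell\,?$ with $A\ne\,?$ not ground; $?\Rightarrow^\ell B$ with $B\neq\,?$; in Variant 2 also casts between two product types or two sum types. **Terms of $\lambda\mathsf{B}'$** (intrinsically typed): $\$k:P$; $`x$; $\lambda M:A\to B$ if $M:\Gamma\cdot A\vdash' B$; $L\,M$; $\mathtt{if}\,L\,M\,N$ (with $L:\mathtt{Bool}$, $M,N$ of the same type); $\mathtt{cons}\,M\,N$; $\pi_iM$; $\mathtt{inl}[B]M:A+B$; $\mathtt{inr}[A]M:A+B$ (all with the usual simple types); $\mathtt{case}\,L\,M\,N:B$ if $L:\Gamma\vdash' A_1+A_2$, $M:\Gamma\cdot A_1\vdash' B$, $N:\Gamma\cdot A_2\vdash' B$; $M\langle c\rangle:B$ if $M:A$ and $c$ is a cast from $A$ to $B$; $M\langle\!\langle c\rangle\!\rangle:B$ likewise with $c$ inert; $\mathtt{blame}\,\ell:A$ for any $A$. *Values* $V,W$: $\lambda M$; $\$k$; $\mathtt{cons}\,V\,W$; $\mathtt{inl}[B]V$;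 $\mathtt{inr}[A]V$; $V\langle\!\langle c\rangle\!\rangle$ ($c$ inert). *Frames* $F$: $\Box\,M$; $V\,\Box$; $\mathtt{if}\,\Box\,M\,N$; $\mathtt{cons}\,V\,\Box$; $\mathtt{cons}\,\Box\,N$; $\pi_i\Box$; $\mathtt{inl}[B]\Box$; $\mathtt{inr}[A]\Box$; $\mathtt{case}\,\Box\,M\,N$; $\Box\langle c\rangle$; $\Box\langle\!\langle c\rangle\!\rangle$. **Reduction** ($M[N]$: substitution of $N$ for variable $0$): - $F[M]\longrightarrow F[M']$ if $M\longrightarrow M'$; $F[\mathtt{blame}\,\ell]\longrightarrow\mathtt{blame}\,\ell$. - $V\langle c\rangle\longrightarrow\mathsf{applyCast}\,V\,c$ for $c$ active; $V\langle c\rangle\longrightarrow V\langle\!\langle c\rangle\!\rangle$ for $c$ inert. - For $c$ an inert cross cast: $V\langle\!\langle c\rangle\!\rangle\,W\longrightarrow(V\,(W\langle\mathsf{dom}\,c\rangle))\langle\mathsf{cod}\,c\rangle$; $\pi_1(V\langle\!\langle c\rangle\!\rangle)\longrightarrow(\pi_1V)\langle\mathsf{fst}\,c\rangle$; $\pi_2(V\langle\!\langle c\rangle\!\rangle)\longrightarrow(\pi_2V)\langle\mathsf{snd}\,c\rangle$; $\mathtt{case}\,(V\langle\!\langle c\rangle\!\rangle)\,M\,N\longrightarrow\mathtt{case}\,V\,M'\,N'$ with $M'$ (resp. $N'$) obtained by replacing the bound variable $`0$ of $M$ by $`0\langle\mathsf{inl}\,c\rangle$ (resp. of $N$ by $`0\langle\mathsf{inr}\,c\rangle$).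 - $(\lambda M)V\longrightarrow M[V]$; $\mathtt{if}\,\$\mathtt{true}\,M\,N\longrightarrow M$; $\mathtt{if}\,\$\mathtt{false}\,M\,N\longrightarrow N$; $\pi_1(\mathtt{cons}\,V\,W)\longrightarrow V$; $\pi_2(\mathtt{cons}\,V\,W)\longrightarrow W$; $\mathtt{case}(\mathtt{inl}[B]V)\,M\,N\longrightarrow M[V]$; $\mathtt{case}(\mathtt{inr}[A]V)\,M\,N\longrightarrow N[V]$; $\$k\,\$k'\longrightarrow\$(k(k'))$. *applyCast*, with $\mathsf{gnd}\,b=b$, $\mathsf{gnd}(A\otimes B)=\,?\otimes\,?$: $\mathsf{applyCast}\,V\,(a\Rightarrow^\ell a)=V$; $\mathsf{applyCast}\,V\,(A\Rightarrow^\ell\,?)=V\langle A\Rightarrow^\ell\mathsf{gnd}\,A\rangle\langle\mathsf{gnd}\,A\Rightarrow^\ell\,?\rangle$ for $A\neq\,?$ non-ground; $\mathsf{applyCast}\,(V\langle\!\langle G\Rightarrow^{\ell_1}?\rangle\!\rangle)\,(?\Rightarrow^{\ell_2}B)$ with $B\neq\,?$ equals $V$ if $B$ is ground and $B=G$, equals $\mathtt{blame}\,\ell_2$ if $B$ is ground and $B\ne G$, and equals $V\langle G\Rightarrow^{\ell_1}?\rangle\langle?\Rightarrow^{\ell_2}\mathsf{gnd}\,B\rangle\langle\mathsf{gnd}\,B\Rightarrow^{\ell_2}B\rangle$ otherwise. In Variant 2 also: for $c$ between product types, $\mathsf{applyCast}\,V\,c=\mathtt{cons}\,((\pi_1V)\langle\mathsf{fst}\,c\rangle)\,((\pi_2V)\langle\mathsf{snd}\,c\rangle)$;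 for $c$ from $A+B$ to $C+D$, $\mathsf{applyCast}\,V\,c=\mathtt{case}\,V\,(\mathtt{inl}[D](`0\langle\mathsf{inl}\,c\rangle))\,(\mathtt{inr}[C](`0\langle\mathsf{inr}\,c\rangle))$. $\longrightarrow^{*}$ is the reflexive-transitive closure; a term *diverges* if it begins an infinite reduction sequence. **Compilation** $\mathcal C'$ of well-typed GTLC terms (types as in the typing rules): $\$k\mapsto\$k$; $`x\mapsto`x$; $\lambda[A]M\mapsto\lambda\,\mathcal C'[\![M]\!]$; $(L\,M)_\ell\mapsto\mathcal C'[\![L]\!]\langle A\Rightarrow^\ell A_1\to A_2\rangle\;\mathcal C'[\![M]\!]\langle B\Rightarrow^\ell A_1\rangle$; $\mathtt{if}_\ell\,L\,M\,N\mapsto\mathtt{if}\,(\mathcal C'[\![L]\!]\langle A\Rightarrow^\ell\mathtt{Bool}\rangle)\,(\mathcal C'[\![M]\!]\langle B\Rightarrow^\ell B\sqcup C\rangle)\,(\mathcal C'[\![N]\!]\langle C\Rightarrow^\ell B\sqcup C\rangle)$; $\mathtt{cons}$, $\mathtt{inl}[B]$, $\mathtt{inr}[A]$ homomorphically; $\pi_i^\ell M\mapsto\pi_i(\mathcal C'[\![M]\!]\langle A\Rightarrow^\ell A_1\times A_2\rangle)$; $\mathtt{case}_\ell[B_1,C_1]\,L\,M\,N\mapsto\mathtt{case}\,(\mathcal C'[\![L]\!]\langle A\Rightarrow^\ell B_1+C_1\rangle)\,(\mathcal C'[\![M]\!]\langle B_2\Rightarrow^\ell B_2\sqcup C_2\rangle)\,(\mathcal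 C'[\![N]\!]\langle C_2\Rightarrow^\ell B_2\sqcup C_2\rangle)$. **Precision for inert casts.** $\langle\!\langle i\rangle\!\rangle\sqsubseteq\langle\!\langle i'\rangle\!\rangle$ iff $i=(G\Rightarrow^\ell?)$ and $i'=(G\Rightarrow^{\ell'}?)$ for the same ground $G$, or $i,i'$ are inert cross casts for the same $\otimes$ with source of $i$ $\sqsubseteq$ source of $i'$ and target of $i$ $\sqsubseteq$ target of $i'$. $\langle\!\langle i\rangle\!\rangle\sqsubseteq A'$ iff $i=(G\Rightarrow^\ell?)$ and $G\sqsubseteq A'$, or $i$ is an inert cross cast for $\otimes$, $A'=A_1'\otimes A_2'$, and both source and target of $i$ are $\sqsubseteq A'$. $A\sqsubseteq\langle\!\langle i'\rangle\!\rangle$ iff $i'$ is an inert cross cast for $\otimes$, $A=A_1\otimes A_2$, and $A$ is $\sqsubseteq$ both source and target of $i'$. **Term precision** $M\sqsubseteq^C M'$ (inductive): - $\$k\sqsubseteq^C\$k$; $`x\sqsubseteq^C`x$; $\lambda N\sqsubseteq^C\lambda N'$ if $N\sqsubseteq^C N'$ and the domain types satisfy $A\sqsubseteq A'$. - Congruence for application, $\mathtt{if}$, $\mathtt{cons}$, $\pi_i$; for $\mathtt{inl}[B]$ vs $\mathtt{inl}[B']$ additionally $B\sqsubseteq B'$; for $\mathtt{inr}[A]$ vs $\mathtt{inr}[A']$ additionally $A\sqsubseteq A'$; for $\mathtt{case}$ with scrutinee types $A_1+A_2$, $A_1'+A_2'$ additionally $A_1\sqsubseteq A_1'$, $A_2\sqsubseteq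 A_2'$. - $M\langle c\rangle\sqsubseteq^C M'\langle c'\rangle$ if $M\sqsubseteq^C M'$ and sources and targets of $c,c'$ are respectively related by $\sqsubseteq$. - $M\langle c\rangle\sqsubseteq^C M'$ if $M\sqsubseteq^C M'$ and source and target of $c$ are both $\sqsubseteq$ the type of $M'$. - $M\sqsubseteq^C M'\langle c'\rangle$ if $M\sqsubseteq^C M'$ and the type of $M$ is $\sqsubseteq$ both source and target of $c'$. - $M\langle\!\langle i\rangle\!\rangle\sqsubseteq^C M'\langle\!\langle i'\rangle\!\rangle$ if $M\sqsubseteq^C M'$, $\langle\!\langle i\rangle\!\rangle\sqsubseteq\langle\!\langle i'\rangle\!\rangle$, and (target of $i$ is $?$ implies target of $i'$ is $?$). - $M\langle\!\langle i\rangle\!\rangle\sqsubseteq^C M'$ if $M\sqsubseteq^C M'$ and $\langle\!\langle i\rangle\!\rangle\sqsubseteq A'$, $A'$ the type of $M'$. - $M\sqsubseteq^C M'\langle\!\langle i'\rangle\!\rangle$ if $M\sqsubseteq^C M'$, the type $A$ of $M$ is not $?$, and $A\sqsubseteq\langle\!\langle i'\rangle\!\rangle$. - $M\sqsubseteq^C\mathtt{blame}\,\ell$ if the type of $M$ is $\sqsubseteq$ the type of $\mathtt{blame}\,\ell$. *)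

theory Defs
  imports Main "HOL-Library.FuncSet"
begin

section \<open>Types\<close>

datatype base = NatB | BoolB | IntB | UnitB | BotB

datatype tycon = Arr | Times | Plus

datatype ty = Base base | Dyn | Bin tycon ty ty

abbreviation arr_ty :: "ty \<Rightarrow> ty \<Rightarrow> ty"  (infixr "\<^bold>\<rightarrow>" 70) where
  "A \<^bold>\<rightarrow> B \<equiv> Bin Arr A B"
abbreviation times_ty :: "ty \<Rightarrow> ty \<Rightarrow> ty"  (infixr "\<^bold>\<times>" 72) where
  "A \<^bold>\<times> B \<equiv> Bin Times A B"
abbreviation plus_ty :: "ty \<Rightarrow> ty \<Rightarrow> ty"  (infixr "\<^bold>+" 71) where
  "A \<^bold>+ B \<equiv> Bin Plus A B"

text \<open>Contexts are lists of types; de Bruijn index 0 is the head of the list.\<close>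

type_synonym ctx = "ty list"

inductive atomic :: "ty \<Rightarrow> bool" where
  "atomic (Base b)"
| "atomic Dyn"

inductive ground :: "ty \<Rightarrow> bool" where
  "ground (Base b)"
| "ground (Bin c Dyn Dyn)"

inductive consistent :: "ty \<Rightarrow> ty \<Rightarrow> bool"  (infix "\<sim>" 50) where
  "A \<sim> Dyn"
| "Dyn \<sim> B"
| "Base b \<sim> Base b"
| "A \<sim> A' \<Longrightarrow> B \<sim> B' \<Longrightarrow> Bin c A B \<sim> Bin c A' B'"

text \<open>The join is only meaningful on consistent types.\<close>

fun join :: "ty \<Rightarrow> ty \<Rightarrow> ty"  (infixl "\<^bold>\<squnion>" 65) where
  "A \<^bold>\<squnion> Dyn = A"
| "Dyn \<^bold>\<squnion> B = B"
| "Base b \<^bold>\<squnion> Base b' = Base b"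
| "Bin c A B \<^bold>\<squnion> Bin c' A' B' = Bin c (A \<^bold>\<squnion> A') (B \<^bold>\<squnion> B')"

definition matches :: "ty \<Rightarrow> tycon \<Rightarrow> ty \<Rightarrow> ty \<Rightarrow> bool" where
  "matches A c A\<^sub>1 A\<^sub>2 \<longleftrightarrow> A = Bin c A\<^sub>1 A\<^sub>2 \<or> A = Dyn \<and> A\<^sub>1 = Dyn \<and> A\<^sub>2 = Dyn"

inductive ty_prec :: "ty \<Rightarrow> ty \<Rightarrow> bool"  (infix "\<^bold>\<sqsubseteq>" 50) where
  "Dyn \<^bold>\<sqsubseteq> A"
| "Base b \<^bold>\<sqsubseteq> Base b"
| "A \<^bold>\<sqsubseteq> A' \<Longrightarrow> B \<^bold>\<sqsubseteq> B' \<Longrightarrow> Bin c A B \<^bold>\<sqsubseteq> Bin c A' B'"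


section \<open>Primitive types and constants\<close>

datatype prim = PBase base | PFun base prim

primrec prim_ty :: "prim \<Rightarrow> ty" where
  "prim_ty (PBase b) = Base b"
| "prim_ty (PFun b P) = Base b \<^bold>\<rightarrow> prim_ty P"

datatype bval = VNat nat | VBool bool | VInt int | VUnit

datatype kval = KBase bval | KFun "bval \<Rightarrow> kval"

primrec base_den :: "base \<Rightarrow> bval set" where
  "base_den NatB = range VNat"
| "base_den BoolB = range VBool"
| "base_den IntB = range VInt"
| "base_den UnitB = {VUnit}"
| "base_den BotB = {}"

text \<open>
  Functions are taken extensional, i.e. with a fixed value outside their domain, so that equality
  of elements is equality of functions on the domain.
\<close>

primrec prim_den :: "prim \<Rightarrow> kval set" where
  "prim_den (PBase b) = KBase ` base_den b"
| "prim_den (PFun b P) = KFun ` (base_den b \<rightarrow>\<^sub>E prim_den P)"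


section \<open>The gradually typed lambda calculus\<close>

text \<open>
  Here and below \<open>'l\<close> is the set of blame labels. A constant carries its primitive type, since
  e.g. the empty function belongs to the denotation of several primitive types.
\<close>

datatype 'l gtm =
    GConst prim kval
  | GVar nat
  | GLam ty "'l gtm"
  | GApp 'l "'l gtm" "'l gtm"
  | GIf 'l "'l gtm" "'l gtm" "'l gtm"
  | GCons "'l gtm" "'l gtm"
  | GFst 'l "'l gtm"
  | GSnd 'l "'l gtm"
  | GInl ty "'l gtm"
  | GInr ty "'l gtm"
  | GCase 'l ty ty "'l gtm" "'l gtm" "'l gtm"

inductive gtyping :: "ctx \<Rightarrow> 'l gtm \<Rightarrow> ty \<Rightarrow> bool"  ("_ \<turnstile>\<^sub>G _ : _" [51, 51, 51] 50) where
  "k \<in> prim_den P \<Longrightarrow> \<Gamma> \<turnstile>\<^sub>G GConst P k : prim_ty P"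
| "x < length \<Gamma> \<Longrightarrow> \<Gamma> \<turnstile>\<^sub>G GVar x : \<Gamma> ! x"
| "A # \<Gamma> \<turnstile>\<^sub>G M : B \<Longrightarrow> \<Gamma> \<turnstile>\<^sub>G GLam A M : A \<^bold>\<rightarrow> B"
| "\<Gamma> \<turnstile>\<^sub>G L : A \<Longrightarrow> \<Gamma> \<turnstile>\<^sub>G M : B \<Longrightarrow> matches A Arr A\<^sub>1 A\<^sub>2 \<Longrightarrow> A\<^sub>1 \<sim> B
    \<Longrightarrow> \<Gamma> \<turnstile>\<^sub>G GApp l L M : A\<^sub>2"
| "\<Gamma> \<turnstile>\<^sub>G L : A \<Longrightarrow> \<Gamma> \<turnstile>\<^sub>G M : B \<Longrightarrow> \<Gamma> \<turnstile>\<^sub>G N : C \<Longrightarrow> A \<sim> Base BoolB \<Longrightarrow> B \<sim> C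
    \<Longrightarrow> \<Gamma> \<turnstile>\<^sub>G GIf l L M N : B \<^bold>\<squnion> C"
| "\<Gamma> \<turnstile>\<^sub>G M : A \<Longrightarrow> \<Gamma> \<turnstile>\<^sub>G N : B \<Longrightarrow> \<Gamma> \<turnstile>\<^sub>G GCons M N : A \<^bold>\<times> B"
| "\<Gamma> \<turnstile>\<^sub>G M : A \<Longrightarrow> matches A Times A\<^sub>1 A\<^sub>2 \<Longrightarrow> \<Gamma> \<turnstile>\<^sub>G GFst l M : A\<^sub>1"
| "\<Gamma> \<turnstile>\<^sub>G M : A \<Longrightarrow> matches A Times A\<^sub>1 A\<^sub>2 \<Longrightarrow> \<Gamma> \<turnstile>\<^sub>G GSnd l M : A\<^sub>2"
| "\<Gamma> \<turnstile>\<^sub>G M : A \<Longrightarrow> \<Gamma> \<turnstile>\<^sub>G GInl B M : A \<^bold>+ B"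
| "\<Gamma> \<turnstile>\<^sub>G M : B \<Longrightarrow> \<Gamma> \<turnstile>\<^sub>G GInr A M : A \<^bold>+ B"
| "\<Gamma> \<turnstile>\<^sub>G L : A \<Longrightarrow> B\<^sub>1 # \<Gamma> \<turnstile>\<^sub>G M : B\<^sub>2 \<Longrightarrow> C\<^sub>1 # \<Gamma> \<turnstile>\<^sub>G N : C\<^sub>2 \<Longrightarrow> A \<sim> B\<^sub>1 \<^bold>+ C\<^sub>1 \<Longrightarrow> B\<^sub>2 \<sim> C\<^sub>2
    \<Longrightarrow> \<Gamma> \<turnstile>\<^sub>G GCase l B\<^sub>1 C\<^sub>1 L M N : B\<^sub>2 \<^bold>\<squnion> C\<^sub>2"

inductive gprec :: "'l gtm \<Rightarrow> 'l gtm \<Rightarrow> bool"  (infix "\<sqsubseteq>\<^sup>G" 50) where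
  "GConst P k \<sqsubseteq>\<^sup>G GConst P k"
| "GVar x \<sqsubseteq>\<^sup>G GVar x"
| "A \<^bold>\<sqsubseteq> A' \<Longrightarrow> M \<sqsubseteq>\<^sup>G M' \<Longrightarrow> GLam A M \<sqsubseteq>\<^sup>G GLam A' M'"
| "L \<sqsubseteq>\<^sup>G L' \<Longrightarrow> M \<sqsubseteq>\<^sup>G M' \<Longrightarrow> GApp l L M \<sqsubseteq>\<^sup>G GApp l' L' M'"
| "L \<sqsubseteq>\<^sup>G L' \<Longrightarrow> M \<sqsubseteq>\<^sup>G M' \<Longrightarrow> N \<sqsubseteq>\<^sup>G N' \<Longrightarrow> GIf l L M N \<sqsubseteq>\<^sup>G GIf l' L' M' N'"
| "M \<sqsubseteq>\<^sup>G M' \<Longrightarrow> N \<sqsubseteq>\<^sup>G N' \<Longrightarrow> GCons M N \<sqsubseteq>\<^sup>G GCons M' N'"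
| "M \<sqsubseteq>\<^sup>G M' \<Longrightarrow> GFst l M \<sqsubseteq>\<^sup>G GFst l' M'"
| "M \<sqsubseteq>\<^sup>G M' \<Longrightarrow> GSnd l M \<sqsubseteq>\<^sup>G GSnd l' M'"
| "B \<^bold>\<sqsubseteq> B' \<Longrightarrow> M \<sqsubseteq>\<^sup>G M' \<Longrightarrow> GInl B M \<sqsubseteq>\<^sup>G GInl B' M'"
| "A \<^bold>\<sqsubseteq> A' \<Longrightarrow> M \<sqsubseteq>\<^sup>G M' \<Longrightarrow> GInr A M \<sqsubseteq>\<^sup>G GInr A' M'"
| "B\<^sub>1 \<^bold>\<sqsubseteq> B\<^sub>1' \<Longrightarrow> C\<^sub>1 \<^bold>\<sqsubseteq> C\<^sub>1' \<Longrightarrow> L \<sqsubseteq>\<^sup>G L' \<Longrightarrow> M \<sqsubseteq>\<^sup>G M' \<Longrightarrow> N \<sqsubseteq>\<^sup>G N'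
    \<Longrightarrow> GCase l B\<^sub>1 C\<^sub>1 L M N \<sqsubseteq>\<^sup>G GCase l' B\<^sub>1' C\<^sub>1' L' M' N'"


section \<open>Casts\<close>

datatype 'l cast = Cast (src: ty) (lbl: 'l) (tgt: ty)  ("_ \<Rightarrow>\<^bsub>_\<^esub> _" [61, 0, 61] 60)

text \<open>The side condition that every cast must satisfy; it is imposed by the typing rules.\<close>

definition cast_ok :: "'l cast \<Rightarrow> bool" where
  "cast_ok c \<longleftrightarrow> src c \<sim> tgt c"

fun cdom :: "'l cast \<Rightarrow> 'l cast" where
  "cdom (A \<^bold>\<rightarrow> B \<Rightarrow>\<^bsub>l\<^esub> C \<^bold>\<rightarrow> D) = (C \<Rightarrow>\<^bsub>l\<^esub> A)"
fun ccod :: "'l cast \<Rightarrow> 'l cast" where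
  "ccod (A \<^bold>\<rightarrow> B \<Rightarrow>\<^bsub>l\<^esub> C \<^bold>\<rightarrow> D) = (B \<Rightarrow>\<^bsub>l\<^esub> D)"
fun cfst :: "'l cast \<Rightarrow> 'l cast" where
  "cfst (A \<^bold>\<times> B \<Rightarrow>\<^bsub>l\<^esub> C \<^bold>\<times> D) = (A \<Rightarrow>\<^bsub>l\<^esub> C)"
fun csnd :: "'l cast \<Rightarrow> 'l cast" where
  "csnd (A \<^bold>\<times> B \<Rightarrow>\<^bsub>l\<^esub> C \<^bold>\<times> D) = (B \<Rightarrow>\<^bsub>l\<^esub> D)"
fun cinl :: "'l cast \<Rightarrow> 'l cast" where
  "cinl (A \<^bold>+ B \<Rightarrow>\<^bsub>l\<^esub> C \<^bold>+ D) = (A \<Rightarrow>\<^bsub>l\<^esub> C)"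
fun cinr :: "'l cast \<Rightarrow> 'l cast" where
  "cinr (A \<^bold>+ B \<Rightarrow>\<^bsub>l\<^esub> C \<^bold>+ D) = (B \<Rightarrow>\<^bsub>l\<^esub> D)"

datatype variant = Variant1 | Variant2

inductive inert :: "variant \<Rightarrow> 'l cast \<Rightarrow> bool" where
  "ground G \<Longrightarrow> inert v (G \<Rightarrow>\<^bsub>l\<^esub> Dyn)"
| "inert Variant1 (Bin c A B \<Rightarrow>\<^bsub>l\<^esub> Bin c C D)"
| "inert Variant2 (A \<^bold>\<rightarrow> B \<Rightarrow>\<^bsub>l\<^esub> C \<^bold>\<rightarrow> D)"

inductive active :: "variant \<Rightarrow> 'l cast \<Rightarrow> bool" where
  "atomic a \<Longrightarrow> active v (a \<Rightarrow>\<^bsub>l\<^esub> a)"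
| "A \<noteq> Dyn \<Longrightarrow> \<not> ground A \<Longrightarrow> active v (A \<Rightarrow>\<^bsub>l\<^esub> Dyn)"
| "B \<noteq> Dyn \<Longrightarrow> active v (Dyn \<Rightarrow>\<^bsub>l\<^esub> B)"
| "active Variant2 (A \<^bold>\<times> B \<Rightarrow>\<^bsub>l\<^esub> C \<^bold>\<times> D)"
| "active Variant2 (A \<^bold>+ B \<Rightarrow>\<^bsub>l\<^esub> C \<^bold>+ D)"


section \<open>The cast calculus\<close>

text \<open>
  An intrinsically typed term of type \<open>A\<close> in context \<open>\<Gamma>\<close> is represented by a raw term \<open>M\<close> with
  \<open>v; \<Gamma> \<turnstile> M : A\<close>. Constants, abstractions and blame carry the type annotation that makes both the
  type and the typing derivation of a raw term unique, so that nothing is lost in passing from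
  derivations to raw terms.
\<close>

datatype 'l tm =
    CConst prim kval
  | CVar nat
  | CLam ty "'l tm"
  | CApp "'l tm" "'l tm"
  | CIf "'l tm" "'l tm" "'l tm"
  | CCons "'l tm" "'l tm"
  | CFst "'l tm"
  | CSnd "'l tm"
  | CInl ty "'l tm"
  | CInr ty "'l tm"
  | CCase "'l tm" "'l tm" "'l tm"
  | CCast "'l tm" "'l cast"  ("_\<langle>_\<rangle>" [1000, 0] 1000)
  | CWrap "'l tm" "'l cast"  ("_\<langle>\<langle>_\<rangle>\<rangle>" [1000, 0] 1000)
  | CBlame ty 'l

inductive typing :: "variant \<Rightarrow> ctx \<Rightarrow> 'l tm \<Rightarrow> ty \<Rightarrow> bool"  ("_; _ \<turnstile> _ : _" [51, 51, 51, 51] 50)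
  for v :: variant where
  "k \<in> prim_den P \<Longrightarrow> v; \<Gamma> \<turnstile> CConst P k : prim_ty P"
| "x < length \<Gamma> \<Longrightarrow> v; \<Gamma> \<turnstile> CVar x : \<Gamma> ! x"
| "v; A # \<Gamma> \<turnstile> M : B \<Longrightarrow> v; \<Gamma> \<turnstile> CLam A M : A \<^bold>\<rightarrow> B"
| "v; \<Gamma> \<turnstile> L : A \<^bold>\<rightarrow> B \<Longrightarrow> v; \<Gamma> \<turnstile> M : A \<Longrightarrow> v; \<Gamma> \<turnstile> CApp L M : B"
| "v; \<Gamma> \<turnstile> L : Base BoolB \<Longrightarrow> v; \<Gamma> \<turnstile> M : A \<Longrightarrow> v; \<Gamma> \<turnstile> N : A \<Longrightarrow> v; \<Gamma> \<turnstile> CIf L M N : A"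
| "v; \<Gamma> \<turnstile> M : A \<Longrightarrow> v; \<Gamma> \<turnstile> N : B \<Longrightarrow> v; \<Gamma> \<turnstile> CCons M N : A \<^bold>\<times> B"
| "v; \<Gamma> \<turnstile> M : A \<^bold>\<times> B \<Longrightarrow> v; \<Gamma> \<turnstile> CFst M : A"
| "v; \<Gamma> \<turnstile> M : A \<^bold>\<times> B \<Longrightarrow> v; \<Gamma> \<turnstile> CSnd M : B"
| "v; \<Gamma> \<turnstile> M : A \<Longrightarrow> v; \<Gamma> \<turnstile> CInl B M : A \<^bold>+ B"
| "v; \<Gamma> \<turnstile> M : B \<Longrightarrow> v; \<Gamma> \<turnstile> CInr A M : A \<^bold>+ B"
| "v; \<Gamma> \<turnstile> L : A\<^sub>1 \<^bold>+ A\<^sub>2 \<Longrightarrow> v; A\<^sub>1 # \<Gamma> \<turnstile> M : B \<Longrightarrow> v; A\<^sub>2 # \<Gamma> \<turnstile> N : B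
    \<Longrightarrow> v; \<Gamma> \<turnstile> CCase L M N : B"
| "v; \<Gamma> \<turnstile> M : src c \<Longrightarrow> cast_ok c \<Longrightarrow> v; \<Gamma> \<turnstile> M\<langle>c\<rangle> : tgt c"
| "v; \<Gamma> \<turnstile> M : src c \<Longrightarrow> cast_ok c \<Longrightarrow> inert v c \<Longrightarrow> v; \<Gamma> \<turnstile> M\<langle>\<langle>c\<rangle>\<rangle> : tgt c"
| "v; \<Gamma> \<turnstile> CBlame A l : A"

primrec ren :: "(nat \<Rightarrow> nat) \<Rightarrow> 'l tm \<Rightarrow> 'l tm" where
  "ren \<rho> (CConst P k) = CConst P k"
| "ren \<rho> (CVar x) = CVar (\<rho> x)"
| "ren \<rho> (CLam A M) = CLam A (ren (case_nat 0 (Suc \<circ> \<rho>)) M)"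
| "ren \<rho> (CApp L M) = CApp (ren \<rho> L) (ren \<rho> M)"
| "ren \<rho> (CIf L M N) = CIf (ren \<rho> L) (ren \<rho> M) (ren \<rho> N)"
| "ren \<rho> (CCons M N) = CCons (ren \<rho> M) (ren \<rho> N)"
| "ren \<rho> (CFst M) = CFst (ren \<rho> M)"
| "ren \<rho> (CSnd M) = CSnd (ren \<rho> M)"
| "ren \<rho> (CInl B M) = CInl B (ren \<rho> M)"
| "ren \<rho> (CInr A M) = CInr A (ren \<rho> M)"
| "ren \<rho> (CCase L M N) =
    CCase (ren \<rho> L) (ren (case_nat 0 (Suc \<circ> \<rho>)) M) (ren (case_nat 0 (Suc \<circ> \<rho>)) N)"
| "ren \<rho> (M\<langle>c\<rangle>) = (ren \<rho> M)\<langle>c\<rangle>"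
| "ren \<rho> (M\<langle>\<langle>c\<rangle>\<rangle>) = (ren \<rho> M)\<langle>\<langle>c\<rangle>\<rangle>"
| "ren \<rho> (CBlame A l) = CBlame A l"

definition exts :: "(nat \<Rightarrow> 'l tm) \<Rightarrow> nat \<Rightarrow> 'l tm" where
  "exts \<sigma> = case_nat (CVar 0) (ren Suc \<circ> \<sigma>)"

primrec sub :: "(nat \<Rightarrow> 'l tm) \<Rightarrow> 'l tm \<Rightarrow> 'l tm" where
  "sub \<sigma> (CConst P k) = CConst P k"
| "sub \<sigma> (CVar x) = \<sigma> x"
| "sub \<sigma> (CLam A M) = CLam A (sub (exts \<sigma>) M)"
| "sub \<sigma> (CApp L M) = CApp (sub \<sigma> L) (sub \<sigma> M)"
| "sub \<sigma> (CIf L M N) = CIf (sub \<sigma> L) (sub \<sigma> M) (sub \<sigma> N)"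
| "sub \<sigma> (CCons M N) = CCons (sub \<sigma> M) (sub \<sigma> N)"
| "sub \<sigma> (CFst M) = CFst (sub \<sigma> M)"
| "sub \<sigma> (CSnd M) = CSnd (sub \<sigma> M)"
| "sub \<sigma> (CInl B M) = CInl B (sub \<sigma> M)"
| "sub \<sigma> (CInr A M) = CInr A (sub \<sigma> M)"
| "sub \<sigma> (CCase L M N) = CCase (sub \<sigma> L) (sub (exts \<sigma>) M) (sub (exts \<sigma>) N)"
| "sub \<sigma> (M\<langle>c\<rangle>) = (sub \<sigma> M)\<langle>c\<rangle>"
| "sub \<sigma> (M\<langle>\<langle>c\<rangle>\<rangle>) = (sub \<sigma> M)\<langle>\<langle>c\<rangle>\<rangle>"
| "sub \<sigma> (CBlame A l) = CBlame A l"

definition subst0 :: "'l tm \<Rightarrow> 'l tm \<Rightarrow> 'l tm" where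
  "subst0 M N = sub (case_nat N CVar) M"

text \<open>Replaces variable 0 by variable 0 under the cast \<open>c\<close>, keeping it bound.\<close>

definition cast_var0 :: "'l cast \<Rightarrow> 'l tm \<Rightarrow> 'l tm" where
  "cast_var0 c M = sub (case_nat ((CVar 0)\<langle>c\<rangle>) (CVar \<circ> Suc)) M"

inductive is_value :: "variant \<Rightarrow> 'l tm \<Rightarrow> bool" for v :: variant where
  "is_value v (CLam A M)"
| "is_value v (CConst P k)"
| "is_value v V \<Longrightarrow> is_value v W \<Longrightarrow> is_value v (CCons V W)"
| "is_value v V \<Longrightarrow> is_value v (CInl B V)"
| "is_value v V \<Longrightarrow> is_value v (CInr A V)"
| "is_value v V \<Longrightarrow> inert v c \<Longrightarrow> is_value v (V\<langle>\<langle>c\<rangle>\<rangle>)"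

text \<open>A frame is represented by the function that fills its hole.\<close>

inductive frame :: "variant \<Rightarrow> ('l tm \<Rightarrow> 'l tm) \<Rightarrow> bool" for v :: variant where
  "frame v (\<lambda>X. CApp X M)"
| "is_value v V \<Longrightarrow> frame v (\<lambda>X. CApp V X)"
| "frame v (\<lambda>X. CIf X M N)"
| "is_value v V \<Longrightarrow> frame v (\<lambda>X. CCons V X)"
| "frame v (\<lambda>X. CCons X N)"
| "frame v (\<lambda>X. CFst X)"
| "frame v (\<lambda>X. CSnd X)"
| "frame v (\<lambda>X. CInl B X)"
| "frame v (\<lambda>X. CInr A X)"
| "frame v (\<lambda>X. CCase X M N)"
| "frame v (\<lambda>X. X\<langle>c\<rangle>)"
| "inert v c \<Longrightarrow> frame v (\<lambda>X. X\<langle>\<langle>c\<rangle>\<rangle>)"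

fun gnd :: "ty \<Rightarrow> ty" where
  "gnd (Base b) = Base b"
| "gnd (Bin c A B) = Bin c Dyn Dyn"

text \<open>The graph of the (partial) function applyCast.\<close>

inductive apply_cast :: "variant \<Rightarrow> 'l tm \<Rightarrow> 'l cast \<Rightarrow> 'l tm \<Rightarrow> bool" where
  "atomic a \<Longrightarrow> apply_cast v V (a \<Rightarrow>\<^bsub>l\<^esub> a) V"
| "A \<noteq> Dyn \<Longrightarrow> \<not> ground A
    \<Longrightarrow> apply_cast v V (A \<Rightarrow>\<^bsub>l\<^esub> Dyn) (V\<langle>A \<Rightarrow>\<^bsub>l\<^esub> gnd A\<rangle>\<langle>gnd A \<Rightarrow>\<^bsub>l\<^esub> Dyn\<rangle>)"
| "ground G \<Longrightarrow> ground B \<Longrightarrow> B = G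
    \<Longrightarrow> apply_cast v (V\<langle>\<langle>G \<Rightarrow>\<^bsub>l\<^sub>1\<^esub> Dyn\<rangle>\<rangle>) (Dyn \<Rightarrow>\<^bsub>l\<^sub>2\<^esub> B) V"
| "ground G \<Longrightarrow> ground B \<Longrightarrow> B \<noteq> G
    \<Longrightarrow> apply_cast v (V\<langle>\<langle>G \<Rightarrow>\<^bsub>l\<^sub>1\<^esub> Dyn\<rangle>\<rangle>) (Dyn \<Rightarrow>\<^bsub>l\<^sub>2\<^esub> B) (CBlame B l\<^sub>2)"
| "ground G \<Longrightarrow> B \<noteq> Dyn \<Longrightarrow> \<not> ground B
    \<Longrightarrow> apply_cast v (V\<langle>\<langle>G \<Rightarrow>\<^bsub>l\<^sub>1\<^esub> Dyn\<rangle>\<rangle>) (Dyn \<Rightarrow>\<^bsub>l\<^sub>2\<^esub> B)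
          (V\<langle>G \<Rightarrow>\<^bsub>l\<^sub>1\<^esub> Dyn\<rangle>\<langle>Dyn \<Rightarrow>\<^bsub>l\<^sub>2\<^esub> gnd B\<rangle>\<langle>gnd B \<Rightarrow>\<^bsub>l\<^sub>2\<^esub> B\<rangle>)"
| "c = (A \<^bold>\<times> B \<Rightarrow>\<^bsub>l\<^esub> C \<^bold>\<times> D)
    \<Longrightarrow> apply_cast Variant2 V c (CCons ((CFst V)\<langle>cfst c\<rangle>) ((CSnd V)\<langle>csnd c\<rangle>))"
| "c = (A \<^bold>+ B \<Rightarrow>\<^bsub>l\<^esub> C \<^bold>+ D)
    \<Longrightarrow> apply_cast Variant2 V c
          (CCase V (CInl D ((CVar 0)\<langle>cinl c\<rangle>)) (CInr C ((CVar 0)\<langle>cinr c\<rangle>)))"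

text \<open>
  The context is needed only to determine the type of the blame term that replaces a frame filled
  with blame.
\<close>

inductive step :: "variant \<Rightarrow> ctx \<Rightarrow> 'l tm \<Rightarrow> 'l tm \<Rightarrow> bool"
  for v :: variant and \<Gamma> :: ctx where
  "frame v F \<Longrightarrow> step v \<Gamma> M M' \<Longrightarrow> step v \<Gamma> (F M) (F M')"
| "frame v F \<Longrightarrow> v; \<Gamma> \<turnstile> F (CBlame A l) : B \<Longrightarrow> step v \<Gamma> (F (CBlame A l)) (CBlame B l)"
| "is_value v V \<Longrightarrow> active v c \<Longrightarrow> apply_cast v V c M \<Longrightarrow> step v \<Gamma> (V\<langle>c\<rangle>) M"
| "is_value v V \<Longrightarrow> inert v c \<Longrightarrow> step v \<Gamma> (V\<langle>c\<rangle>) (V\<langle>\<langle>c\<rangle>\<rangle>)"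
| "is_value v V \<Longrightarrow> is_value v W \<Longrightarrow> inert v c \<Longrightarrow> c = (A \<^bold>\<rightarrow> B \<Rightarrow>\<^bsub>l\<^esub> C \<^bold>\<rightarrow> D)
    \<Longrightarrow> step v \<Gamma> (CApp (V\<langle>\<langle>c\<rangle>\<rangle>) W) ((CApp V (W\<langle>cdom c\<rangle>))\<langle>ccod c\<rangle>)"
| "is_value v V \<Longrightarrow> inert v c \<Longrightarrow> c = (A \<^bold>\<times> B \<Rightarrow>\<^bsub>l\<^esub> C \<^bold>\<times> D)
    \<Longrightarrow> step v \<Gamma> (CFst (V\<langle>\<langle>c\<rangle>\<rangle>)) ((CFst V)\<langle>cfst c\<rangle>)"
| "is_value v V \<Longrightarrow> inert v c \<Longrightarrow> c = (A \<^bold>\<times> B \<Rightarrow>\<^bsub>l\<^esub> C \<^bold>\<times> D)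
    \<Longrightarrow> step v \<Gamma> (CSnd (V\<langle>\<langle>c\<rangle>\<rangle>)) ((CSnd V)\<langle>csnd c\<rangle>)"
| "is_value v V \<Longrightarrow> inert v c \<Longrightarrow> c = (A \<^bold>+ B \<Rightarrow>\<^bsub>l\<^esub> C \<^bold>+ D)
    \<Longrightarrow> step v \<Gamma> (CCase (V\<langle>\<langle>c\<rangle>\<rangle>) M N) (CCase V (cast_var0 (cinl c) M) (cast_var0 (cinr c) N))"
| "is_value v V \<Longrightarrow> step v \<Gamma> (CApp (CLam A M) V) (subst0 M V)"
| "step v \<Gamma> (CIf (CConst (PBase BoolB) (KBase (VBool True))) M N) M"
| "step v \<Gamma> (CIf (CConst (PBase BoolB) (KBase (VBool False))) M N) N"
| "is_value v V \<Longrightarrow> is_value v W \<Longrightarrow> step v \<Gamma> (CFst (CCons V W)) V"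
| "is_value v V \<Longrightarrow> is_value v W \<Longrightarrow> step v \<Gamma> (CSnd (CCons V W)) W"
| "is_value v V \<Longrightarrow> step v \<Gamma> (CCase (CInl B V) M N) (subst0 M V)"
| "is_value v V \<Longrightarrow> step v \<Gamma> (CCase (CInr A V) M N) (subst0 N V)"
| "step v \<Gamma> (CApp (CConst (PFun b P) (KFun f)) (CConst (PBase b) (KBase u))) (CConst P (f u))"

abbreviation steps :: "variant \<Rightarrow> ctx \<Rightarrow> 'l tm \<Rightarrow> 'l tm \<Rightarrow> bool" where
  "steps v \<Gamma> \<equiv> (step v \<Gamma>)\<^sup>*\<^sup>*"

definition diverges :: "variant \<Rightarrow> ctx \<Rightarrow> 'l tm \<Rightarrow> bool" where
  "diverges v \<Gamma> M \<longleftrightarrow> (\<exists>f :: nat \<Rightarrow> 'l tm. f 0 = M \<and> (\<forall>i. step v \<Gamma> (f i) (f (Suc i))))"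


section \<open>Compilation\<close>


definition gtype :: "ctx \<Rightarrow> 'l gtm \<Rightarrow> ty" where
  "gtype \<Gamma> M = (THE A. \<Gamma> \<turnstile>\<^sub>G M : A)"

text \<open>The components \<open>A\<^sub>1\<close> and \<open>A\<^sub>2\<close> of a type that matches a binary type.\<close>

fun match1 :: "ty \<Rightarrow> ty" where
  "match1 (Bin c A\<^sub>1 A\<^sub>2) = A\<^sub>1"
| "match1 Dyn = Dyn"
fun match2 :: "ty \<Rightarrow> ty" where
  "match2 (Bin c A\<^sub>1 A\<^sub>2) = A\<^sub>2"
| "match2 Dyn = Dyn"

lemma matches_match: "matches A c A\<^sub>1 A\<^sub>2 \<Longrightarrow> match1 A = A\<^sub>1 \<and> match2 A = A\<^sub>2"
  by (auto simp: matches_def)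

inductive_cases gtyping_inv:
  "\<Gamma> \<turnstile>\<^sub>G GConst P k : B"
  "\<Gamma> \<turnstile>\<^sub>G GVar x : B"
  "\<Gamma> \<turnstile>\<^sub>G GLam A M : B"
  "\<Gamma> \<turnstile>\<^sub>G GApp l L M : B"
  "\<Gamma> \<turnstile>\<^sub>G GIf l L M N : B"
  "\<Gamma> \<turnstile>\<^sub>G GCons M N : B"
  "\<Gamma> \<turnstile>\<^sub>G GFst l M : B"
  "\<Gamma> \<turnstile>\<^sub>G GSnd l M : B"
  "\<Gamma> \<turnstile>\<^sub>G GInl A M : B"
  "\<Gamma> \<turnstile>\<^sub>G GInr A M : B"
  "\<Gamma> \<turnstile>\<^sub>G GCase l A A' L M N : B"

lemma gtyping_unique: "\<Gamma> \<turnstile>\<^sub>G M : A \<Longrightarrow> \<Gamma> \<turnstile>\<^sub>G M : B \<Longrightarrow> A = B"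
  by (induction arbitrary: B rule: gtyping.induct)
    (erule gtyping_inv; use matches_match in blast)+

lemma gtype_eq: "\<Gamma> \<turnstile>\<^sub>G M : A \<Longrightarrow> gtype \<Gamma> M = A"
  unfolding gtype_def by (blast intro: the_equality gtyping_unique)

primrec compile :: "ctx \<Rightarrow> 'l gtm \<Rightarrow> 'l tm" where
  "compile \<Gamma> (GConst P k) = CConst P k"
| "compile \<Gamma> (GVar x) = CVar x"
| "compile \<Gamma> (GLam A M) = CLam A (compile (A # \<Gamma>) M)"
| "compile \<Gamma> (GApp l L M) =
    (let A = gtype \<Gamma> L; B = gtype \<Gamma> M; A\<^sub>1 = match1 A; A\<^sub>2 = match2 A
     in CApp ((compile \<Gamma> L)\<langle>A \<Rightarrow>\<^bsub>l\<^esub> A\<^sub>1 \<^bold>\<rightarrow> A\<^sub>2\<rangle>) ((compile \<Gamma> M)\<langle>B \<Rightarrow>\<^bsub>l\<^esub> A\<^sub>1\<rangle>))"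
| "compile \<Gamma> (GIf l L M N) =
    (let A = gtype \<Gamma> L; B = gtype \<Gamma> M; C = gtype \<Gamma> N
     in CIf ((compile \<Gamma> L)\<langle>A \<Rightarrow>\<^bsub>l\<^esub> Base BoolB\<rangle>)
          ((compile \<Gamma> M)\<langle>B \<Rightarrow>\<^bsub>l\<^esub> B \<^bold>\<squnion> C\<rangle>) ((compile \<Gamma> N)\<langle>C \<Rightarrow>\<^bsub>l\<^esub> B \<^bold>\<squnion> C\<rangle>))"
| "compile \<Gamma> (GCons M N) = CCons (compile \<Gamma> M) (compile \<Gamma> N)"
| "compile \<Gamma> (GFst l M) =
    (let A = gtype \<Gamma> M in CFst ((compile \<Gamma> M)\<langle>A \<Rightarrow>\<^bsub>l\<^esub> match1 A \<^bold>\<times> match2 A\<rangle>))"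
| "compile \<Gamma> (GSnd l M) =
    (let A = gtype \<Gamma> M in CSnd ((compile \<Gamma> M)\<langle>A \<Rightarrow>\<^bsub>l\<^esub> match1 A \<^bold>\<times> match2 A\<rangle>))"
| "compile \<Gamma> (GInl B M) = CInl B (compile \<Gamma> M)"
| "compile \<Gamma> (GInr A M) = CInr A (compile \<Gamma> M)"
| "compile \<Gamma> (GCase l B\<^sub>1 C\<^sub>1 L M N) =
    (let A = gtype \<Gamma> L; B\<^sub>2 = gtype (B\<^sub>1 # \<Gamma>) M; C\<^sub>2 = gtype (C\<^sub>1 # \<Gamma>) N
     in CCase ((compile \<Gamma> L)\<langle>A \<Rightarrow>\<^bsub>l\<^esub> B\<^sub>1 \<^bold>+ C\<^sub>1\<rangle>)
          ((compile (B\<^sub>1 # \<Gamma>) M)\<langle>B\<^sub>2 \<Rightarrow>\<^bsub>l\<^esub> B\<^sub>2 \<^bold>\<squnion> C\<^sub>2\<rangle>)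
          ((compile (C\<^sub>1 # \<Gamma>) N)\<langle>C\<^sub>2 \<Rightarrow>\<^bsub>l\<^esub> B\<^sub>2 \<^bold>\<squnion> C\<^sub>2\<rangle>))"


section \<open>Precision for the cast calculus\<close>

inductive inert_prec :: "variant \<Rightarrow> 'l cast \<Rightarrow> 'l cast \<Rightarrow> bool" for v :: variant where
  "ground G \<Longrightarrow> inert_prec v (G \<Rightarrow>\<^bsub>l\<^esub> Dyn) (G \<Rightarrow>\<^bsub>l'\<^esub> Dyn)"
| "i = (Bin c A B \<Rightarrow>\<^bsub>l\<^esub> Bin c C D) \<Longrightarrow> i' = (Bin c A' B' \<Rightarrow>\<^bsub>l'\<^esub> Bin c C' D')
    \<Longrightarrow> inert v i \<Longrightarrow> inert v i' \<Longrightarrow> src i \<^bold>\<sqsubseteq> src i' \<Longrightarrow> tgt i \<^bold>\<sqsubseteq> tgt i' \<Longrightarrow> inert_prec v i i'"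

inductive inert_prec_ty :: "variant \<Rightarrow> 'l cast \<Rightarrow> ty \<Rightarrow> bool" for v :: variant where
  "ground G \<Longrightarrow> G \<^bold>\<sqsubseteq> A' \<Longrightarrow> inert_prec_ty v (G \<Rightarrow>\<^bsub>l\<^esub> Dyn) A'"
| "i = (Bin c A B \<Rightarrow>\<^bsub>l\<^esub> Bin c C D) \<Longrightarrow> inert v i \<Longrightarrow> A' = Bin c A\<^sub>1' A\<^sub>2'
    \<Longrightarrow> src i \<^bold>\<sqsubseteq> A' \<Longrightarrow> tgt i \<^bold>\<sqsubseteq> A' \<Longrightarrow> inert_prec_ty v i A'"

inductive ty_prec_inert :: "variant \<Rightarrow> ty \<Rightarrow> 'l cast \<Rightarrow> bool" for v :: variant where
  "i' = (Bin c A' B' \<Rightarrow>\<^bsub>l'\<^esub> Bin c C' D') \<Longrightarrow> inert v i' \<Longrightarrow> A = Bin c A\<^sub>1 A\<^sub>2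
    \<Longrightarrow> A \<^bold>\<sqsubseteq> src i' \<Longrightarrow> A \<^bold>\<sqsubseteq> tgt i' \<Longrightarrow> ty_prec_inert v A i'"

text \<open>
  \<open>cprec v \<Gamma> \<Gamma>' M A M' A'\<close> relates the intrinsically typed terms \<open>\<Gamma> \<turnstile> M : A\<close> and \<open>\<Gamma>' \<turnstile> M' : A'\<close>.
  It entails that both are well-typed.
\<close>

inductive cprec :: "variant \<Rightarrow> ctx \<Rightarrow> ctx \<Rightarrow> 'l tm \<Rightarrow> ty \<Rightarrow> 'l tm \<Rightarrow> ty \<Rightarrow> bool"
    ("_; _; _ \<turnstile> _ : _ \<sqsubseteq>\<^sup>C _ : _" [51, 51, 51, 51, 51, 51, 51] 50)
  for v :: variant where
  "k \<in> prim_den P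
    \<Longrightarrow> v; \<Gamma>; \<Gamma>' \<turnstile> CConst P k : prim_ty P \<sqsubseteq>\<^sup>C CConst P k : prim_ty P"
| "x < length \<Gamma> \<Longrightarrow> x < length \<Gamma>'
    \<Longrightarrow> v; \<Gamma>; \<Gamma>' \<turnstile> CVar x : \<Gamma> ! x \<sqsubseteq>\<^sup>C CVar x : \<Gamma>' ! x"
| "v; A # \<Gamma>; A' # \<Gamma>' \<turnstile> N : B \<sqsubseteq>\<^sup>C N' : B' \<Longrightarrow> A \<^bold>\<sqsubseteq> A'
    \<Longrightarrow> v; \<Gamma>; \<Gamma>' \<turnstile> CLam A N : A \<^bold>\<rightarrow> B \<sqsubseteq>\<^sup>C CLam A' N' : A' \<^bold>\<rightarrow> B'"
| "v; \<Gamma>; \<Gamma>' \<turnstile> L : A \<^bold>\<rightarrow> B \<sqsubseteq>\<^sup>C L' : A' \<^bold>\<rightarrow> B' \<Longrightarrow> v; \<Gamma>; \<Gamma>' \<turnstile> M : A \<sqsubseteq>\<^sup>C M' : A'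
    \<Longrightarrow> v; \<Gamma>; \<Gamma>' \<turnstile> CApp L M : B \<sqsubseteq>\<^sup>C CApp L' M' : B'"
| "v; \<Gamma>; \<Gamma>' \<turnstile> L : Base BoolB \<sqsubseteq>\<^sup>C L' : Base BoolB
    \<Longrightarrow> v; \<Gamma>; \<Gamma>' \<turnstile> M : A \<sqsubseteq>\<^sup>C M' : A' \<Longrightarrow> v; \<Gamma>; \<Gamma>' \<turnstile> N : A \<sqsubseteq>\<^sup>C N' : A'
    \<Longrightarrow> v; \<Gamma>; \<Gamma>' \<turnstile> CIf L M N : A \<sqsubseteq>\<^sup>C CIf L' M' N' : A'"
| "v; \<Gamma>; \<Gamma>' \<turnstile> M : A \<sqsubseteq>\<^sup>C M' : A' \<Longrightarrow> v; \<Gamma>; \<Gamma>' \<turnstile> N : B \<sqsubseteq>\<^sup>C N' : B'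
    \<Longrightarrow> v; \<Gamma>; \<Gamma>' \<turnstile> CCons M N : A \<^bold>\<times> B \<sqsubseteq>\<^sup>C CCons M' N' : A' \<^bold>\<times> B'"
| "v; \<Gamma>; \<Gamma>' \<turnstile> M : A \<^bold>\<times> B \<sqsubseteq>\<^sup>C M' : A' \<^bold>\<times> B' \<Longrightarrow> v; \<Gamma>; \<Gamma>' \<turnstile> CFst M : A \<sqsubseteq>\<^sup>C CFst M' : A'"
| "v; \<Gamma>; \<Gamma>' \<turnstile> M : A \<^bold>\<times> B \<sqsubseteq>\<^sup>C M' : A' \<^bold>\<times> B' \<Longrightarrow> v; \<Gamma>; \<Gamma>' \<turnstile> CSnd M : B \<sqsubseteq>\<^sup>C CSnd M' : B'"
| "v; \<Gamma>; \<Gamma>' \<turnstile> M : A \<sqsubseteq>\<^sup>C M' : A' \<Longrightarrow> B \<^bold>\<sqsubseteq> B'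
    \<Longrightarrow> v; \<Gamma>; \<Gamma>' \<turnstile> CInl B M : A \<^bold>+ B \<sqsubseteq>\<^sup>C CInl B' M' : A' \<^bold>+ B'"
| "v; \<Gamma>; \<Gamma>' \<turnstile> M : B \<sqsubseteq>\<^sup>C M' : B' \<Longrightarrow> A \<^bold>\<sqsubseteq> A'
    \<Longrightarrow> v; \<Gamma>; \<Gamma>' \<turnstile> CInr A M : A \<^bold>+ B \<sqsubseteq>\<^sup>C CInr A' M' : A' \<^bold>+ B'"
| "v; \<Gamma>; \<Gamma>' \<turnstile> L : A\<^sub>1 \<^bold>+ A\<^sub>2 \<sqsubseteq>\<^sup>C L' : A\<^sub>1' \<^bold>+ A\<^sub>2' \<Longrightarrow> A\<^sub>1 \<^bold>\<sqsubseteq> A\<^sub>1' \<Longrightarrow> A\<^sub>2 \<^bold>\<sqsubseteq> A\<^sub>2'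
    \<Longrightarrow> v; A\<^sub>1 # \<Gamma>; A\<^sub>1' # \<Gamma>' \<turnstile> M : B \<sqsubseteq>\<^sup>C M' : B' \<Longrightarrow> v; A\<^sub>2 # \<Gamma>; A\<^sub>2' # \<Gamma>' \<turnstile> N : B \<sqsubseteq>\<^sup>C N' : B'
    \<Longrightarrow> v; \<Gamma>; \<Gamma>' \<turnstile> CCase L M N : B \<sqsubseteq>\<^sup>C CCase L' M' N' : B'"
| "v; \<Gamma>; \<Gamma>' \<turnstile> M : src c \<sqsubseteq>\<^sup>C M' : src c' \<Longrightarrow> cast_ok c \<Longrightarrow> cast_ok c'
    \<Longrightarrow> src c \<^bold>\<sqsubseteq> src c' \<Longrightarrow> tgt c \<^bold>\<sqsubseteq> tgt c'
    \<Longrightarrow> v; \<Gamma>; \<Gamma>' \<turnstile> M\<langle>c\<rangle> : tgt c \<sqsubseteq>\<^sup>C M'\<langle>c'\<rangle> : tgt c'"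
| "v; \<Gamma>; \<Gamma>' \<turnstile> M : src c \<sqsubseteq>\<^sup>C M' : A' \<Longrightarrow> cast_ok c \<Longrightarrow> src c \<^bold>\<sqsubseteq> A' \<Longrightarrow> tgt c \<^bold>\<sqsubseteq> A'
    \<Longrightarrow> v; \<Gamma>; \<Gamma>' \<turnstile> M\<langle>c\<rangle> : tgt c \<sqsubseteq>\<^sup>C M' : A'"
| "v; \<Gamma>; \<Gamma>' \<turnstile> M : A \<sqsubseteq>\<^sup>C M' : src c' \<Longrightarrow> cast_ok c' \<Longrightarrow> A \<^bold>\<sqsubseteq> src c' \<Longrightarrow> A \<^bold>\<sqsubseteq> tgt c'
    \<Longrightarrow> v; \<Gamma>; \<Gamma>' \<turnstile> M : A \<sqsubseteq>\<^sup>C M'\<langle>c'\<rangle> : tgt c'"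
| "v; \<Gamma>; \<Gamma>' \<turnstile> M : src i \<sqsubseteq>\<^sup>C M' : src i' \<Longrightarrow> cast_ok i \<Longrightarrow> cast_ok i' \<Longrightarrow> inert v i \<Longrightarrow> inert v i'
    \<Longrightarrow> inert_prec v i i' \<Longrightarrow> (tgt i = Dyn \<Longrightarrow> tgt i' = Dyn)
    \<Longrightarrow> v; \<Gamma>; \<Gamma>' \<turnstile> M\<langle>\<langle>i\<rangle>\<rangle> : tgt i \<sqsubseteq>\<^sup>C M'\<langle>\<langle>i'\<rangle>\<rangle> : tgt i'"
| "v; \<Gamma>; \<Gamma>' \<turnstile> M : src i \<sqsubseteq>\<^sup>C M' : A' \<Longrightarrow> cast_ok i \<Longrightarrow> inert v i \<Longrightarrow> inert_prec_ty v i A'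
    \<Longrightarrow> v; \<Gamma>; \<Gamma>' \<turnstile> M\<langle>\<langle>i\<rangle>\<rangle> : tgt i \<sqsubseteq>\<^sup>C M' : A'"
| "v; \<Gamma>; \<Gamma>' \<turnstile> M : A \<sqsubseteq>\<^sup>C M' : src i' \<Longrightarrow> cast_ok i' \<Longrightarrow> inert v i' \<Longrightarrow> A \<noteq> Dyn
    \<Longrightarrow> ty_prec_inert v A i'
    \<Longrightarrow> v; \<Gamma>; \<Gamma>' \<turnstile> M : A \<sqsubseteq>\<^sup>C M'\<langle>\<langle>i'\<rangle>\<rangle> : tgt i'"
| "v; \<Gamma> \<turnstile> M : A \<Longrightarrow> A \<^bold>\<sqsubseteq> A'
    \<Longrightarrow> v; \<Gamma>; \<Gamma>' \<turnstile> M : A \<sqsubseteq>\<^sup>C CBlame A' l : A'"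

end

(*
  A pair of terms M, N with M below N is run in lockstep. By induction on the precision derivation,
  one of four things happens: both terms make at least one step to related terms; N reduces to
  blame; both reach related values; or both get stuck on a free variable in evaluation position.
  The two sides may take different numbers of steps, because in Variant 2 a cast between product
  or sum types on one side only passes through terms that are not related to the other side.
  Iterating, either both terms diverge or one of the other three outcomes is reached, and the four
  claims follow by determinism of reduction.
*)
theory Submission
  imports Defs
begin

section \<open>Types and precision\<close>

text \<open>Blame on the less precise side needs no outcome of its own. A projection there meets a
  tag \<open>G\<close> below the type of the other side, and its target is below that type too, so
  tag and target have the same outermost shape and the projection succeeds. New blame arises only on
  the side of \<open>N\<close>, when a projection from \<open>Dyn\<close> meets a tag that does not
  match. Single steps cannot be matched one by one, since a cast or wrapper may be present on one
  side only. Two devices deal with this. Casts applied to values are evaluated to the end on both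
  sides; this terminates by induction on types. Wrapped values in elimination position are handled
  by induction on the precision derivation: the side with the extra wrapper unrolls it alone, until
  constructors or wrappers that face each other let both sides step. The context is arbitrary, so
  open terms occur, and a free variable in evaluation position must be an outcome as well.\<close>

lemma ty_prec_simps [simp]:
  "Dyn \<^bold>\<sqsubseteq> A"
  "A \<^bold>\<sqsubseteq> Dyn \<longleftrightarrow> A = Dyn"
  "Base b \<^bold>\<sqsubseteq> A \<longleftrightarrow> A = Base b"
  "Bin k A\<^sub>1 A\<^sub>2 \<^bold>\<sqsubseteq> Base b \<longleftrightarrow> False"
  "Bin k A\<^sub>1 A\<^sub>2 \<^bold>\<sqsubseteq> Bin k' B\<^sub>1 B\<^sub>2 \<longleftrightarrow> k = k' \<and> A\<^sub>1 \<^bold>\<sqsubseteq> B\<^sub>1 \<and> A\<^sub>2 \<^bold>\<sqsubseteq> B\<^sub>2"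
  by (auto intro: ty_prec.intros elim: ty_prec.cases)

lemma ty_prec_refl [simp]: "A \<^bold>\<sqsubseteq> A"
  by (induction A) auto

lemma ty_prec_trans: "A \<^bold>\<sqsubseteq> B \<Longrightarrow> B \<^bold>\<sqsubseteq> C \<Longrightarrow> A \<^bold>\<sqsubseteq> C"
  by (induction arbitrary: C rule: ty_prec.induct) (auto elim: ty_prec.cases)

lemma consistent_simps [simp]:
  "A \<sim> Dyn"
  "Dyn \<sim> A"
  "Base b \<sim> Base b' \<longleftrightarrow> b = b'"
  "Base b \<sim> Bin k A\<^sub>1 A\<^sub>2 \<longleftrightarrow> False"
  "Bin k A\<^sub>1 A\<^sub>2 \<sim> Base b \<longleftrightarrow> False"
  "Bin k A\<^sub>1 A\<^sub>2 \<sim> Bin k' B\<^sub>1 B\<^sub>2 \<longleftrightarrow> k = k' \<and> A\<^sub>1 \<sim> B\<^sub>1 \<and> A\<^sub>2 \<sim> B\<^sub>2"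
  by (auto intro: consistent.intros elim: consistent.cases)

lemma consistent_refl [simp]: "A \<sim> A"
  by (induction A) auto

lemma consistent_sym: "A \<sim> B \<Longrightarrow> B \<sim> A"
  by (induction rule: consistent.induct) auto

lemma ground_simps [simp]:
  "ground (Base b)"
  "\<not> ground Dyn"
  "ground (Bin k A B) \<longleftrightarrow> A = Dyn \<and> B = Dyn"
  by (auto intro: ground.intros elim: ground.cases)

lemma gnd_eq_ground: "ground G \<Longrightarrow> gnd G = G"
  by (auto elim: ground.cases)

lemma ground_gnd: "A \<noteq> Dyn \<Longrightarrow> ground (gnd A)"
  by (cases A) auto

lemma consistent_gnd: "A \<noteq> Dyn \<Longrightarrow> gnd A \<sim> A"
  by (cases A) auto

lemma ground_prec_gnd: "ground G \<Longrightarrow> G \<^bold>\<sqsubseteq> A \<Longrightarrow> A \<noteq> Dyn \<and> gnd A = G"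
  by (cases A; cases G) auto

lemma prec_gnd_eq: "B \<^bold>\<sqsubseteq> A \<Longrightarrow> B \<noteq> Dyn \<Longrightarrow> gnd B = gnd A"
  by (cases A; cases B) auto

text \<open>With \<open>join_least\<close> this says that, on consistent types, the join is the
  least upper bound for precision. Monotonicity of the join follows; it is needed for the branch
  casts of compiled conditionals and case terms, whose targets are joins.\<close>

lemma join_upper:
  "A \<sim> B \<Longrightarrow> A \<^bold>\<sqsubseteq> A \<^bold>\<squnion> B" "A \<sim> B \<Longrightarrow> B \<^bold>\<sqsubseteq> A \<^bold>\<squnion> B"
proof -
  assume "A \<sim> B"
  then have "A \<^bold>\<sqsubseteq> A \<^bold>\<squnion> B \<and> B \<^bold>\<sqsubseteq> A \<^bold>\<squnion> B"
  proof (induction rule: consistent.induct)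
    case (2 B) then show ?case by (cases B) auto
  qed auto
  then show "A \<^bold>\<sqsubseteq> A \<^bold>\<squnion> B" "B \<^bold>\<sqsubseteq> A \<^bold>\<squnion> B" by auto
qed

lemma join_least: "A \<sim> B \<Longrightarrow> A \<^bold>\<sqsubseteq> C \<Longrightarrow> B \<^bold>\<sqsubseteq> C \<Longrightarrow> A \<^bold>\<squnion> B \<^bold>\<sqsubseteq> C"
proof (induction arbitrary: C rule: consistent.induct)
  case (2 B) then show ?case by (cases B) auto
next
  case (4 A A' B B' c) then show ?case by (cases C) auto
qed auto

lemma join_mono:
  "A \<sim> B \<Longrightarrow> A' \<sim> B' \<Longrightarrow> A \<^bold>\<sqsubseteq> A' \<Longrightarrow> B \<^bold>\<sqsubseteq> B' \<Longrightarrow> A \<^bold>\<squnion> B \<^bold>\<sqsubseteq> A' \<^bold>\<squnion> B'"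
  by (blast intro: join_least ty_prec_trans join_upper)

lemma ty_prec_consistent: "A \<^bold>\<sqsubseteq> B \<Longrightarrow> A \<sim> B"
  by (induction rule: ty_prec.induct) auto

section \<open>Determinism of reduction\<close>

lemma inert_iff:
  "inert v (A \<Rightarrow>\<^bsub>l\<^esub> B) \<longleftrightarrow> ground A \<and> B = Dyn \<or>
    (\<exists>k A\<^sub>1 A\<^sub>2 B\<^sub>1 B\<^sub>2. A = Bin k A\<^sub>1 A\<^sub>2 \<and> B = Bin k B\<^sub>1 B\<^sub>2 \<and> (v = Variant1 \<or> k = Arr))"
  by (cases v) (auto intro: inert.intros elim: inert.cases)

lemma active_iff:
  "active v (A \<Rightarrow>\<^bsub>l\<^esub> B) \<longleftrightarrow> atomic A \<and> A = B \<or> A \<noteq> Dyn \<and> \<not> ground A \<and> B = Dyn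
    \<or> A = Dyn \<and> B \<noteq> Dyn
    \<or> v = Variant2 \<and> (\<exists>k A\<^sub>1 A\<^sub>2 B\<^sub>1 B\<^sub>2. A = Bin k A\<^sub>1 A\<^sub>2 \<and> B = Bin k B\<^sub>1 B\<^sub>2 \<and> k \<noteq> Arr)"
  apply (rule iffI)
   apply (erule active.cases; auto)
  apply (auto intro: active.intros)
  subgoal for k by (cases k) (auto intro: active.intros)
  done

lemma atomic_simps [simp]: "atomic (Base b)" "atomic Dyn" "\<not> atomic (Bin k A B)"
  by (auto intro: atomic.intros elim: atomic.cases)

lemma active_not_inert: "active v c \<Longrightarrow> \<not> inert v c"
  by (cases c) (auto simp: active_iff inert_iff)

lemma is_value_simps [simp]:
  "is_value v (CLam A M)"
  "is_value v (CConst P k)"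
  "is_value v (CCons M N) \<longleftrightarrow> is_value v M \<and> is_value v N"
  "is_value v (CInl B M) \<longleftrightarrow> is_value v M"
  "is_value v (CInr B M) \<longleftrightarrow> is_value v M"
  "is_value v (M\<langle>\<langle>c\<rangle>\<rangle>) \<longleftrightarrow> is_value v M \<and> inert v c"
  "\<not> is_value v (CVar x)"
  "\<not> is_value v (CApp L M)"
  "\<not> is_value v (CIf L M N)"
  "\<not> is_value v (CFst M)"
  "\<not> is_value v (CSnd M)"
  "\<not> is_value v (CCase L M N)"
  "\<not> is_value v (M\<langle>c\<rangle>)"
  "\<not> is_value v (CBlame A l)"
  by (auto intro: is_value.intros elim: is_value.cases)

lemma value_frameD: "frame v F \<Longrightarrow> is_value v (F M) \<Longrightarrow> is_value v M"
  by (erule frame.cases) auto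

lemma value_no_step: "step v \<Gamma> M N \<Longrightarrow> \<not> is_value v M"
  by (induction rule: step.induct) (auto dest: value_frameD)

text \<open>Frames encode a fixed evaluation order: the right hole of an application or a pair
  requires a value on the left. A left component that is not a value therefore leaves only the left
  frame possible.\<close>

lemma frame_unique:
  "frame v F \<Longrightarrow> frame v G \<Longrightarrow> F M = G N \<Longrightarrow> \<not> is_value v M \<Longrightarrow> \<not> is_value v N \<Longrightarrow> F = G \<and> M = N"
  by (erule frame.cases; erule frame.cases; simp; blast)

text \<open>Neither congruence nor blame propagation applies to such a term, because values do not
  step and blame is not a value. Left-hand sides of all other rules have this property, so a step is
  classified either by \<open>step_frame_cases\<close> or by
  \<open>step_redex_cases\<close>.\<close>

definition at_redex :: "variant \<Rightarrow> 'l tm \<Rightarrow> bool" where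
  "at_redex v X \<longleftrightarrow> (\<forall>F M. frame v F \<longrightarrow> X = F M \<longrightarrow> is_value v M)"

lemma at_redexI [simp]:
  "is_value v L \<Longrightarrow> is_value v M \<Longrightarrow> at_redex v (CApp L M)"
  "is_value v L \<Longrightarrow> at_redex v (CIf L M N)"
  "is_value v L \<Longrightarrow> at_redex v (CFst L)"
  "is_value v L \<Longrightarrow> at_redex v (CSnd L)"
  "is_value v L \<Longrightarrow> at_redex v (CCase L M N)"
  "is_value v L \<Longrightarrow> at_redex v (L\<langle>c\<rangle>)"
  unfolding at_redex_def by (auto elim!: frame.cases)

lemma at_redexD: "at_redex v (F M) \<Longrightarrow> frame v F \<Longrightarrow> is_value v M"
  unfolding at_redex_def by blast

lemma step_frame_cases:
  assumes "step v \<Gamma> (F M) N" "frame v F" "\<not> is_value v M"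
  obtains M' where "step v \<Gamma> M M'" "N = F M'"
  | A l B where "M = CBlame A l" "v; \<Gamma> \<turnstile> F (CBlame A l) : B" "N = CBlame B l"
proof -
  have *: "\<not> at_redex v (F M)"
    using assms at_redexD by blast
  from assms(1) show thesis
  proof cases
    case (1 G L L')
    then have "G = F \<and> L = M"
      using frame_unique[of v G F L M] assms value_no_step by metis
    then show ?thesis using 1 that by blast
  next
    case (2 G A l B)
    then have "G = F \<and> CBlame A l = M"
      using frame_unique[of v G F _ M] assms by force
    then show ?thesis using 2 that by blast
  qed (use * in \<open>simp; fastforce\<close>)+
qed

lemma step_redex_cases:
  assumes "step v \<Gamma> X N" "at_redex v X"
  obtains V c where "X = V\<langle>c\<rangle>" "active v c" "apply_cast v V c N"
  | V c where "X = V\<langle>c\<rangle>" "inert v c" "N = V\<langle>\<langle>c\<rangle>\<rangle>"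
  | V W c where "X = CApp (V\<langle>\<langle>c\<rangle>\<rangle>) W" "N = (CApp V (W\<langle>cdom c\<rangle>))\<langle>ccod c\<rangle>"
  | V c where "X = CFst (V\<langle>\<langle>c\<rangle>\<rangle>)" "N = (CFst V)\<langle>cfst c\<rangle>"
  | V c where "X = CSnd (V\<langle>\<langle>c\<rangle>\<rangle>)" "N = (CSnd V)\<langle>csnd c\<rangle>"
  | V c M M' where "X = CCase (V\<langle>\<langle>c\<rangle>\<rangle>) M M'"
      "N = CCase V (cast_var0 (cinl c) M) (cast_var0 (cinr c) M')"
  | A M V where "X = CApp (CLam A M) V" "N = subst0 M V"
  | M where "X = CIf (CConst (PBase BoolB) (KBase (VBool True))) N M"
  | M where "X = CIf (CConst (PBase BoolB) (KBase (VBool False))) M N"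
  | W where "X = CFst (CCons N W)"
  | V where "X = CSnd (CCons V N)"
  | B V M M' where "X = CCase (CInl B V) M M'" "N = subst0 M V"
  | A V M M' where "X = CCase (CInr A V) M M'" "N = subst0 M' V"
  | b P f u where "X = CApp (CConst (PFun b P) (KFun f)) (CConst (PBase b) (KBase u))"
      "N = CConst P (f u)"
  using assms(1)
proof cases
  case (1 F M M')
  then show ?thesis using assms(2) at_redexD value_no_step by blast
next
  case (2 F A l B)
  then show ?thesis using assms(2) at_redexD by fastforce
qed (use that in blast)+

lemma frame_not_blame: "frame v F \<Longrightarrow> F M \<noteq> CBlame A l"
  by (erule frame.cases) auto

lemma frame_not_var: "frame v F \<Longrightarrow> F M \<noteq> CVar x"
  by (erule frame.cases) auto

lemma blame_no_step: "\<not> step v \<Gamma> (CBlame A l) N"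
proof
  assume "step v \<Gamma> (CBlame A l) N"
  then show False
    by cases (use frame_not_blame in metis)+
qed

lemma apply_cast_fun: "apply_cast v V c M \<Longrightarrow> apply_cast v V c M' \<Longrightarrow> M = M'"
  by (erule apply_cast.cases; erule apply_cast.cases; simp; auto)

inductive_cases typing_inv:
  "v; \<Gamma> \<turnstile> CConst P k : B"
  "v; \<Gamma> \<turnstile> CVar x : B"
  "v; \<Gamma> \<turnstile> CLam A M : B"
  "v; \<Gamma> \<turnstile> CApp L M : B"
  "v; \<Gamma> \<turnstile> CIf L M N : B"
  "v; \<Gamma> \<turnstile> CCons M N : B"
  "v; \<Gamma> \<turnstile> CFst M : B"
  "v; \<Gamma> \<turnstile> CSnd M : B"
  "v; \<Gamma> \<turnstile> CInl A M : B"
  "v; \<Gamma> \<turnstile> CInr A M : B"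
  "v; \<Gamma> \<turnstile> CCase L M N : B"
  "v; \<Gamma> \<turnstile> M\<langle>c\<rangle> : B"
  "v; \<Gamma> \<turnstile> M\<langle>\<langle>c\<rangle>\<rangle> : B"
  "v; \<Gamma> \<turnstile> CBlame A l : B"

lemma typing_unique: "v; \<Gamma> \<turnstile> M : A \<Longrightarrow> v; \<Gamma> \<turnstile> M : B \<Longrightarrow> A = B"
  by (induction arbitrary: B rule: typing.induct) (erule typing_inv; blast)+

lemma step_deterministic: "step v \<Gamma> M N \<Longrightarrow> step v \<Gamma> M N' \<Longrightarrow> N = N'"
proof (induction arbitrary: N' rule: step.induct)
  case (1 F M M')
  from 1(4,1) show ?case
    by (rule step_frame_cases) (use 1 in \<open>auto simp: blame_no_step dest: value_no_step\<close>)
next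
  case (2 F A l B)
  \<comment> \<open>The annotation of the resulting blame is read off a typing derivation, so
    uniqueness of types is what makes the two results equal.\<close>
  from 2(3,1) show ?case
    by (rule step_frame_cases) (use 2(2) in \<open>auto simp: blame_no_step dest: typing_unique\<close>)
next
  case (3 V c M)
  from 3(4) show ?case
    by (rule step_redex_cases, use 3(1) in simp) (use 3 active_not_inert apply_cast_fun in blast)+
next
  case (4 V c)
  from 4(3) show ?case
    by (rule step_redex_cases, use 4(1) in simp) (use 4 active_not_inert in blast)+
qed (erule step_redex_cases; simp)+

section \<open>Substitution\<close>

lemma cprec_typing:
  "v; \<Gamma>; \<Gamma>' \<turnstile> M : A \<sqsubseteq>\<^sup>C M' : A' \<Longrightarrow> v; \<Gamma> \<turnstile> M : A \<and> v; \<Gamma>' \<turnstile> M' : A'"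
  by (induction rule: cprec.induct) (auto intro: typing.intros)

definition ren_ok :: "(nat \<Rightarrow> nat) \<Rightarrow> ctx \<Rightarrow> ctx \<Rightarrow> bool" where
  "ren_ok \<rho> \<Gamma> \<Delta> \<longleftrightarrow> (\<forall>x < length \<Gamma>. \<rho> x < length \<Delta> \<and> \<Delta> ! \<rho> x = \<Gamma> ! x)"

lemma ren_ok_ext: "ren_ok \<rho> \<Gamma> \<Delta> \<Longrightarrow> ren_ok (case_nat 0 (Suc \<circ> \<rho>)) (A # \<Gamma>) (A # \<Delta>)"
  by (auto simp: ren_ok_def split: nat.split)

lemma ren_ok_Suc: "ren_ok Suc \<Gamma> (A # \<Gamma>)"
  by (simp add: ren_ok_def)

lemma typing_ren: "v; \<Gamma> \<turnstile> M : A \<Longrightarrow> ren_ok \<rho> \<Gamma> \<Delta> \<Longrightarrow> v; \<Delta> \<turnstile> ren \<rho> M : A"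
proof (induction arbitrary: \<rho> \<Delta> rule: typing.induct)
  case (2 x \<Gamma>)
  then show ?case
    using typing.intros(2)[of "\<rho> x" \<Delta> v] by (auto simp: ren_ok_def)
qed (use ren_ok_ext in \<open>fastforce intro: typing.intros\<close>)+

lemma cprec_ren:
  "v; \<Gamma>; \<Gamma>' \<turnstile> M : A \<sqsubseteq>\<^sup>C M' : A' \<Longrightarrow> ren_ok \<rho> \<Gamma> \<Delta> \<Longrightarrow> ren_ok \<rho> \<Gamma>' \<Delta>'
    \<Longrightarrow> v; \<Delta>; \<Delta>' \<turnstile> ren \<rho> M : A \<sqsubseteq>\<^sup>C ren \<rho> M' : A'"
proof (induction arbitrary: \<rho> \<Delta> \<Delta>' rule: cprec.induct)
  case (2 x \<Gamma> \<Gamma>')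
  then show ?case
    using cprec.intros(2)[of "\<rho> x" \<Delta> \<Delta>' v] by (auto simp: ren_ok_def)
next
  case (3 A \<Gamma> A' \<Gamma>' N B N' B')
  show ?case
    using cprec.intros(3)[OF 3(3)[OF ren_ok_ext ren_ok_ext] 3(2)] 3(4-) by simp
next
  case (11 \<Gamma> \<Gamma>' L A\<^sub>1 A\<^sub>2 L' A\<^sub>1' A\<^sub>2' M B M' B' N N')
  show ?case
    using cprec.intros(11)[OF 11(6)[OF 11(9,10)] 11(2,3) 11(7)[OF ren_ok_ext ren_ok_ext]
        11(8)[OF ren_ok_ext ren_ok_ext]] 11(9-)
    by simp
qed ((simp only: ren.simps, rule cprec.intros; blast intro: typing_ren)[1])+

definition sub_ok :: "variant \<Rightarrow> (nat \<Rightarrow> 'l tm) \<Rightarrow> ctx \<Rightarrow> ctx \<Rightarrow> bool" where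
  "sub_ok v \<sigma> \<Gamma> \<Delta> \<longleftrightarrow> (\<forall>x < length \<Gamma>. v; \<Delta> \<turnstile> \<sigma> x : \<Gamma> ! x)"

text \<open>The asymmetry comes from the rule that puts blame on the right: it asks only for a
  typing of the left term and leaves the right context free. The right context may even be shorter,
  so typing of the left substitution is required for all of \<open>\<Gamma>\<close>, but relatedness
  only where both contexts are defined.\<close>

definition sub_prec ::
  "variant \<Rightarrow> ctx \<Rightarrow> ctx \<Rightarrow> (nat \<Rightarrow> 'l tm) \<Rightarrow> ctx \<Rightarrow> (nat \<Rightarrow> 'l tm) \<Rightarrow> ctx \<Rightarrow> bool" where
  "sub_prec v \<Delta> \<Delta>' \<sigma> \<Gamma> \<sigma>' \<Gamma>' \<longleftrightarrow> sub_ok v \<sigma> \<Gamma> \<Delta> \<and>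
    (\<forall>x. x < length \<Gamma> \<longrightarrow> x < length \<Gamma>' \<longrightarrow> v; \<Delta>; \<Delta>' \<turnstile> \<sigma> x : \<Gamma> ! x \<sqsubseteq>\<^sup>C \<sigma>' x : \<Gamma>' ! x)"

lemma sub_ok_exts: "sub_ok v \<sigma> \<Gamma> \<Delta> \<Longrightarrow> sub_ok v (exts \<sigma>) (A # \<Gamma>) (A # \<Delta>)"
  using typing.intros(2)[of 0 "A # \<Delta>" v]
  by (auto simp: sub_ok_def exts_def intro: typing_ren ren_ok_Suc split: nat.split)

lemma sub_prec_exts:
  "sub_prec v \<Delta> \<Delta>' \<sigma> \<Gamma> \<sigma>' \<Gamma>'
    \<Longrightarrow> sub_prec v (A # \<Delta>) (A' # \<Delta>') (exts \<sigma>) (A # \<Gamma>) (exts \<sigma>') (A' # \<Gamma>')"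
  using cprec.intros(2)[of 0 "A # \<Delta>" "A' # \<Delta>'" v]
  by (auto simp: sub_prec_def sub_ok_exts)
    (auto simp: exts_def intro: cprec_ren ren_ok_Suc split: nat.split)

lemma typing_sub: "v; \<Gamma> \<turnstile> M : A \<Longrightarrow> sub_ok v \<sigma> \<Gamma> \<Delta> \<Longrightarrow> v; \<Delta> \<turnstile> sub \<sigma> M : A"
proof (induction arbitrary: \<sigma> \<Delta> rule: typing.induct)
  case (2 x \<Gamma>)
  then show ?case by (auto simp: sub_ok_def)
qed (use sub_ok_exts in \<open>fastforce intro: typing.intros\<close>)+

lemma cprec_sub:
  "v; \<Gamma>; \<Gamma>' \<turnstile> M : A \<sqsubseteq>\<^sup>C M' : A' \<Longrightarrow> sub_prec v \<Delta> \<Delta>' \<sigma> \<Gamma> \<sigma>' \<Gamma>'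
    \<Longrightarrow> v; \<Delta>; \<Delta>' \<turnstile> sub \<sigma> M : A \<sqsubseteq>\<^sup>C sub \<sigma>' M' : A'"
proof (induction arbitrary: \<sigma> \<sigma>' \<Delta> \<Delta>' rule: cprec.induct)
  case (2 x \<Gamma> \<Gamma>')
  then show ?case by (auto simp: sub_prec_def)
next
  case (3 A \<Gamma> A' \<Gamma>' N B N' B')
  show ?case
    using cprec.intros(3)[OF 3(3)[OF sub_prec_exts] 3(2)] 3(4-) by simp
next
  case (11 \<Gamma> \<Gamma>' L A\<^sub>1 A\<^sub>2 L' A\<^sub>1' A\<^sub>2' M B M' B' N N')
  show ?case
    using cprec.intros(11)[OF 11(6)[OF 11(9)] 11(2,3) 11(7)[OF sub_prec_exts] 11(8)[OF sub_prec_exts]] 11(9-)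
    by simp
next
  case (18 \<Gamma> M A A' \<Gamma>' l)
  then show ?case
    by (auto simp: sub_prec_def intro: cprec.intros(18) typing_sub)
qed ((simp only: sub.simps, rule cprec.intros; blast)[1])+

lemma cprec_subst0:
  assumes "v; A # \<Gamma>; A' # \<Gamma>' \<turnstile> M : B \<sqsubseteq>\<^sup>C M' : B'" and "v; \<Gamma>; \<Gamma>' \<turnstile> V : A \<sqsubseteq>\<^sup>C V' : A'"
  shows "v; \<Gamma>; \<Gamma>' \<turnstile> subst0 M V : B \<sqsubseteq>\<^sup>C subst0 M' V' : B'"
  unfolding subst0_def using assms(1)
proof (rule cprec_sub)
  show "sub_prec v \<Gamma> \<Gamma>' (case_nat V CVar) (A # \<Gamma>) (case_nat V' CVar) (A' # \<Gamma>')"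
    using assms(2) cprec_typing[OF assms(2)]
    by (auto simp: sub_prec_def sub_ok_def intro: typing.intros cprec.intros(2) split: nat.split)
qed

lemma sub_CVar: "sub CVar M = (M :: 'l tm)"
proof -
  have "exts CVar = (CVar :: nat \<Rightarrow> 'l tm)"
    by (auto simp: exts_def fun_eq_iff split: nat.split)
  then show ?thesis by (induction M) auto
qed

text \<open>Covers the substitution in \<open>cast_var0\<close>: variable 0 stays bound but gets the
  new types \<open>C\<close> and \<open>C'\<close>, hence the changed heads of both contexts, while
  all other variables are mapped to themselves.\<close>

lemma cprec_sub_var0:
  assumes "v; A # \<Gamma>; A' # \<Gamma>' \<turnstile> M : B \<sqsubseteq>\<^sup>C M' : B'"
    and "v; C # \<Gamma>; C' # \<Gamma>' \<turnstile> X : A \<sqsubseteq>\<^sup>C X' : A'"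
  shows "v; C # \<Gamma>; C' # \<Gamma>' \<turnstile> sub (case_nat X (CVar \<circ> Suc)) M : B
    \<sqsubseteq>\<^sup>C sub (case_nat X' (CVar \<circ> Suc)) M' : B'"
  using assms(1)
proof (rule cprec_sub)
  have "v; C # \<Gamma>; C' # \<Gamma>' \<turnstile> CVar (Suc x) : \<Gamma> ! x \<sqsubseteq>\<^sup>C CVar (Suc x) : \<Gamma>' ! x"
    if "x < length \<Gamma>" "x < length \<Gamma>'" for x
    using cprec.intros(2)[of "Suc x" "C # \<Gamma>" "C' # \<Gamma>'" v] that by simp
  moreover have "v; C # \<Gamma> \<turnstile> CVar (Suc x) : \<Gamma> ! x" if "x < length \<Gamma>" for x
    using typing.intros(2)[of "Suc x" "C # \<Gamma>" v] that by simp
  ultimately show "sub_prec v (C # \<Gamma>) (C' # \<Gamma>') (case_nat X (CVar \<circ> Suc)) (A # \<Gamma>)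
      (case_nat X' (CVar \<circ> Suc)) (A' # \<Gamma>')"
    using assms(2) cprec_typing[OF assms(2)]
    by (auto simp: sub_prec_def sub_ok_def split: nat.split)
qed

lemma case_nat_CVar: "case_nat (CVar 0) (CVar \<circ> Suc) = CVar"
  by (auto simp: fun_eq_iff split: nat.split)

section \<open>Precision rules for casts and wrappers with explicit source and target types\<close>

lemma cprec_castLR:
  assumes "v; \<Gamma>; \<Gamma>' \<turnstile> M : A \<sqsubseteq>\<^sup>C M' : A'" "A \<sim> B" "A' \<sim> B'" "A \<^bold>\<sqsubseteq> A'" "B \<^bold>\<sqsubseteq> B'"
  shows "v; \<Gamma>; \<Gamma>' \<turnstile> M\<langle>A \<Rightarrow>\<^bsub>l\<^esub> B\<rangle> : B \<sqsubseteq>\<^sup>C M'\<langle>A' \<Rightarrow>\<^bsub>l'\<^esub> B'\<rangle> : B'"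
  using cprec.intros(12)[of v \<Gamma> \<Gamma>' M "A \<Rightarrow>\<^bsub>l\<^esub> B" M' "A' \<Rightarrow>\<^bsub>l'\<^esub> B'"] assms by (simp add: cast_ok_def)

lemma cprec_castL:
  assumes "v; \<Gamma>; \<Gamma>' \<turnstile> M : A \<sqsubseteq>\<^sup>C M' : A'" "A \<sim> B" "A \<^bold>\<sqsubseteq> A'" "B \<^bold>\<sqsubseteq> A'"
  shows "v; \<Gamma>; \<Gamma>' \<turnstile> M\<langle>A \<Rightarrow>\<^bsub>l\<^esub> B\<rangle> : B \<sqsubseteq>\<^sup>C M' : A'"
  using cprec.intros(13)[of v \<Gamma> \<Gamma>' M "A \<Rightarrow>\<^bsub>l\<^esub> B" M' A'] assms by (simp add: cast_ok_def)

lemma cprec_castR: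
  assumes "v; \<Gamma>; \<Gamma>' \<turnstile> M : A \<sqsubseteq>\<^sup>C M' : A'" "A' \<sim> B'" "A \<^bold>\<sqsubseteq> A'" "A \<^bold>\<sqsubseteq> B'"
  shows "v; \<Gamma>; \<Gamma>' \<turnstile> M : A \<sqsubseteq>\<^sup>C M'\<langle>A' \<Rightarrow>\<^bsub>l\<^esub> B'\<rangle> : B'"
  using cprec.intros(14)[of v \<Gamma> \<Gamma>' M A M' "A' \<Rightarrow>\<^bsub>l\<^esub> B'"] assms by (simp add: cast_ok_def)

lemma cprec_wrapLR_Dyn:
  assumes "v; \<Gamma>; \<Gamma>' \<turnstile> M : G \<sqsubseteq>\<^sup>C M' : G" "ground G"
  shows "v; \<Gamma>; \<Gamma>' \<turnstile> M\<langle>\<langle>G \<Rightarrow>\<^bsub>l\<^esub> Dyn\<rangle>\<rangle> : Dyn \<sqsubseteq>\<^sup>C M'\<langle>\<langle>G \<Rightarrow>\<^bsub>l'\<^esub> Dyn\<rangle>\<rangle> : Dyn"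
  using cprec.intros(15)[of v \<Gamma> \<Gamma>' M "G \<Rightarrow>\<^bsub>l\<^esub> Dyn" M' "G \<Rightarrow>\<^bsub>l'\<^esub> Dyn"] assms
  by (simp add: cast_ok_def inert_iff inert_prec.intros)

lemma cprec_wrapLR_cross:
  assumes "v; \<Gamma>; \<Gamma>' \<turnstile> M : Bin k A\<^sub>1 A\<^sub>2 \<sqsubseteq>\<^sup>C M' : Bin k A\<^sub>1' A\<^sub>2'"
    "Bin k A\<^sub>1 A\<^sub>2 \<sim> Bin k B\<^sub>1 B\<^sub>2" "Bin k A\<^sub>1' A\<^sub>2' \<sim> Bin k B\<^sub>1' B\<^sub>2'"
    "Bin k A\<^sub>1 A\<^sub>2 \<^bold>\<sqsubseteq> Bin k A\<^sub>1' A\<^sub>2'" "Bin k B\<^sub>1 B\<^sub>2 \<^bold>\<sqsubseteq> Bin k B\<^sub>1' B\<^sub>2'" "v = Variant1 \<or> k = Arr"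
  shows "v; \<Gamma>; \<Gamma>' \<turnstile> M\<langle>\<langle>Bin k A\<^sub>1 A\<^sub>2 \<Rightarrow>\<^bsub>l\<^esub> Bin k B\<^sub>1 B\<^sub>2\<rangle>\<rangle> : Bin k B\<^sub>1 B\<^sub>2
    \<sqsubseteq>\<^sup>C M'\<langle>\<langle>Bin k A\<^sub>1' A\<^sub>2' \<Rightarrow>\<^bsub>l'\<^esub> Bin k B\<^sub>1' B\<^sub>2'\<rangle>\<rangle> : Bin k B\<^sub>1' B\<^sub>2'"
proof -
  have *: "inert_prec v (Bin k A\<^sub>1 A\<^sub>2 \<Rightarrow>\<^bsub>l\<^esub> Bin k B\<^sub>1 B\<^sub>2) (Bin k A\<^sub>1' A\<^sub>2' \<Rightarrow>\<^bsub>l'\<^esub> Bin k B\<^sub>1' B\<^sub>2')"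
    by (rule inert_prec.intros(2)[OF refl refl]) (use assms in \<open>simp_all add: inert_iff\<close>)
  show ?thesis
    using cprec.intros(15)[OF _ _ _ _ _ *, of \<Gamma> \<Gamma>' M M'] assms
    by (simp add: cast_ok_def inert_iff)
qed

lemma cprec_wrapL_Dyn:
  assumes "v; \<Gamma>; \<Gamma>' \<turnstile> M : G \<sqsubseteq>\<^sup>C M' : A'" "ground G" "G \<^bold>\<sqsubseteq> A'"
  shows "v; \<Gamma>; \<Gamma>' \<turnstile> M\<langle>\<langle>G \<Rightarrow>\<^bsub>l\<^esub> Dyn\<rangle>\<rangle> : Dyn \<sqsubseteq>\<^sup>C M' : A'"
  using cprec.intros(16)[of v \<Gamma> \<Gamma>' M "G \<Rightarrow>\<^bsub>l\<^esub> Dyn" M' A'] assms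
  by (simp add: cast_ok_def inert_iff inert_prec_ty.intros)

lemma cprec_wrapL_cross:
  assumes "v; \<Gamma>; \<Gamma>' \<turnstile> M : Bin k A\<^sub>1 A\<^sub>2 \<sqsubseteq>\<^sup>C M' : A'"
    "Bin k A\<^sub>1 A\<^sub>2 \<sim> Bin k B\<^sub>1 B\<^sub>2" "Bin k A\<^sub>1 A\<^sub>2 \<^bold>\<sqsubseteq> A'" "Bin k B\<^sub>1 B\<^sub>2 \<^bold>\<sqsubseteq> A'" "v = Variant1 \<or> k = Arr"
  shows "v; \<Gamma>; \<Gamma>' \<turnstile> M\<langle>\<langle>Bin k A\<^sub>1 A\<^sub>2 \<Rightarrow>\<^bsub>l\<^esub> Bin k B\<^sub>1 B\<^sub>2\<rangle>\<rangle> : Bin k B\<^sub>1 B\<^sub>2 \<sqsubseteq>\<^sup>C M' : A'"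
proof -
  obtain A\<^sub>1' A\<^sub>2' where A': "A' = Bin k A\<^sub>1' A\<^sub>2'"
    using assms(3) by (cases A') auto
  have *: "inert_prec_ty v (Bin k A\<^sub>1 A\<^sub>2 \<Rightarrow>\<^bsub>l\<^esub> Bin k B\<^sub>1 B\<^sub>2) A'"
    by (rule inert_prec_ty.intros(2)[OF refl _ A']) (use assms in \<open>simp_all add: inert_iff\<close>)
  show ?thesis
    using cprec.intros(16)[OF _ _ _ *, of \<Gamma> \<Gamma>' M M'] assms
    by (simp add: cast_ok_def inert_iff)
qed

lemma cprec_wrapR_cross:
  assumes "v; \<Gamma>; \<Gamma>' \<turnstile> M : A \<sqsubseteq>\<^sup>C M' : Bin k A\<^sub>1' A\<^sub>2'" "A \<noteq> Dyn"
    "Bin k A\<^sub>1' A\<^sub>2' \<sim> Bin k B\<^sub>1' B\<^sub>2'" "A \<^bold>\<sqsubseteq> Bin k A\<^sub>1' A\<^sub>2'" "A \<^bold>\<sqsubseteq> Bin k B\<^sub>1' B\<^sub>2'"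
    "v = Variant1 \<or> k = Arr"
  shows "v; \<Gamma>; \<Gamma>' \<turnstile> M : A \<sqsubseteq>\<^sup>C M'\<langle>\<langle>Bin k A\<^sub>1' A\<^sub>2' \<Rightarrow>\<^bsub>l\<^esub> Bin k B\<^sub>1' B\<^sub>2'\<rangle>\<rangle> : Bin k B\<^sub>1' B\<^sub>2'"
proof -
  obtain A\<^sub>1 A\<^sub>2 where A: "A = Bin k A\<^sub>1 A\<^sub>2"
    using assms(2,4) by (cases A) auto
  have *: "ty_prec_inert v A (Bin k A\<^sub>1' A\<^sub>2' \<Rightarrow>\<^bsub>l\<^esub> Bin k B\<^sub>1' B\<^sub>2')"
    by (rule ty_prec_inert.intros[OF refl _ A]) (use assms in \<open>simp_all add: inert_iff\<close>)
  show ?thesis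
    using cprec.intros(17)[OF _ _ _ assms(2) *, of \<Gamma> \<Gamma>' M M'] assms
    by (simp add: cast_ok_def inert_iff)
qed

section \<open>Outcomes of a pair of related terms\<close>

text \<open>Since the context need not be empty, evaluation can arrive at a free variable. Such
  terms are normal without being values or blame.\<close>

inductive stuck :: "variant \<Rightarrow> 'l tm \<Rightarrow> bool" for v :: variant where
  "stuck v (CVar x)"
| "frame v F \<Longrightarrow> stuck v M \<Longrightarrow> stuck v (F M)"

lemma stuck_not_value: "stuck v M \<Longrightarrow> \<not> is_value v M"
  by (induction rule: stuck.induct) (auto dest: value_frameD)

lemma var_no_step: "\<not> step v \<Gamma> (CVar x) N"
proof
  assume "step v \<Gamma> (CVar x) N"
  then show False
    by cases (use frame_not_var in metis)+
qed

lemma stuck_no_step: "stuck v M \<Longrightarrow> \<not> step v \<Gamma> M N"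
proof (induction arbitrary: N rule: stuck.induct)
  case (1 x)
  show ?case by (rule var_no_step)
next
  case (2 F M)
  show ?case
  proof
    assume "step v \<Gamma> (F M) N"
    then show False
      using 2(1) stuck_not_value[OF 2(2)]
    proof (cases rule: step_frame_cases)
      case (1 M')
      then show ?thesis using 2(3) by blast
    next
      case (2 A l B)
      with \<open>stuck v M\<close> show ?thesis
        by (auto elim: stuck.cases dest: frame_not_blame[THEN not_sym])
    qed
  qed
qed

text \<open>The identity is included so that a cast on one side only is a pair of evaluation contexts, too.\<close>

definition eframe :: "variant \<Rightarrow> ('l tm \<Rightarrow> 'l tm) \<Rightarrow> bool" where
  "eframe v F \<longleftrightarrow> frame v F \<or> F = (\<lambda>X. X)"

lemma eframe_id [simp]: "eframe v (\<lambda>X. X)"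
  by (simp add: eframe_def)

lemma eframeI: "frame v F \<Longrightarrow> eframe v F"
  by (simp add: eframe_def)

lemma eframe_step: "eframe v F \<Longrightarrow> step v \<Gamma> M N \<Longrightarrow> step v \<Gamma> (F M) (F N)"
  by (auto simp: eframe_def intro: step.intros(1))

lemma eframe_steps: "steps v \<Gamma> M N \<Longrightarrow> eframe v F \<Longrightarrow> steps v \<Gamma> (F M) (F N)"
  by (induction rule: rtranclp_induct) (auto intro: eframe_step rtranclp.rtrancl_into_rtrancl)

lemma eframe_steps_trans: "(step v \<Gamma>)\<^sup>+\<^sup>+ M N \<Longrightarrow> eframe v F \<Longrightarrow> (step v \<Gamma>)\<^sup>+\<^sup>+ (F M) (F N)"
  by (induction rule: tranclp_induct) (auto intro: eframe_step tranclp.intros)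

lemma eframe_stuck: "eframe v F \<Longrightarrow> stuck v M \<Longrightarrow> stuck v (F M)"
  by (auto simp: eframe_def intro: stuck.intros)

text \<open>A proper frame discards itself in one step. For the identity the typing assumption
  forces \<open>B = A\<close>, and zero steps suffice.\<close>

lemma eframe_blame:
  assumes "eframe v F" "v; \<Gamma> \<turnstile> F (CBlame A l) : B"
  shows "steps v \<Gamma> (F (CBlame A l)) (CBlame B l)"
  using assms by (auto simp: eframe_def elim!: typing_inv intro: step.intros(2))

text \<open>In \<open>good_step\<close> both step sequences are nonempty, so that repeating this
  outcome forever yields divergence on both sides. In \<open>good_stuck\<close> the two end terms
  need not be related: it only matters that neither side reaches a value or diverges.\<close>

inductive good :: "variant \<Rightarrow> ctx \<Rightarrow> ctx \<Rightarrow> 'l tm \<Rightarrow> ty \<Rightarrow> 'l tm \<Rightarrow> ty \<Rightarrow> bool"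
  for v :: variant and \<Gamma> \<Gamma>' :: ctx and M :: "'l tm" and A :: ty and N :: "'l tm" and A' :: ty where
  good_step: "(step v \<Gamma>)\<^sup>+\<^sup>+ M M' \<Longrightarrow> (step v \<Gamma>')\<^sup>+\<^sup>+ N N' \<Longrightarrow> v; \<Gamma>; \<Gamma>' \<turnstile> M' : A \<sqsubseteq>\<^sup>C N' : A'
    \<Longrightarrow> good v \<Gamma> \<Gamma>' M A N A'"
| good_blame: "steps v \<Gamma>' N (CBlame A' l) \<Longrightarrow> good v \<Gamma> \<Gamma>' M A N A'"
| good_value: "steps v \<Gamma> M V \<Longrightarrow> steps v \<Gamma>' N W \<Longrightarrow> is_value v V \<Longrightarrow> is_value v W
    \<Longrightarrow> v; \<Gamma>; \<Gamma>' \<turnstile> V : A \<sqsubseteq>\<^sup>C W : A' \<Longrightarrow> good v \<Gamma> \<Gamma>' M A N A'"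
| good_stuck: "steps v \<Gamma> M S \<Longrightarrow> steps v \<Gamma>' N S' \<Longrightarrow> stuck v S \<Longrightarrow> stuck v S'
    \<Longrightarrow> good v \<Gamma> \<Gamma>' M A N A'"

lemma good_steps:
  assumes "steps v \<Gamma> M M'" "steps v \<Gamma>' N N'" "good v \<Gamma> \<Gamma>' M' A N' A'"
  shows "good v \<Gamma> \<Gamma>' M A N A'"
  using assms(3)
proof cases
  case (good_step P Q)
  with assms show ?thesis
    by (auto intro: good.good_step dest: rtranclp_tranclp_tranclp)
next
  case (good_blame l)
  with assms show ?thesis
    by (meson good.good_blame rtranclp_trans)
next
  case (good_value V W)
  with assms show ?thesis
    by (meson good.good_value rtranclp_trans)
next
  case (good_stuck S S')
  with assms show ?thesis
    by (meson good.good_stuck rtranclp_trans)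
qed

text \<open>The pair in the holes is run first. If it merely steps, \<open>cong\<close> restores
  relatedness of the whole terms; if it ends in blame, \<open>blame\<close> types the frame that
  blame must leave; if it ends in values, \<open>val\<close> takes over.\<close>

lemma good_bind:
  assumes "good v \<Gamma> \<Gamma>' M A N A'" "eframe v F" "eframe v F'"
    and cong: "\<And>M N. v; \<Gamma>; \<Gamma>' \<turnstile> M : A \<sqsubseteq>\<^sup>C N : A' \<Longrightarrow> v; \<Gamma>; \<Gamma>' \<turnstile> F M : B \<sqsubseteq>\<^sup>C F' N : B'"
    and blame: "\<And>l. v; \<Gamma>' \<turnstile> F' (CBlame A' l) : B'"
    and val: "\<And>V W. is_value v V \<Longrightarrow> is_value v W \<Longrightarrow> v; \<Gamma>; \<Gamma>' \<turnstile> V : A \<sqsubseteq>\<^sup>C W : A'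
      \<Longrightarrow> good v \<Gamma> \<Gamma>' (F V) B (F' W) B'"
  shows "good v \<Gamma> \<Gamma>' (F M) B (F' N) B'"
  using assms(1)
proof cases
  case (good_step P Q)
  then show ?thesis
    by (blast intro: good.good_step eframe_steps_trans cong assms(2,3))
next
  case (good_blame l)
  then show ?thesis
    using eframe_steps[OF good_blame assms(3)] eframe_blame[OF assms(3) blame]
    by (meson good.good_blame rtranclp_trans)
next
  case (good_value V W)
  then show ?thesis
    by (blast intro: good_steps eframe_steps assms(2,3) val)
next
  case (good_stuck S S')
  then show ?thesis
    by (blast intro: good.good_stuck eframe_steps eframe_stuck assms(2,3))
qed

lemma good_refl_value:
  "is_value v V \<Longrightarrow> is_value v W \<Longrightarrow> v; \<Gamma>; \<Gamma>' \<turnstile> V : A \<sqsubseteq>\<^sup>C W : A' \<Longrightarrow> good v \<Gamma> \<Gamma>' V A W A'"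
  by (blast intro: good_value)

lemma good_redex:
  "step v \<Gamma> M M' \<Longrightarrow> step v \<Gamma>' N N' \<Longrightarrow> v; \<Gamma>; \<Gamma>' \<turnstile> M' : A \<sqsubseteq>\<^sup>C N' : A' \<Longrightarrow> good v \<Gamma> \<Gamma>' M A N A'"
  by (blast intro: good_step)

section \<open>Values\<close>

lemma value_Base:
  assumes "v; \<Gamma> \<turnstile> V : Base b" "is_value v V"
  obtains u where "V = CConst (PBase b) (KBase u)" "u \<in> base_den b"
  using assms(2,1)
proof cases
  case (2 P k)
  with assms(1) have "prim_ty P = Base b" "k \<in> prim_den P"
    by (auto elim: typing_inv)
  then show ?thesis using 2 that by (cases P) auto
next
  case (6 V c)
  with assms(1) show ?thesis
    by (cases c) (auto simp: inert_iff elim: typing_inv)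
qed (use assms(1) in \<open>auto elim: typing_inv\<close>)

lemma value_Dyn:
  assumes "v; \<Gamma> \<turnstile> V : Dyn" "is_value v V"
  obtains V' G l where "V = V'\<langle>\<langle>G \<Rightarrow>\<^bsub>l\<^esub> Dyn\<rangle>\<rangle>" "ground G" "is_value v V'"
  using assms(2,1)
proof cases
  case (2 P k)
  with assms(1) show ?thesis
    by (cases P) (auto elim: typing_inv)
next
  case (6 V c)
  with assms(1) that show ?thesis
    by (cases c) (auto simp: inert_iff elim: typing_inv)
qed (use assms(1) in \<open>auto elim: typing_inv\<close>)

text \<open>In Variant 2 casts between products are active, so no wrapper has a product as its
  target. In Variant 1 a wrapped value would be possible here.\<close>

lemma value_Times:
  assumes "Variant2; \<Gamma> \<turnstile> V : A \<^bold>\<times> B" "is_value Variant2 V"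
  obtains V\<^sub>1 V\<^sub>2 where "V = CCons V\<^sub>1 V\<^sub>2" "is_value Variant2 V\<^sub>1" "is_value Variant2 V\<^sub>2"
  using assms(2,1)
proof cases
  case (2 P k)
  with assms(1) show ?thesis
    by (cases P) (auto elim: typing_inv)
next
  case (6 V c)
  with assms(1) show ?thesis
    by (cases c) (auto simp: inert_iff elim: typing_inv)
qed (use assms(1) that in \<open>auto elim: typing_inv\<close>)

lemma value_Plus:
  assumes "Variant2; \<Gamma> \<turnstile> V : A \<^bold>+ B" "is_value Variant2 V"
  obtains V' where "V = CInl B V'" "is_value Variant2 V'" | V' where "V = CInr A V'" "is_value Variant2 V'"
  using assms(2,1)
proof cases
  case (2 P k)
  with assms(1) show ?thesis
    by (cases P) (auto elim: typing_inv)
next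
  case (6 V c)
  with assms(1) show ?thesis
    by (cases c) (auto simp: inert_iff elim: typing_inv)
qed (use assms(1) that in \<open>auto elim: typing_inv\<close>)

inductive_cases cprec_const_constE: "v; \<Gamma>; \<Gamma>' \<turnstile> CConst P k : A \<sqsubseteq>\<^sup>C CConst P' k' : A'"
inductive_cases cprec_cons_consE: "v; \<Gamma>; \<Gamma>' \<turnstile> CCons M N : A \<sqsubseteq>\<^sup>C CCons M' N' : A'"
inductive_cases cprec_inl_inlE: "v; \<Gamma>; \<Gamma>' \<turnstile> CInl B M : A \<sqsubseteq>\<^sup>C CInl B' M' : A'"
inductive_cases cprec_inr_inrE: "v; \<Gamma>; \<Gamma>' \<turnstile> CInr B M : A \<sqsubseteq>\<^sup>C CInr B' M' : A'"
inductive_cases cprec_inl_inrE: "v; \<Gamma>; \<Gamma>' \<turnstile> CInl B M : A \<sqsubseteq>\<^sup>C CInr B' M' : A'"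
inductive_cases cprec_inr_inlE: "v; \<Gamma>; \<Gamma>' \<turnstile> CInr B M : A \<sqsubseteq>\<^sup>C CInl B' M' : A'"

lemma cprec_value_Base:
  assumes "v; \<Gamma>; \<Gamma>' \<turnstile> V : Base b \<sqsubseteq>\<^sup>C W : Base b" "is_value v V" "is_value v W"
  obtains u where "V = CConst (PBase b) (KBase u)" "W = CConst (PBase b) (KBase u)" "u \<in> base_den b"
proof -
  obtain u where u: "V = CConst (PBase b) (KBase u)" "u \<in> base_den b"
    using assms cprec_typing value_Base by metis
  obtain w where w: "W = CConst (PBase b) (KBase w)"
    using assms cprec_typing value_Base by metis
  from assms(1) have "u = w" unfolding u w by (auto elim: cprec_const_constE)
  with u w that show ?thesis by blast
qed

lemma cprec_value_Times:
  assumes "Variant2; \<Gamma>; \<Gamma>' \<turnstile> V : A\<^sub>1 \<^bold>\<times> A\<^sub>2 \<sqsubseteq>\<^sup>C W : A\<^sub>1' \<^bold>\<times> A\<^sub>2'" "is_value Variant2 V" "is_value Variant2 W"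
  obtains V\<^sub>1 V\<^sub>2 W\<^sub>1 W\<^sub>2 where "V = CCons V\<^sub>1 V\<^sub>2" "W = CCons W\<^sub>1 W\<^sub>2"
    "is_value Variant2 V\<^sub>1" "is_value Variant2 V\<^sub>2" "is_value Variant2 W\<^sub>1" "is_value Variant2 W\<^sub>2"
    "Variant2; \<Gamma>; \<Gamma>' \<turnstile> V\<^sub>1 : A\<^sub>1 \<sqsubseteq>\<^sup>C W\<^sub>1 : A\<^sub>1'" "Variant2; \<Gamma>; \<Gamma>' \<turnstile> V\<^sub>2 : A\<^sub>2 \<sqsubseteq>\<^sup>C W\<^sub>2 : A\<^sub>2'"
proof -
  obtain V\<^sub>1 V\<^sub>2 where V: "V = CCons V\<^sub>1 V\<^sub>2" "is_value Variant2 V\<^sub>1" "is_value Variant2 V\<^sub>2"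
    using assms cprec_typing value_Times by metis
  obtain W\<^sub>1 W\<^sub>2 where W: "W = CCons W\<^sub>1 W\<^sub>2" "is_value Variant2 W\<^sub>1" "is_value Variant2 W\<^sub>2"
    using assms cprec_typing value_Times by metis
  from assms(1) show ?thesis unfolding V(1) W(1)
    by (rule cprec_cons_consE) (use V W that in auto)
qed

lemma cprec_value_Plus:
  assumes "Variant2; \<Gamma>; \<Gamma>' \<turnstile> V : A\<^sub>1 \<^bold>+ A\<^sub>2 \<sqsubseteq>\<^sup>C W : A\<^sub>1' \<^bold>+ A\<^sub>2'" "is_value Variant2 V" "is_value Variant2 W"
  obtains V' W' where "V = CInl A\<^sub>2 V'" "W = CInl A\<^sub>2' W'" "is_value Variant2 V'" "is_value Variant2 W'"
      "Variant2; \<Gamma>; \<Gamma>' \<turnstile> V' : A\<^sub>1 \<sqsubseteq>\<^sup>C W' : A\<^sub>1'"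
  | V' W' where "V = CInr A\<^sub>1 V'" "W = CInr A\<^sub>1' W'" "is_value Variant2 V'" "is_value Variant2 W'"
      "Variant2; \<Gamma>; \<Gamma>' \<turnstile> V' : A\<^sub>2 \<sqsubseteq>\<^sup>C W' : A\<^sub>2'"
proof -
  have V: "Variant2; \<Gamma> \<turnstile> V : A\<^sub>1 \<^bold>+ A\<^sub>2" and W: "Variant2; \<Gamma>' \<turnstile> W : A\<^sub>1' \<^bold>+ A\<^sub>2'"
    using assms(1) cprec_typing by blast+
  from V assms(2) show ?thesis
  proof (cases rule: value_Plus)
    case V: (1 V')
    from W assms(3) show ?thesis
    proof (cases rule: value_Plus)
      case (1 W')
      from assms(1) show ?thesis unfolding V 1
        by (rule cprec_inl_inlE) (use V 1 that in auto)
    next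
      case (2 W')
      from assms(1) show ?thesis unfolding V 2 by (rule cprec_inl_inrE)
    qed
  next
    case V: (2 V')
    from W assms(3) show ?thesis
    proof (cases rule: value_Plus)
      case (1 W')
      from assms(1) show ?thesis unfolding V 1 by (rule cprec_inr_inlE)
    next
      case (2 W')
      from assms(1) show ?thesis unfolding V 2
        by (rule cprec_inr_inrE) (use V 2 that in auto)
    qed
  qed
qed

text \<open>Since \<open>W\<close> is a value, and a wrapper on the right alone needs a left type
  other than \<open>Dyn\<close>, two rules remain: the tag occurs on both sides, or it is a wrapper
  on the left alone. In the latter case \<open>G\<close> is below \<open>A'\<close>, which excludes
  \<open>A' = Dyn\<close>.\<close>

lemma cprec_wrap_Dyn_cases:
  assumes "v; \<Gamma>; \<Gamma>' \<turnstile> V\<langle>\<langle>G \<Rightarrow>\<^bsub>l\<^esub> Dyn\<rangle>\<rangle> : Dyn \<sqsubseteq>\<^sup>C W : A'" "is_value v W"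
  obtains "A' \<noteq> Dyn" "v; \<Gamma>; \<Gamma>' \<turnstile> V : G \<sqsubseteq>\<^sup>C W : A'" "G \<^bold>\<sqsubseteq> A'"
  | W' l' where "A' = Dyn" "W = W'\<langle>\<langle>G \<Rightarrow>\<^bsub>l'\<^esub> Dyn\<rangle>\<rangle>" "v; \<Gamma>; \<Gamma>' \<turnstile> V : G \<sqsubseteq>\<^sup>C W' : G"
  using assms(1)
proof cases
  case (15 i')
  then show ?thesis using that by (auto elim!: inert_prec.cases)
next
  case 16
  then have "ground G" "G \<^bold>\<sqsubseteq> A'" by (auto elim: inert_prec_ty.cases)
  then show ?thesis using 16 that by (cases A') auto
qed (use assms(2) in auto)

lemma cprec_value_Dyn:
  assumes "v; \<Gamma>; \<Gamma>' \<turnstile> V : Dyn \<sqsubseteq>\<^sup>C W : A'" "is_value v V" "is_value v W"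
  obtains V' G l where "A' \<noteq> Dyn" "V = V'\<langle>\<langle>G \<Rightarrow>\<^bsub>l\<^esub> Dyn\<rangle>\<rangle>" "ground G" "is_value v V'"
      "G \<^bold>\<sqsubseteq> A'" "v; \<Gamma>; \<Gamma>' \<turnstile> V' : G \<sqsubseteq>\<^sup>C W : A'"
  | V' W' G l l' where "A' = Dyn" "V = V'\<langle>\<langle>G \<Rightarrow>\<^bsub>l\<^esub> Dyn\<rangle>\<rangle>" "W = W'\<langle>\<langle>G \<Rightarrow>\<^bsub>l'\<^esub> Dyn\<rangle>\<rangle>"
      "ground G" "is_value v V'" "is_value v W'" "v; \<Gamma>; \<Gamma>' \<turnstile> V' : G \<sqsubseteq>\<^sup>C W' : G"
proof -
  obtain V' G l where V: "V = V'\<langle>\<langle>G \<Rightarrow>\<^bsub>l\<^esub> Dyn\<rangle>\<rangle>" "ground G" "is_value v V'"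
    using assms cprec_typing value_Dyn by metis
  from assms(1,3) show ?thesis unfolding V(1)
    by (cases rule: cprec_wrap_Dyn_cases) (use V assms(3) that in auto)
qed

section \<open>Casts on related values\<close>

lemma gnd_prec: "A \<noteq> Dyn \<Longrightarrow> gnd A \<^bold>\<sqsubseteq> A"
  by (cases A) auto

section \<open>Reduction sequences of casts applied to values\<close>

lemma typing_cast: "v; \<Gamma> \<turnstile> M : A \<Longrightarrow> A \<sim> B \<Longrightarrow> v; \<Gamma> \<turnstile> M\<langle>A \<Rightarrow>\<^bsub>l\<^esub> B\<rangle> : B"
  using typing.intros(12)[of v \<Gamma> M "A \<Rightarrow>\<^bsub>l\<^esub> B"] by (simp add: cast_ok_def)

lemma eframe_cast [simp]: "eframe v (\<lambda>X. X\<langle>c\<rangle>)"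
  by (intro eframeI frame.intros)

lemma steps_id: "is_value v V \<Longrightarrow> atomic a \<Longrightarrow> steps v \<Gamma> (V\<langle>a \<Rightarrow>\<^bsub>l\<^esub> a\<rangle>) V"
  by (intro r_into_rtranclp step.intros(3) active.intros(1) apply_cast.intros(1))

lemma steps_wrap: "is_value v V \<Longrightarrow> inert v c \<Longrightarrow> steps v \<Gamma> (V\<langle>c\<rangle>) (V\<langle>\<langle>c\<rangle>\<rangle>)"
  by (intro r_into_rtranclp step.intros(4))

lemma steps_inject:
  "is_value v V \<Longrightarrow> A \<noteq> Dyn \<Longrightarrow> \<not> ground A
    \<Longrightarrow> steps v \<Gamma> (V\<langle>A \<Rightarrow>\<^bsub>l\<^esub> Dyn\<rangle>) (V\<langle>A \<Rightarrow>\<^bsub>l\<^esub> gnd A\<rangle>\<langle>gnd A \<Rightarrow>\<^bsub>l\<^esub> Dyn\<rangle>)"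
  by (intro r_into_rtranclp step.intros(3) active.intros(2) apply_cast.intros(2))

lemma steps_project_ground:
  "is_value v V \<Longrightarrow> ground G \<Longrightarrow> steps v \<Gamma> (V\<langle>\<langle>G \<Rightarrow>\<^bsub>l\<^esub> Dyn\<rangle>\<rangle>\<langle>Dyn \<Rightarrow>\<^bsub>l'\<^esub> G\<rangle>) V"
  by (intro r_into_rtranclp step.intros(3) active.intros(3) apply_cast.intros(3))
    (auto simp: inert_iff)

lemma steps_project_expand:
  assumes "is_value v V" "ground G" "B \<noteq> Dyn" "\<not> ground B"
  shows "steps v \<Gamma> (V\<langle>\<langle>G \<Rightarrow>\<^bsub>l\<^esub> Dyn\<rangle>\<rangle>\<langle>Dyn \<Rightarrow>\<^bsub>l'\<^esub> B\<rangle>)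
    (V\<langle>\<langle>G \<Rightarrow>\<^bsub>l\<^esub> Dyn\<rangle>\<rangle>\<langle>Dyn \<Rightarrow>\<^bsub>l'\<^esub> gnd B\<rangle>\<langle>gnd B \<Rightarrow>\<^bsub>l'\<^esub> B\<rangle>)"
proof -
  have "step v \<Gamma> (V\<langle>\<langle>G \<Rightarrow>\<^bsub>l\<^esub> Dyn\<rangle>\<rangle>\<langle>Dyn \<Rightarrow>\<^bsub>l'\<^esub> B\<rangle>)
      (V\<langle>G \<Rightarrow>\<^bsub>l\<^esub> Dyn\<rangle>\<langle>Dyn \<Rightarrow>\<^bsub>l'\<^esub> gnd B\<rangle>\<langle>gnd B \<Rightarrow>\<^bsub>l'\<^esub> B\<rangle>)"
    using assms by (intro step.intros(3) active.intros(3) apply_cast.intros(5)) (auto simp: inert_iff)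
  \<comment> \<open>Unfolding the projection turns the wrapper into a pending cast. That cast is
    inert, so one more step under the two outer casts restores the wrapper.\<close>
  moreover have "steps v \<Gamma> (V\<langle>G \<Rightarrow>\<^bsub>l\<^esub> Dyn\<rangle>\<langle>Dyn \<Rightarrow>\<^bsub>l'\<^esub> gnd B\<rangle>\<langle>gnd B \<Rightarrow>\<^bsub>l'\<^esub> B\<rangle>)
      (V\<langle>\<langle>G \<Rightarrow>\<^bsub>l\<^esub> Dyn\<rangle>\<rangle>\<langle>Dyn \<Rightarrow>\<^bsub>l'\<^esub> gnd B\<rangle>\<langle>gnd B \<Rightarrow>\<^bsub>l'\<^esub> B\<rangle>)"
    by (rule eframe_steps[OF eframe_steps[OF steps_wrap eframe_cast] eframe_cast])
      (use assms in \<open>auto simp: inert_iff\<close>)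
  ultimately show ?thesis by (rule converse_rtranclp_into_rtranclp)
qed

lemma steps_project_match:
  assumes "is_value v V" "ground G" "B \<noteq> Dyn" "\<not> ground B" "gnd B = G"
  shows "steps v \<Gamma> (V\<langle>\<langle>G \<Rightarrow>\<^bsub>l\<^esub> Dyn\<rangle>\<rangle>\<langle>Dyn \<Rightarrow>\<^bsub>l'\<^esub> B\<rangle>) (V\<langle>G \<Rightarrow>\<^bsub>l'\<^esub> B\<rangle>)"
  using steps_project_expand[OF assms(1-4)] assms(5)
    eframe_steps[OF steps_project_ground[OF assms(1,2)] eframe_cast]
  by (metis rtranclp_trans)

text \<open>Tags are compared only at ground types. A target that is not ground is unfolded first;
  blame then arises at \<open>gnd B\<close>, and leaving the outer cast changes its annotation to
  \<open>B\<close>.\<close>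

lemma steps_project_mismatch:
  assumes "is_value v V" "ground G" "B \<noteq> Dyn" "gnd B \<noteq> G"
  shows "steps v \<Gamma> (V\<langle>\<langle>G \<Rightarrow>\<^bsub>l\<^esub> Dyn\<rangle>\<rangle>\<langle>Dyn \<Rightarrow>\<^bsub>l'\<^esub> B\<rangle>) (CBlame B l')"
proof -
  have blame: "steps v \<Gamma> (V\<langle>\<langle>G \<Rightarrow>\<^bsub>l\<^esub> Dyn\<rangle>\<rangle>\<langle>Dyn \<Rightarrow>\<^bsub>l'\<^esub> C\<rangle>) (CBlame C l')" if "ground C" "C \<noteq> G" for C
    using assms that
    by (intro r_into_rtranclp step.intros(3) active.intros(3) apply_cast.intros(4)) (auto simp: inert_iff)
  show ?thesis
  proof (cases "ground B")
    case True
    then show ?thesis using blame assms(4) gnd_eq_ground by metis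
  next
    case False
    have "steps v \<Gamma> ((CBlame (gnd B) l')\<langle>gnd B \<Rightarrow>\<^bsub>l'\<^esub> B\<rangle>) (CBlame B l')"
      by (rule eframe_blame[OF eframe_cast]) (simp add: typing_cast typing.intros(14) consistent_gnd assms(3))
    then show ?thesis
      using steps_project_expand[OF assms(1-3) False]
        eframe_steps[OF blame[OF ground_gnd[OF assms(3)] assms(4)] eframe_cast]
      by (meson rtranclp_trans)
  qed
qed

lemma steps_cast_Times:
  assumes "is_value Variant2 V"
  shows "steps Variant2 \<Gamma> (V\<langle>A\<^sub>1 \<^bold>\<times> A\<^sub>2 \<Rightarrow>\<^bsub>l\<^esub> B\<^sub>1 \<^bold>\<times> B\<^sub>2\<rangle>)
    (CCons ((CFst V)\<langle>A\<^sub>1 \<Rightarrow>\<^bsub>l\<^esub> B\<^sub>1\<rangle>) ((CSnd V)\<langle>A\<^sub>2 \<Rightarrow>\<^bsub>l\<^esub> B\<^sub>2\<rangle>))"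
proof -
  let ?c = "A\<^sub>1 \<^bold>\<times> A\<^sub>2 \<Rightarrow>\<^bsub>l\<^esub> B\<^sub>1 \<^bold>\<times> B\<^sub>2"
  have "step Variant2 \<Gamma> (V\<langle>?c\<rangle>) (CCons ((CFst V)\<langle>cfst ?c\<rangle>) ((CSnd V)\<langle>csnd ?c\<rangle>))"
    using assms by (intro step.intros(3) active.intros(4) apply_cast.intros(6)) auto
  then show ?thesis by auto
qed

lemma steps_cast_fst:
  "is_value v V\<^sub>1 \<Longrightarrow> is_value v V\<^sub>2 \<Longrightarrow> steps v \<Gamma> ((CFst (CCons V\<^sub>1 V\<^sub>2))\<langle>c\<rangle>) (V\<^sub>1\<langle>c\<rangle>)"
  by (rule eframe_steps[OF r_into_rtranclp eframe_cast]) (rule step.intros(12))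

lemma steps_cast_snd:
  "is_value v V\<^sub>1 \<Longrightarrow> is_value v V\<^sub>2 \<Longrightarrow> steps v \<Gamma> ((CSnd (CCons V\<^sub>1 V\<^sub>2))\<langle>c\<rangle>) (V\<^sub>2\<langle>c\<rangle>)"
  by (rule eframe_steps[OF r_into_rtranclp eframe_cast]) (rule step.intros(13))

lemma steps_cast_inl:
  assumes "is_value Variant2 V"
  shows "steps Variant2 \<Gamma> ((CInl A\<^sub>2 V)\<langle>A\<^sub>1 \<^bold>+ A\<^sub>2 \<Rightarrow>\<^bsub>l\<^esub> B\<^sub>1 \<^bold>+ B\<^sub>2\<rangle>) (CInl B\<^sub>2 (V\<langle>A\<^sub>1 \<Rightarrow>\<^bsub>l\<^esub> B\<^sub>1\<rangle>))"
proof -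
  let ?c = "A\<^sub>1 \<^bold>+ A\<^sub>2 \<Rightarrow>\<^bsub>l\<^esub> B\<^sub>1 \<^bold>+ B\<^sub>2"
  let ?M = "CInl B\<^sub>2 ((CVar 0)\<langle>cinl ?c\<rangle>)" and ?N = "CInr B\<^sub>1 ((CVar 0)\<langle>cinr ?c\<rangle>)"
  have "step Variant2 \<Gamma> ((CInl A\<^sub>2 V)\<langle>?c\<rangle>) (CCase (CInl A\<^sub>2 V) ?M ?N)"
    using assms by (intro step.intros(3) active.intros(5) apply_cast.intros(7)) auto
  moreover have "step Variant2 \<Gamma> (CCase (CInl A\<^sub>2 V) ?M ?N) (subst0 ?M V)"
    using assms by (rule step.intros(14))
  ultimately show ?thesis
    by (simp add: subst0_def)
qed

lemma steps_cast_inr: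
  assumes "is_value Variant2 V"
  shows "steps Variant2 \<Gamma> ((CInr A\<^sub>1 V)\<langle>A\<^sub>1 \<^bold>+ A\<^sub>2 \<Rightarrow>\<^bsub>l\<^esub> B\<^sub>1 \<^bold>+ B\<^sub>2\<rangle>) (CInr B\<^sub>1 (V\<langle>A\<^sub>2 \<Rightarrow>\<^bsub>l\<^esub> B\<^sub>2\<rangle>))"
proof -
  let ?c = "A\<^sub>1 \<^bold>+ A\<^sub>2 \<Rightarrow>\<^bsub>l\<^esub> B\<^sub>1 \<^bold>+ B\<^sub>2"
  let ?M = "CInl B\<^sub>2 ((CVar 0)\<langle>cinl ?c\<rangle>)" and ?N = "CInr B\<^sub>1 ((CVar 0)\<langle>cinr ?c\<rangle>)"
  have "step Variant2 \<Gamma> ((CInr A\<^sub>1 V)\<langle>?c\<rangle>) (CCase (CInr A\<^sub>1 V) ?M ?N)"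
    using assms by (intro step.intros(3) active.intros(5) apply_cast.intros(7)) auto
  moreover have "step Variant2 \<Gamma> (CCase (CInr A\<^sub>1 V) ?M ?N) (subst0 ?N V)"
    using assms by (rule step.intros(15))
  ultimately show ?thesis
    by (simp add: subst0_def)
qed


text \<open>
  Outcomes of a pair whose evaluation certainly ends, as for casts applied to values. Unlike for
  \<open>good\<close>, frames need not preserve precision (cf. \<open>conv_bind\<close> and \<open>good_bind\<close>), which they do not:
  with \<open>W\<^sub>2\<close> a component of the other side, \<open>(CSnd V)\<langle>c\<rangle>\<close> is not related to \<open>W\<^sub>2\<close>.
\<close>

inductive conv :: "variant \<Rightarrow> ctx \<Rightarrow> ctx \<Rightarrow> 'l tm \<Rightarrow> ty \<Rightarrow> 'l tm \<Rightarrow> ty \<Rightarrow> bool"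
  for v :: variant and \<Gamma> \<Gamma>' :: ctx and M :: "'l tm" and A :: ty and N :: "'l tm" and A' :: ty where
  conv_blame: "steps v \<Gamma>' N (CBlame A' l) \<Longrightarrow> conv v \<Gamma> \<Gamma>' M A N A'"
| conv_value: "steps v \<Gamma> M V \<Longrightarrow> steps v \<Gamma>' N W \<Longrightarrow> is_value v V \<Longrightarrow> is_value v W
    \<Longrightarrow> v; \<Gamma>; \<Gamma>' \<turnstile> V : A \<sqsubseteq>\<^sup>C W : A' \<Longrightarrow> conv v \<Gamma> \<Gamma>' M A N A'"

lemma conv_good: "conv v \<Gamma> \<Gamma>' M A N A' \<Longrightarrow> good v \<Gamma> \<Gamma>' M A N A'"
  by (erule conv.cases) (auto intro: good_blame good_value)

lemma conv_refl_value:
  "is_value v V \<Longrightarrow> is_value v W \<Longrightarrow> v; \<Gamma>; \<Gamma>' \<turnstile> V : A \<sqsubseteq>\<^sup>C W : A' \<Longrightarrow> conv v \<Gamma> \<Gamma>' V A W A'"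
  by (blast intro: conv_value)

lemma conv_steps:
  assumes "steps v \<Gamma> M M'" "steps v \<Gamma>' N N'" "conv v \<Gamma> \<Gamma>' M' A N' A'"
  shows "conv v \<Gamma> \<Gamma>' M A N A'"
  using assms(3)
proof cases
  case (conv_blame l)
  with assms show ?thesis
    by (meson conv.conv_blame rtranclp_trans)
next
  case (conv_value V W)
  with assms show ?thesis
    by (meson conv.conv_value rtranclp_trans)
qed

lemmas conv_stepsL = conv_steps[OF _ rtranclp.rtrancl_refl]
lemmas conv_stepsR = conv_steps[OF rtranclp.rtrancl_refl]

lemma conv_bind:
  assumes "conv v \<Gamma> \<Gamma>' M A N A'" "eframe v F" "eframe v F'"
    and blame: "\<And>l. v; \<Gamma>' \<turnstile> F' (CBlame A' l) : B'"
    and val: "\<And>V W. is_value v V \<Longrightarrow> is_value v W \<Longrightarrow> v; \<Gamma>; \<Gamma>' \<turnstile> V : A \<sqsubseteq>\<^sup>C W : A'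
      \<Longrightarrow> conv v \<Gamma> \<Gamma>' (F V) B (F' W) B'"
  shows "conv v \<Gamma> \<Gamma>' (F M) B (F' N) B'"
  using assms(1)
proof cases
  case (conv_blame l)
  then show ?thesis
    using eframe_steps[OF conv_blame assms(3)] eframe_blame[OF assms(3) blame]
    by (meson conv.conv_blame rtranclp_trans)
next
  case (conv_value V W)
  then show ?thesis
    by (blast intro: conv_steps eframe_steps assms(2,3) val)
qed

lemma typing_blame: "v; \<Gamma> \<turnstile> CBlame A l : A"
  by (rule typing.intros)

lemma conv_wrapL_Dyn:
  assumes "conv v \<Gamma> \<Gamma>' M G N A'" "ground G" "G \<^bold>\<sqsubseteq> A'"
  shows "conv v \<Gamma> \<Gamma>' (M\<langle>\<langle>G \<Rightarrow>\<^bsub>l\<^esub> Dyn\<rangle>\<rangle>) Dyn N A'"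
  using assms(1)
  by (rule conv_bind)
    (auto intro!: eframeI frame.intros typing_blame conv_refl_value cprec_wrapL_Dyn simp: assms inert_iff)

lemma conv_castL_inject:
  assumes "conv v \<Gamma> \<Gamma>' M G N A'" "ground G" "G \<^bold>\<sqsubseteq> A'"
  shows "conv v \<Gamma> \<Gamma>' (M\<langle>G \<Rightarrow>\<^bsub>l\<^esub> Dyn\<rangle>) Dyn N A'"
  using assms(1)
  by (rule conv_bind)
    (auto intro!: typing_blame conv_stepsL[OF steps_wrap conv_refl_value] cprec_wrapL_Dyn simp: assms inert_iff)

text \<open>If the first component ends in blame, \<open>N\<^sub>2\<close> is still unevaluated; its
  typing is needed to type the frame that the blame leaves.\<close>

lemma conv_cons:
  assumes "conv v \<Gamma> \<Gamma>' M\<^sub>1 A\<^sub>1 N\<^sub>1 A\<^sub>1'" "conv v \<Gamma> \<Gamma>' M\<^sub>2 A\<^sub>2 N\<^sub>2 A\<^sub>2'" "v; \<Gamma>' \<turnstile> N\<^sub>2 : A\<^sub>2'"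
  shows "conv v \<Gamma> \<Gamma>' (CCons M\<^sub>1 M\<^sub>2) (A\<^sub>1 \<^bold>\<times> A\<^sub>2) (CCons N\<^sub>1 N\<^sub>2) (A\<^sub>1' \<^bold>\<times> A\<^sub>2')"
  using assms(1)
proof (rule conv_bind)
  fix V W :: "'a tm" assume VW: "is_value v V" "is_value v W" "v; \<Gamma>; \<Gamma>' \<turnstile> V : A\<^sub>1 \<sqsubseteq>\<^sup>C W : A\<^sub>1'"
  show "conv v \<Gamma> \<Gamma>' (CCons V M\<^sub>2) (A\<^sub>1 \<^bold>\<times> A\<^sub>2) (CCons W N\<^sub>2) (A\<^sub>1' \<^bold>\<times> A\<^sub>2')"
    using assms(2)
    by (rule conv_bind)
      (use VW cprec_typing[OF VW(3)] in \<open>auto intro!: eframeI frame.intros typing.intros conv_refl_value cprec.intros(6)\<close>)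
qed (use assms(3) in \<open>auto intro!: eframeI frame.intros typing.intros\<close>)

lemma conv_inl:
  assumes "conv v \<Gamma> \<Gamma>' M A N A'" "B \<^bold>\<sqsubseteq> B'"
  shows "conv v \<Gamma> \<Gamma>' (CInl B M) (A \<^bold>+ B) (CInl B' N) (A' \<^bold>+ B')"
  using assms(1)
  by (rule conv_bind)
    (use assms in \<open>auto intro!: eframeI frame.intros typing.intros conv_refl_value cprec.intros(9)\<close>)

lemma conv_inr:
  assumes "conv v \<Gamma> \<Gamma>' M A N A'" "B \<^bold>\<sqsubseteq> B'"
  shows "conv v \<Gamma> \<Gamma>' (CInr B M) (B \<^bold>+ A) (CInr B' N) (B' \<^bold>+ A')"
  using assms(1)
  by (rule conv_bind)
    (use assms in \<open>auto intro!: eframeI frame.intros typing.intros conv_refl_value cprec.intros(10)\<close>)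

text \<open>Identity casts on atoms, projections and injections all reduce to at most one cross cast
  plus adding or removing a tag. Only the left side moves, so \<open>W\<close> and \<open>A'\<close>
  stay fixed, and an induction on \<open>A'\<close> can be confined to cross casts.\<close>

lemma conv_castL_if_cross:
  assumes cross: "\<And>k P\<^sub>1 P\<^sub>2 Q\<^sub>1 Q\<^sub>2 V. v; \<Gamma>; \<Gamma>' \<turnstile> V : Bin k P\<^sub>1 P\<^sub>2 \<sqsubseteq>\<^sup>C W : A' \<Longrightarrow> is_value v V
      \<Longrightarrow> P\<^sub>1 \<sim> Q\<^sub>1 \<Longrightarrow> P\<^sub>2 \<sim> Q\<^sub>2 \<Longrightarrow> Bin k P\<^sub>1 P\<^sub>2 \<^bold>\<sqsubseteq> A' \<Longrightarrow> Bin k Q\<^sub>1 Q\<^sub>2 \<^bold>\<sqsubseteq> A'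
      \<Longrightarrow> conv v \<Gamma> \<Gamma>' (V\<langle>Bin k P\<^sub>1 P\<^sub>2 \<Rightarrow>\<^bsub>l\<^esub> Bin k Q\<^sub>1 Q\<^sub>2\<rangle>) (Bin k Q\<^sub>1 Q\<^sub>2) W A'"
    and VW: "v; \<Gamma>; \<Gamma>' \<turnstile> V : A \<sqsubseteq>\<^sup>C W : A'" "is_value v V" "is_value v W"
    and AB: "A \<sim> B" "A \<^bold>\<sqsubseteq> A'" "B \<^bold>\<sqsubseteq> A'"
  shows "conv v \<Gamma> \<Gamma>' (V\<langle>A \<Rightarrow>\<^bsub>l\<^esub> B\<rangle>) B W A'"
proof -
  consider (id) "A = B" "atomic A" | (project) "A = Dyn" "B \<noteq> Dyn" | (inject) "A \<noteq> Dyn" "B = Dyn"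
    | (cross) k P\<^sub>1 P\<^sub>2 Q\<^sub>1 Q\<^sub>2 where "A = Bin k P\<^sub>1 P\<^sub>2" "B = Bin k Q\<^sub>1 Q\<^sub>2"
    using AB(1) by (cases A; cases B) auto
  then show ?thesis
  proof cases
    case id
    then show ?thesis
      using VW by (auto intro!: conv_stepsL[OF steps_id conv_refl_value])
  next
    case project
    from VW(1)[unfolded project(1)] VW(2,3) show ?thesis
    proof (cases rule: cprec_value_Dyn)
      case (1 V' G l')
      \<comment> \<open>The tag and the target of the projection are both below \<open>A'\<close>,
        so the tags agree and the left side cannot blame.\<close>
      have G: "gnd B = G"
        using ground_prec_gnd[OF 1(3,5)] prec_gnd_eq[OF AB(3) project(2)] by simp
      show ?thesis
      proof (cases "ground B")
        case True
        then have "B = G" using G gnd_eq_ground by simp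
        then show ?thesis unfolding 1(2) project(1)
          using 1 VW(3) by (auto intro!: conv_stepsL[OF steps_project_ground conv_refl_value])
      next
        case False
        then obtain k Q\<^sub>1 Q\<^sub>2 where B: "B = Bin k Q\<^sub>1 Q\<^sub>2"
          using project(2) by (cases B) auto
        show ?thesis unfolding 1(2) project(1)
          using steps_project_match[OF 1(4,3) project(2) False G] 
          by (rule conv_stepsL) (use 1 G AB(3) B in \<open>auto intro!: cross\<close>)
      qed
    next
      case (2 V' W' G l l')
      then show ?thesis using AB(3) project by simp
    qed
  next
    case inject
    show ?thesis
    proof (cases "ground A")
      case True
      then show ?thesis unfolding inject(2)
        using AB VW by (auto intro: conv_castL_inject conv_refl_value)
    next
      case False
      then obtain k P\<^sub>1 P\<^sub>2 where A: "A = Bin k P\<^sub>1 P\<^sub>2"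
        using inject(1) by (cases A) auto
      have "gnd A \<^bold>\<sqsubseteq> A'"
        using gnd_prec[OF inject(1)] AB(2) ty_prec_trans by blast
      \<comment> \<open>The unfolded injection starts with a cross cast to \<open>gnd A\<close>,
        which is still below \<open>A'\<close> because it is below \<open>A\<close>.\<close>
      moreover from this have "conv v \<Gamma> \<Gamma>' (V\<langle>A \<Rightarrow>\<^bsub>l\<^esub> gnd A\<rangle>) (gnd A) W A'"
        using VW AB unfolding A by (auto intro!: cross)
      ultimately show ?thesis unfolding inject(2)
        by (intro conv_stepsL[OF steps_inject[OF VW(2) inject(1) False]] conv_castL_inject
            ground_gnd inject(1))
    qed
  next
    case cross
    then show ?thesis using VW AB by (auto intro: assms(1))
  qed
qed

text \<open>The induction is on \<open>A'\<close> because it bounds both source and target of the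
  cast. In Variant 1 and between functions a cross cast just becomes a wrapper. Otherwise it is
  computed on the components of a pair or under an injection, and each component cast is bounded by
  a component of \<open>A'\<close>.\<close>

lemma conv_castL_value:
  assumes "v; \<Gamma>; \<Gamma>' \<turnstile> V : A \<sqsubseteq>\<^sup>C W : A'" "is_value v V" "is_value v W"
    and "A \<sim> B" "A \<^bold>\<sqsubseteq> A'" "B \<^bold>\<sqsubseteq> A'"
  shows "conv v \<Gamma> \<Gamma>' (V\<langle>A \<Rightarrow>\<^bsub>l\<^esub> B\<rangle>) B W A'"
  using assms
proof (induction A' arbitrary: A B V W rule: ty.induct)
  case (Bin k A\<^sub>1' A\<^sub>2')
  from Bin.prems show ?case
  proof (rule conv_castL_if_cross[rotated])
    fix k' P\<^sub>1 P\<^sub>2 Q\<^sub>1 Q\<^sub>2 V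
    assume V: "v; \<Gamma>; \<Gamma>' \<turnstile> V : Bin k' P\<^sub>1 P\<^sub>2 \<sqsubseteq>\<^sup>C W : Bin k A\<^sub>1' A\<^sub>2'" "is_value v V"
      and sim: "P\<^sub>1 \<sim> Q\<^sub>1" "P\<^sub>2 \<sim> Q\<^sub>2"
      and prec: "Bin k' P\<^sub>1 P\<^sub>2 \<^bold>\<sqsubseteq> Bin k A\<^sub>1' A\<^sub>2'" "Bin k' Q\<^sub>1 Q\<^sub>2 \<^bold>\<sqsubseteq> Bin k A\<^sub>1' A\<^sub>2'"
    then have k: "k' = k" by simp
    note W = Bin.prems(3)
    show "conv v \<Gamma> \<Gamma>' (V\<langle>Bin k' P\<^sub>1 P\<^sub>2 \<Rightarrow>\<^bsub>l\<^esub> Bin k' Q\<^sub>1 Q\<^sub>2\<rangle>) (Bin k' Q\<^sub>1 Q\<^sub>2) W (Bin k A\<^sub>1' A\<^sub>2')"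
    proof (cases "v = Variant1 \<or> k = Arr")
      case True
      then show ?thesis
        using V sim prec W
        by (intro conv_stepsL[OF steps_wrap] conv_refl_value cprec_wrapL_cross) (auto simp: inert_iff)
    next
      case False
      then have v: "v = Variant2" by (cases v) auto
      then have vW: "is_value Variant2 V" "is_value Variant2 W"
        using V W by auto
      from False consider (Times) "k = Times" | (Plus) "k = Plus" by (cases k) auto
      then show ?thesis
      proof cases
        case Times
        note eqs = v Times k
        from V(1)[unfolded eqs] vW show ?thesis
        proof (cases rule: cprec_value_Times)
          case (1 V\<^sub>1 V\<^sub>2 W\<^sub>1 W\<^sub>2)
          have "conv Variant2 \<Gamma> \<Gamma>' (V\<^sub>1\<langle>P\<^sub>1 \<Rightarrow>\<^bsub>l\<^esub> Q\<^sub>1\<rangle>) Q\<^sub>1 W\<^sub>1 A\<^sub>1'"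
            using 1 sim prec Bin.IH(1)[unfolded v] by auto
          moreover have "conv Variant2 \<Gamma> \<Gamma>' (V\<^sub>2\<langle>P\<^sub>2 \<Rightarrow>\<^bsub>l\<^esub> Q\<^sub>2\<rangle>) Q\<^sub>2 W\<^sub>2 A\<^sub>2'"
            using 1 sim prec Bin.IH(2)[unfolded v] by auto
          ultimately show ?thesis unfolding eqs
            using 1 vW cprec_typing[OF 1(8)]
            by (auto intro!: conv_stepsL[OF steps_cast_Times] conv_cons
                conv_stepsL[OF steps_cast_fst] conv_stepsL[OF steps_cast_snd])
        qed
      next
        case Plus
        note eqs = v Plus k
        from V(1)[unfolded eqs] vW show ?thesis
        proof (cases rule: cprec_value_Plus)
          case (1 V' W')
          then show ?thesis unfolding eqs
            using sim prec Bin.IH(1)[unfolded v]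
            by (auto intro!: conv_stepsL[OF steps_cast_inl] conv_inl)
        next
          case (2 V' W')
          then show ?thesis unfolding eqs
            using sim prec Bin.IH(2)[unfolded v]
            by (auto intro!: conv_stepsL[OF steps_cast_inr] conv_inr)
        qed
      qed
    qed
  qed
\<comment> \<open>No binary type is below \<open>Base\<close> or \<open>Dyn\<close>, so the premise
  about cross casts is vacuous.\<close>
qed (erule conv_castL_if_cross[rotated]; simp)+

text \<open>The size bounds concern the component casts, not the cross cast itself: unfolding a
  projection from \<open>Dyn\<close> to \<open>Q\<close> yields a cast from \<open>gnd Q\<close> to
  \<open>Q\<close>, which is larger than the original, while its components are smaller. The
  condition \<open>A \<noteq> Dyn\<close> is what a wrapper on the right alone demands.\<close>

lemma conv_castR_if_cross:
  assumes cross: "\<And>k P\<^sub>1 P\<^sub>2 Q\<^sub>1 Q\<^sub>2 A V W. v; \<Gamma>; \<Gamma>' \<turnstile> V : A \<sqsubseteq>\<^sup>C W : Bin k P\<^sub>1 P\<^sub>2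
      \<Longrightarrow> is_value v V \<Longrightarrow> is_value v W \<Longrightarrow> A \<noteq> Dyn \<Longrightarrow> P\<^sub>1 \<sim> Q\<^sub>1 \<Longrightarrow> P\<^sub>2 \<sim> Q\<^sub>2
      \<Longrightarrow> A \<^bold>\<sqsubseteq> Bin k P\<^sub>1 P\<^sub>2 \<Longrightarrow> A \<^bold>\<sqsubseteq> Bin k Q\<^sub>1 Q\<^sub>2
      \<Longrightarrow> size P\<^sub>1 + size Q\<^sub>1 < size P + size Q \<Longrightarrow> size P\<^sub>2 + size Q\<^sub>2 < size P + size Q
      \<Longrightarrow> conv v \<Gamma> \<Gamma>' V A (W\<langle>Bin k P\<^sub>1 P\<^sub>2 \<Rightarrow>\<^bsub>l\<^esub> Bin k Q\<^sub>1 Q\<^sub>2\<rangle>) (Bin k Q\<^sub>1 Q\<^sub>2)"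
    and VW: "v; \<Gamma>; \<Gamma>' \<turnstile> V : A \<sqsubseteq>\<^sup>C W : P" "is_value v V" "is_value v W"
    and PQ: "P \<sim> Q" "A \<^bold>\<sqsubseteq> P" "A \<^bold>\<sqsubseteq> Q"
  shows "conv v \<Gamma> \<Gamma>' V A (W\<langle>P \<Rightarrow>\<^bsub>l\<^esub> Q\<rangle>) Q"
proof -
  consider (id) "P = Q" "atomic P" | (project) "P = Dyn" "Q \<noteq> Dyn" | (inject) "P \<noteq> Dyn" "Q = Dyn"
    | (cross) k P\<^sub>1 P\<^sub>2 Q\<^sub>1 Q\<^sub>2 where "P = Bin k P\<^sub>1 P\<^sub>2" "Q = Bin k Q\<^sub>1 Q\<^sub>2"
    using PQ(1) by (cases P; cases Q) auto
  then show ?thesis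
  proof cases
    case id
    then show ?thesis
      using VW by (auto intro!: conv_stepsR[OF steps_id conv_refl_value])
  next
    case project
    then have A: "A = Dyn" using PQ by simp
    from VW(1)[unfolded project(1) A] VW(2,3) show ?thesis
    proof (cases rule: cprec_value_Dyn)
      \<comment> \<open>Both values carry the tag \<open>G\<close>. If the projection succeeds, the
        right one loses it, and the left one keeps it as a wrapper on the left alone.\<close>
      case (2 V' W' G l\<^sub>1 l\<^sub>2)
      show ?thesis
      proof (cases "gnd Q = G")
        case G: True
        have GQ: "G \<^bold>\<sqsubseteq> Q" using gnd_prec[OF project(2)] G by simp
        show ?thesis
        proof (cases "ground Q")
          case True
          then have "Q = G" using G gnd_eq_ground by simp
          then show ?thesis unfolding 2(2,3) project(1) A
            using 2 by (auto intro!: conv_stepsR[OF steps_project_ground conv_refl_value]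
                cprec_wrapL_Dyn simp: inert_iff)
        next
          case False
          then obtain k Q\<^sub>1 Q\<^sub>2 where Q: "Q = Bin k Q\<^sub>1 Q\<^sub>2"
            using project(2) by (cases Q) auto
          have "conv v \<Gamma> \<Gamma>' V' G (W'\<langle>G \<Rightarrow>\<^bsub>l\<^esub> Q\<rangle>) Q"
            using 2 G GQ project unfolding Q by (auto intro!: cross simp: Q)
          then show ?thesis unfolding 2(2,3) project(1) A
            using 2 G GQ project False
            by (intro conv_stepsR[OF steps_project_match] conv_wrapL_Dyn) auto
        qed
      next
        \<comment> \<open>The only place where new blame arises.\<close>
        case False
        then show ?thesis unfolding 2(2,3) project(1) A
          using 2 project by (intro conv_blame[OF steps_project_mismatch]) auto
      qed
    qed simp
  next
    case inject
    then have A: "A = Dyn" using PQ by simp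
    from VW(1)[unfolded A] VW(2,3) show ?thesis
    proof (cases rule: cprec_value_Dyn)
      \<comment> \<open>The left tag is \<open>gnd P\<close>, the very tag that the right injection
        will produce. So the left tag is set aside, \<open>W\<close> is cast to \<open>G\<close> if
        necessary, and both sides are then tagged with \<open>G\<close>.\<close>
      case (1 V' G l')
      have G: "gnd P = G"
        using ground_prec_gnd[OF 1(3,5)] by simp
      show ?thesis
      proof (cases "ground P")
        case True
        then have "P = G" using G gnd_eq_ground by simp
        then show ?thesis unfolding 1(2) inject(2) A
          using 1 VW(3) by (auto intro!: conv_stepsR[OF steps_wrap conv_refl_value]
              cprec_wrapLR_Dyn simp: inert_iff)
      next
        case False
        then obtain k P\<^sub>1 P\<^sub>2 where P: "P = Bin k P\<^sub>1 P\<^sub>2"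
          using inject(1) by (cases P) auto
        have "conv v \<Gamma> \<Gamma>' V' G (W\<langle>P \<Rightarrow>\<^bsub>l\<^esub> G\<rangle>) G"
          using 1 G VW(3) inject unfolding P by (auto intro!: cross simp: P)
        then have "conv v \<Gamma> \<Gamma>' (V'\<langle>\<langle>G \<Rightarrow>\<^bsub>l'\<^esub> Dyn\<rangle>\<rangle>) Dyn (W\<langle>P \<Rightarrow>\<^bsub>l\<^esub> G\<rangle>\<langle>G \<Rightarrow>\<^bsub>l\<^esub> Dyn\<rangle>) Dyn"
          by (rule conv_bind)
            (use 1(3) in \<open>auto intro!: eframeI frame.intros typing_cast typing_blame
              conv_stepsR[OF steps_wrap conv_refl_value] cprec_wrapLR_Dyn simp: inert_iff\<close>)
        then show ?thesis unfolding 1(2) inject(2) A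
          using conv_stepsR[OF steps_inject[OF VW(3) inject(1) False]] G by simp
      qed
    qed (use inject in simp)
  next
    case (cross k P\<^sub>1 P\<^sub>2 Q\<^sub>1 Q\<^sub>2)
    show ?thesis
    proof (cases "A = Dyn")
      \<comment> \<open>The type \<open>Dyn\<close> gives no access to components. The left tag is
        set aside, the content at type \<open>G\<close> is used for the cross cast, and
        \<open>conv_wrapL_Dyn\<close> puts the tag back.\<close>
      case A: True
      from VW(1)[unfolded A] VW(2,3) show ?thesis
      proof (cases rule: cprec_value_Dyn)
        case (1 V' G l')
        have GQ: "G \<^bold>\<sqsubseteq> Q"
          using 1(3,5) cross by (cases G) auto
        have "conv v \<Gamma> \<Gamma>' V' G (W\<langle>P \<Rightarrow>\<^bsub>l\<^esub> Q\<rangle>) Q"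
          using 1 GQ VW(3) PQ(1) unfolding cross by (auto intro!: assms(1)) (auto simp: cross)
        then show ?thesis unfolding 1(2) A
          using 1 GQ by (auto intro: conv_wrapL_Dyn)
      qed (use cross in simp)
    next
      case False
      then show ?thesis
        using VW PQ unfolding cross by (auto intro!: assms(1)) (auto simp: cross)
    qed
  qed
qed

text \<open>Source and target lie above \<open>A\<close>, which therefore does not bound them, and
  either of them may be \<open>Dyn\<close> while the other is large. Hence the recursion is on the
  sum of their sizes.\<close>

lemma conv_castR_value:
  assumes "v; \<Gamma>; \<Gamma>' \<turnstile> V : A \<sqsubseteq>\<^sup>C W : P" "is_value v V" "is_value v W"
    and "P \<sim> Q" "A \<^bold>\<sqsubseteq> P" "A \<^bold>\<sqsubseteq> Q"
  shows "conv v \<Gamma> \<Gamma>' V A (W\<langle>P \<Rightarrow>\<^bsub>l\<^esub> Q\<rangle>) Q"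
  using assms
proof (induction "size P + size Q" arbitrary: A P Q V W rule: less_induct)
  case less
  note IH = less.hyps
  from less.prems show ?case
  proof (rule conv_castR_if_cross[rotated])
    fix k P\<^sub>1 P\<^sub>2 Q\<^sub>1 Q\<^sub>2 A and V W :: "'a tm"
    assume V: "v; \<Gamma>; \<Gamma>' \<turnstile> V : A \<sqsubseteq>\<^sup>C W : Bin k P\<^sub>1 P\<^sub>2" and vals: "is_value v V" "is_value v W"
      and A: "A \<noteq> Dyn" and sim: "P\<^sub>1 \<sim> Q\<^sub>1" "P\<^sub>2 \<sim> Q\<^sub>2"
      and prec: "A \<^bold>\<sqsubseteq> Bin k P\<^sub>1 P\<^sub>2" "A \<^bold>\<sqsubseteq> Bin k Q\<^sub>1 Q\<^sub>2"
      and size: "size P\<^sub>1 + size Q\<^sub>1 < size P + size Q" "size P\<^sub>2 + size Q\<^sub>2 < size P + size Q"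
    obtain A\<^sub>1 A\<^sub>2 where A: "A = Bin k A\<^sub>1 A\<^sub>2"
      using A prec by (cases A) auto
    show "conv v \<Gamma> \<Gamma>' V A (W\<langle>Bin k P\<^sub>1 P\<^sub>2 \<Rightarrow>\<^bsub>l\<^esub> Bin k Q\<^sub>1 Q\<^sub>2\<rangle>) (Bin k Q\<^sub>1 Q\<^sub>2)"
    proof (cases "v = Variant1 \<or> k = Arr")
      case True
      then show ?thesis
        using V vals sim prec A
        by (intro conv_stepsR[OF steps_wrap] conv_refl_value cprec_wrapR_cross) (auto simp: inert_iff)
    next
      case False
      then have v: "v = Variant2" by (cases v) auto
      then have vW: "is_value Variant2 V" "is_value Variant2 W"
        using vals by auto
      from False consider (Times) "k = Times" | (Plus) "k = Plus" by (cases k) auto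
      then show ?thesis
      proof cases
        case Times
        note eqs = v Times A
        from V[unfolded eqs] vW show ?thesis
        proof (cases rule: cprec_value_Times)
          case (1 V\<^sub>1 V\<^sub>2 W\<^sub>1 W\<^sub>2)
          have "conv Variant2 \<Gamma> \<Gamma>' V\<^sub>1 A\<^sub>1 (W\<^sub>1\<langle>P\<^sub>1 \<Rightarrow>\<^bsub>l\<^esub> Q\<^sub>1\<rangle>) Q\<^sub>1"
            using 1 sim prec A IH[unfolded v] size by auto
          moreover have "conv Variant2 \<Gamma> \<Gamma>' V\<^sub>2 A\<^sub>2 (W\<^sub>2\<langle>P\<^sub>2 \<Rightarrow>\<^bsub>l\<^esub> Q\<^sub>2\<rangle>) Q\<^sub>2"
            using 1 sim prec A IH[unfolded v] size by auto
          moreover have "Variant2; \<Gamma>' \<turnstile> (CSnd W)\<langle>P\<^sub>2 \<Rightarrow>\<^bsub>l\<^esub> Q\<^sub>2\<rangle> : Q\<^sub>2"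
            using cprec_typing[OF V[unfolded eqs]] sim by (auto intro: typing_cast typing.intros)
          ultimately show ?thesis unfolding eqs
            using 1 vW
            by (auto intro!: conv_stepsR[OF steps_cast_Times] conv_cons
                conv_stepsR[OF steps_cast_fst] conv_stepsR[OF steps_cast_snd])
        qed
      next
        case Plus
        note eqs = v Plus A
        from V[unfolded eqs] vW show ?thesis
        proof (cases rule: cprec_value_Plus)
          case (1 V' W')
          then show ?thesis unfolding eqs
            using sim prec A IH[unfolded v] size
            by (auto intro!: conv_stepsR[OF steps_cast_inl] conv_inl)
        next
          case (2 V' W')
          then show ?thesis unfolding eqs
            using sim prec A IH[unfolded v] size
            by (auto intro!: conv_stepsR[OF steps_cast_inr] conv_inr)
        qed
      qed
    qed
  qed
qed

text \<open>
  If one of the two less precise types is \<open>?\<close>, the two casts can be performed one after the other,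
  passing through related terms: the left one first if its target is \<open>?\<close>, the right one first if
  the source of the left one is \<open>?\<close>.
\<close>

lemma conv_castLR_value:
  assumes "v; \<Gamma>; \<Gamma>' \<turnstile> V : A \<sqsubseteq>\<^sup>C W : A'" "is_value v V" "is_value v W"
    and "A \<sim> B" "A' \<sim> B'" "A \<^bold>\<sqsubseteq> A'" "B \<^bold>\<sqsubseteq> B'"
  shows "conv v \<Gamma> \<Gamma>' (V\<langle>A \<Rightarrow>\<^bsub>l\<^esub> B\<rangle>) B (W\<langle>A' \<Rightarrow>\<^bsub>l'\<^esub> B'\<rangle>) B'"
  using assms
proof (induction B' arbitrary: A B A' V W rule: ty.induct)
  have Dyn_case: "conv v \<Gamma> \<Gamma>' (V\<langle>A \<Rightarrow>\<^bsub>l\<^esub> B\<rangle>) B (W\<langle>A' \<Rightarrow>\<^bsub>l'\<^esub> B'\<rangle>) B'"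
    if "A = Dyn \<or> B = Dyn" and VW: "v; \<Gamma>; \<Gamma>' \<turnstile> V : A \<sqsubseteq>\<^sup>C W : A'" "is_value v V" "is_value v W"
      and AB: "A \<sim> B" "A' \<sim> B'" "A \<^bold>\<sqsubseteq> A'" "B \<^bold>\<sqsubseteq> B'" for A B A' B' V W
    using that(1)
  proof
    assume A: "A = Dyn"
    have "conv v \<Gamma> \<Gamma>' V A (W\<langle>A' \<Rightarrow>\<^bsub>l'\<^esub> B'\<rangle>) B'"
      using VW AB A by (intro conv_castR_value) auto
    then show ?thesis
      by (rule conv_bind) (use AB A in \<open>auto intro: typing_blame conv_castL_value\<close>)
  next
    assume B: "B = Dyn"
    have "conv v \<Gamma> \<Gamma>' (V\<langle>A \<Rightarrow>\<^bsub>l\<^esub> B\<rangle>) B W A'"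
      using VW AB B by (intro conv_castL_value) auto
    then show ?thesis
      by (rule conv_bind) (use AB B in \<open>auto intro: typing_cast typing_blame conv_castR_value\<close>)
  qed
  {
    case (Base b)
    then show ?case
    proof (cases "A = Dyn \<or> B = Dyn")
      case False
      then have "A = Base b" "B = Base b" "A' = Base b"
        using Base by (cases A; cases B; auto)+
      then show ?thesis
        using Base by (auto intro!: conv_steps[OF steps_id steps_id conv_refl_value])
    qed (rule Dyn_case)
  next
    case Dyn
    then show ?case by (intro Dyn_case) auto
  next
    case (Bin k B\<^sub>1' B\<^sub>2')
    then show ?case
    proof (cases "A = Dyn \<or> B = Dyn")
      case False
      then obtain A\<^sub>1 A\<^sub>2 B\<^sub>1 B\<^sub>2 A\<^sub>1' A\<^sub>2'
        where eq: "A = Bin k A\<^sub>1 A\<^sub>2" "B = Bin k B\<^sub>1 B\<^sub>2" "A' = Bin k A\<^sub>1' A\<^sub>2'"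
        using Bin.prems by (cases A; cases B; cases A') auto
      show ?thesis
      proof (cases "v = Variant1 \<or> k = Arr")
        case True
        then show ?thesis
          using Bin.prems unfolding eq
          by (intro conv_steps[OF steps_wrap steps_wrap] conv_refl_value cprec_wrapLR_cross)
            (auto simp: inert_iff)
      next
        case False
        then have v: "v = Variant2" by (cases v) auto
        then have vW: "is_value Variant2 V" "is_value Variant2 W"
          using Bin.prems by auto
        from False consider (Times) "k = Times" | (Plus) "k = Plus" by (cases k) auto
        then show ?thesis
        proof cases
          case Times
          note eqs = eq v Times
          from Bin.prems(1)[unfolded eqs] vW show ?thesis
          proof (cases rule: cprec_value_Times)
            case (1 V\<^sub>1 V\<^sub>2 W\<^sub>1 W\<^sub>2)
            have "conv Variant2 \<Gamma> \<Gamma>' (V\<^sub>1\<langle>A\<^sub>1 \<Rightarrow>\<^bsub>l\<^esub> B\<^sub>1\<rangle>) B\<^sub>1 (W\<^sub>1\<langle>A\<^sub>1' \<Rightarrow>\<^bsub>l'\<^esub> B\<^sub>1'\<rangle>) B\<^sub>1'"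
              using 1 Bin.prems(4-7) eq Bin.IH(1)[unfolded v] by auto
            moreover have "conv Variant2 \<Gamma> \<Gamma>' (V\<^sub>2\<langle>A\<^sub>2 \<Rightarrow>\<^bsub>l\<^esub> B\<^sub>2\<rangle>) B\<^sub>2 (W\<^sub>2\<langle>A\<^sub>2' \<Rightarrow>\<^bsub>l'\<^esub> B\<^sub>2'\<rangle>) B\<^sub>2'"
              using 1 Bin.prems(4-7) eq Bin.IH(2)[unfolded v] by auto
            moreover have "Variant2; \<Gamma>' \<turnstile> (CSnd W)\<langle>A\<^sub>2' \<Rightarrow>\<^bsub>l'\<^esub> B\<^sub>2'\<rangle> : B\<^sub>2'"
              using cprec_typing[OF Bin.prems(1)[unfolded eqs]] Bin.prems(5) eq
              by (auto intro: typing_cast typing.intros)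
            ultimately show ?thesis unfolding eqs
              using 1 vW
              by (auto intro!: conv_steps[OF steps_cast_Times steps_cast_Times] conv_cons
                  conv_steps[OF steps_cast_fst steps_cast_fst] conv_steps[OF steps_cast_snd steps_cast_snd])
          qed
        next
          case Plus
          note eqs = eq v Plus
          from Bin.prems(1)[unfolded eqs] vW show ?thesis
          proof (cases rule: cprec_value_Plus)
            case (1 V' W')
            then show ?thesis unfolding eqs
              using Bin.prems(4-7) eq Bin.IH(1)[unfolded v]
              by (auto intro!: conv_steps[OF steps_cast_inl steps_cast_inl] conv_inl)
          next
            case (2 V' W')
            then show ?thesis unfolding eqs
              using Bin.prems(4-7) eq Bin.IH(2)[unfolded v]
              by (auto intro!: conv_steps[OF steps_cast_inr steps_cast_inr] conv_inr)
          qed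
        qed
      qed
    qed (rule Dyn_case)
  }
qed

section \<open>Eliminations of related values\<close>

text \<open>Precision between the types is assumed separately here and below: \<open>cprec\<close>
  leaves the two contexts unrelated, so related terms, for instance variables, need not have related
  types.\<close>

lemma good_castL:
  assumes "good v \<Gamma> \<Gamma>' M A N A'" "A \<sim> B" "A \<^bold>\<sqsubseteq> A'" "B \<^bold>\<sqsubseteq> A'"
  shows "good v \<Gamma> \<Gamma>' (M\<langle>A \<Rightarrow>\<^bsub>l\<^esub> B\<rangle>) B N A'"
  using assms(1)
  by (rule good_bind) (use assms in \<open>auto intro: typing_blame cprec_castL conv_good conv_castL_value\<close>)

lemma good_castR:
  assumes "good v \<Gamma> \<Gamma>' M A N A'" "A' \<sim> B'" "A \<^bold>\<sqsubseteq> A'" "A \<^bold>\<sqsubseteq> B'"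
  shows "good v \<Gamma> \<Gamma>' M A (N\<langle>A' \<Rightarrow>\<^bsub>l\<^esub> B'\<rangle>) B'"
  using assms(1)
  by (rule good_bind[where F = "\<lambda>X. X"])
    (use assms in \<open>auto intro: typing_blame typing_cast cprec_castR conv_good conv_castR_value\<close>)

lemma good_castLR:
  assumes "good v \<Gamma> \<Gamma>' M A N A'" "A \<sim> B" "A' \<sim> B'" "A \<^bold>\<sqsubseteq> A'" "B \<^bold>\<sqsubseteq> B'"
  shows "good v \<Gamma> \<Gamma>' (M\<langle>A \<Rightarrow>\<^bsub>l\<^esub> B\<rangle>) B (N\<langle>A' \<Rightarrow>\<^bsub>l'\<^esub> B'\<rangle>) B'"
  using assms(1)
  by (rule good_bind)
    (use assms in \<open>auto intro: typing_blame typing_cast cprec_castLR conv_good conv_castLR_value\<close>)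

lemmas good_stepL = good_steps[OF r_into_rtranclp rtranclp.rtrancl_refl]
lemmas good_stepR = good_steps[OF rtranclp.rtrancl_refl r_into_rtranclp]

lemma inert_cross:
  assumes "inert v i" "tgt i = Bin k B\<^sub>1 B\<^sub>2"
  obtains A\<^sub>1 A\<^sub>2 l where "i = (Bin k A\<^sub>1 A\<^sub>2 \<Rightarrow>\<^bsub>l\<^esub> Bin k B\<^sub>1 B\<^sub>2)"
  using assms by (cases i) (auto simp: inert_iff)

lemma inert_prec_src:
  "inert_prec v i i' \<Longrightarrow> src i \<^bold>\<sqsubseteq> src i'"
  by (erule inert_prec.cases) auto

lemma inert_prec_tgt:
  "inert_prec v i i' \<Longrightarrow> tgt i \<^bold>\<sqsubseteq> tgt i'"
  by (erule inert_prec.cases) auto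

lemma inert_prec_ty_src: "inert_prec_ty v i A \<Longrightarrow> src i \<^bold>\<sqsubseteq> A"
  by (erule inert_prec_ty.cases) auto

lemma inert_prec_ty_tgt: "inert_prec_ty v i A \<Longrightarrow> tgt i \<^bold>\<sqsubseteq> A"
  by (erule inert_prec_ty.cases) auto

lemma ty_prec_inert_src: "ty_prec_inert v A i \<Longrightarrow> A \<^bold>\<sqsubseteq> src i"
  by (erule ty_prec_inert.cases) auto

lemma ty_prec_inert_tgt: "ty_prec_inert v A i \<Longrightarrow> A \<^bold>\<sqsubseteq> tgt i"
  by (erule ty_prec_inert.cases) auto

text \<open>Induction on the derivation for the function values. A wrapper on one side is unrolled
  by that side alone, and the shorter derivation supplies the outcome; the recursion ends at
  constants, abstractions or wrappers on both sides, where both sides step. The function types enter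
  through equations so that they can change along the recursion.\<close>

lemma good_app_value:
  assumes "v; \<Gamma>; \<Gamma>' \<turnstile> V : T \<sqsubseteq>\<^sup>C W : T'" "is_value v V" "is_value v W"
    and "T = A \<^bold>\<rightarrow> B" "T' = A' \<^bold>\<rightarrow> B'"
    and "v; \<Gamma>; \<Gamma>' \<turnstile> V\<^sub>2 : A \<sqsubseteq>\<^sup>C W\<^sub>2 : A'" "is_value v V\<^sub>2" "is_value v W\<^sub>2"
  shows "good v \<Gamma> \<Gamma>' (CApp V V\<^sub>2) B (CApp W W\<^sub>2) B'"
  using assms
proof (induction arbitrary: A B A' B' V\<^sub>2 W\<^sub>2 rule: cprec.induct)
  case (1 k P \<Gamma> \<Gamma>')
  from 1(4) obtain b P' where P: "P = PFun b P'" "A = Base b" "B = prim_ty P'"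
    by (cases P) auto
  with 1(5) have T': "A' = Base b" "B' = prim_ty P'" by auto
  from 1(1) P obtain f where f: "k = KFun f" "f \<in> base_den b \<rightarrow>\<^sub>E prim_den P'" by auto
  obtain u where u: "V\<^sub>2 = CConst (PBase b) (KBase u)" "W\<^sub>2 = CConst (PBase b) (KBase u)"
    "u \<in> base_den b"
    using 1(6-8) cprec_value_Base unfolding P T' by metis
  \<comment> \<open>Related values of base type are equal constants, so both sides produce the same
    constant \<open>f u\<close>; its membership is what makes it a legal term.\<close>
  have "f u \<in> prim_den P'" using f u by auto
  then show ?case
    unfolding P T' f u by (intro good_redex[OF step.intros(16) step.intros(16)] cprec.intros(1))
next
  case (3 C \<Gamma> C' \<Gamma>' N D N' D')
  then show ?case
    by (auto intro!: good_redex[OF step.intros(9) step.intros(9)] cprec_subst0)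
next
  case (15 \<Gamma> \<Gamma>' M i M' i')
  obtain A\<^sub>0 B\<^sub>0 l where i: "i = (A\<^sub>0 \<^bold>\<rightarrow> B\<^sub>0 \<Rightarrow>\<^bsub>l\<^esub> A \<^bold>\<rightarrow> B)"
    using inert_cross 15 by metis
  obtain A\<^sub>0' B\<^sub>0' l' where i': "i' = (A\<^sub>0' \<^bold>\<rightarrow> B\<^sub>0' \<Rightarrow>\<^bsub>l'\<^esub> A' \<^bold>\<rightarrow> B')"
    using inert_cross 15 by metis
  have prec: "A\<^sub>0 \<^bold>\<sqsubseteq> A\<^sub>0'" "B\<^sub>0 \<^bold>\<sqsubseteq> B\<^sub>0'" "A \<^bold>\<sqsubseteq> A'" "B \<^bold>\<sqsubseteq> B'"
    using inert_prec_src[OF 15(6)] inert_prec_tgt[OF 15(6)] i i' by auto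
  have sim: "A \<sim> A\<^sub>0" "B\<^sub>0 \<sim> B" "A' \<sim> A\<^sub>0'" "B\<^sub>0' \<sim> B'"
    using 15(2,3) by (auto simp: i i' cast_ok_def dest: consistent_sym)
  have "v; \<Gamma>; \<Gamma>' \<turnstile> (CApp M (V\<^sub>2\<langle>cdom i\<rangle>))\<langle>ccod i\<rangle> : B \<sqsubseteq>\<^sup>C (CApp M' (W\<^sub>2\<langle>cdom i'\<rangle>))\<langle>ccod i'\<rangle> : B'"
    using 15 prec sim unfolding i i' by (auto intro!: cprec_castLR cprec.intros(4)[of _ _ _ _ A\<^sub>0 B\<^sub>0 _ A\<^sub>0' B\<^sub>0'])
  with 15 show ?case
    by (auto intro!: good_redex[OF step.intros(5) step.intros(5)] simp: i i')
next
  case (16 \<Gamma> \<Gamma>' M i M' T')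
  obtain A\<^sub>0 B\<^sub>0 l where i: "i = (A\<^sub>0 \<^bold>\<rightarrow> B\<^sub>0 \<Rightarrow>\<^bsub>l\<^esub> A \<^bold>\<rightarrow> B)"
    using inert_cross 16 by metis
  have prec: "A\<^sub>0 \<^bold>\<sqsubseteq> A'" "B\<^sub>0 \<^bold>\<sqsubseteq> B'" "A \<^bold>\<sqsubseteq> A'" "B \<^bold>\<sqsubseteq> B'"
    using inert_prec_ty_src[OF 16(4)] inert_prec_ty_tgt[OF 16(4)] i 16(9) by auto
  have sim: "A \<sim> A\<^sub>0" "B\<^sub>0 \<sim> B"
    using 16(2) by (auto simp: i cast_ok_def dest: consistent_sym)
  have M: "v; \<Gamma>; \<Gamma>' \<turnstile> M : A\<^sub>0 \<^bold>\<rightarrow> B\<^sub>0 \<sqsubseteq>\<^sup>C M' : A' \<^bold>\<rightarrow> B'" "is_value v M"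
    using 16 by (auto simp: i)
  \<comment> \<open>The unrolled wrapper leaves a cast around the argument. It is evaluated first,
    because the induction hypothesis speaks of value arguments only; the result cast is added at the
    end by \<open>good_castL\<close>.\<close>
  have "good v \<Gamma> \<Gamma>' (V\<^sub>2\<langle>cdom i\<rangle>) A\<^sub>0 W\<^sub>2 A'"
    using 16 prec sim by (auto simp: i intro!: conv_good conv_castL_value)
  then have "good v \<Gamma> \<Gamma>' (CApp M (V\<^sub>2\<langle>cdom i\<rangle>)) B\<^sub>0 (CApp M' W\<^sub>2) B'"
    by (rule good_bind)
      (use M 16 cprec_typing[OF M(1)] i in
        \<open>auto intro: eframeI frame.intros typing.intros cprec.intros(4)\<close>)
  then have "good v \<Gamma> \<Gamma>' ((CApp M (V\<^sub>2\<langle>cdom i\<rangle>))\<langle>ccod i\<rangle>) B (CApp M' W\<^sub>2) B'"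
    using prec sim by (auto simp: i intro!: good_castL)
  moreover have "step v \<Gamma> (CApp (M\<langle>\<langle>i\<rangle>\<rangle>) V\<^sub>2) ((CApp M (V\<^sub>2\<langle>cdom i\<rangle>))\<langle>ccod i\<rangle>)"
    using 16 by (intro step.intros(5)[OF _ _ _ i]) auto
  ultimately show ?case by (rule good_stepL[rotated])
next
  case (17 \<Gamma> \<Gamma>' M T M' i')
  obtain A\<^sub>0' B\<^sub>0' l where i': "i' = (A\<^sub>0' \<^bold>\<rightarrow> B\<^sub>0' \<Rightarrow>\<^bsub>l\<^esub> A' \<^bold>\<rightarrow> B')"
    using inert_cross 17 by metis
  have prec: "A \<^bold>\<sqsubseteq> A\<^sub>0'" "B \<^bold>\<sqsubseteq> B\<^sub>0'" "A \<^bold>\<sqsubseteq> A'" "B \<^bold>\<sqsubseteq> B'"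
    using ty_prec_inert_src[OF 17(5)] ty_prec_inert_tgt[OF 17(5)] i' 17(9) by auto
  have sim: "A' \<sim> A\<^sub>0'" "B\<^sub>0' \<sim> B'"
    using 17(2) by (auto simp: i' cast_ok_def dest: consistent_sym)
  have M: "v; \<Gamma>; \<Gamma>' \<turnstile> M : A \<^bold>\<rightarrow> B \<sqsubseteq>\<^sup>C M' : A\<^sub>0' \<^bold>\<rightarrow> B\<^sub>0'" "is_value v M'"
    using 17 by (auto simp: i')
  have "good v \<Gamma> \<Gamma>' V\<^sub>2 A (W\<^sub>2\<langle>cdom i'\<rangle>) A\<^sub>0'"
    using 17 prec sim by (auto simp: i' intro!: conv_good conv_castR_value)
  then have "good v \<Gamma> \<Gamma>' (CApp M V\<^sub>2) B (CApp M' (W\<^sub>2\<langle>cdom i'\<rangle>)) B\<^sub>0'"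
    by (rule good_bind)
      (use M 17 cprec_typing[OF M(1)] i' in
        \<open>auto intro: eframeI frame.intros typing.intros cprec.intros(4)\<close>)
  then have "good v \<Gamma> \<Gamma>' (CApp M V\<^sub>2) B ((CApp M' (W\<^sub>2\<langle>cdom i'\<rangle>))\<langle>ccod i'\<rangle>) B'"
    using prec sim by (auto simp: i' intro!: good_castR)
  moreover have "step v \<Gamma>' (CApp (M'\<langle>\<langle>i'\<rangle>\<rangle>) W\<^sub>2) ((CApp M' (W\<^sub>2\<langle>cdom i'\<rangle>))\<langle>ccod i'\<rangle>)"
    using 17 by (intro step.intros(5)[OF _ _ _ i']) auto
  ultimately show ?case by (rule good_stepR[rotated])
qed simp_all

lemma good_fst_value:
  assumes "v; \<Gamma>; \<Gamma>' \<turnstile> V : T \<sqsubseteq>\<^sup>C W : T'" "is_value v V" "is_value v W"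
    and "T = A \<^bold>\<times> B" "T' = A' \<^bold>\<times> B'"
  shows "good v \<Gamma> \<Gamma>' (CFst V) A (CFst W) A'"
  using assms
proof (induction arbitrary: A B A' B' rule: cprec.induct)
  case (1 k P)
  then show ?case by (cases P) auto
next
  case (6 \<Gamma> \<Gamma>' M C M' C' N D N' D')
  then show ?case
    by (auto intro!: good_steps[OF r_into_rtranclp r_into_rtranclp good_refl_value] step.intros(12))
next
  case (15 \<Gamma> \<Gamma>' M i M' i')
  obtain A\<^sub>0 B\<^sub>0 l where i: "i = (A\<^sub>0 \<^bold>\<times> B\<^sub>0 \<Rightarrow>\<^bsub>l\<^esub> A \<^bold>\<times> B)"
    using inert_cross 15 by metis
  obtain A\<^sub>0' B\<^sub>0' l' where i': "i' = (A\<^sub>0' \<^bold>\<times> B\<^sub>0' \<Rightarrow>\<^bsub>l'\<^esub> A' \<^bold>\<times> B')"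
    using inert_cross 15 by metis
  have "v; \<Gamma>; \<Gamma>' \<turnstile> CFst M : A\<^sub>0 \<sqsubseteq>\<^sup>C CFst M' : A\<^sub>0'"
    using 15(1) unfolding i i' by (auto intro: cprec.intros(7))
  then have "v; \<Gamma>; \<Gamma>' \<turnstile> (CFst M)\<langle>cfst i\<rangle> : A \<sqsubseteq>\<^sup>C (CFst M')\<langle>cfst i'\<rangle> : A'"
    using inert_prec_src[OF 15(6)] inert_prec_tgt[OF 15(6)] 15(2,3) unfolding i i'
    by (auto intro!: cprec_castLR simp: cast_ok_def)
  with 15 show ?case
    by (auto intro!: good_redex[OF step.intros(6) step.intros(6)] simp: i i')
next
  case (16 \<Gamma> \<Gamma>' M i M' T')
  obtain A\<^sub>0 B\<^sub>0 l where i: "i = (A\<^sub>0 \<^bold>\<times> B\<^sub>0 \<Rightarrow>\<^bsub>l\<^esub> A \<^bold>\<times> B)"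
    using inert_cross 16 by metis
  have "good v \<Gamma> \<Gamma>' (CFst M) A\<^sub>0 (CFst M') A'"
    using 16 by (auto simp: i)
  then have "good v \<Gamma> \<Gamma>' ((CFst M)\<langle>cfst i\<rangle>) A (CFst M') A'"
    using inert_prec_ty_src[OF 16(4)] inert_prec_ty_tgt[OF 16(4)] 16(2,9) unfolding i
    by (auto intro!: good_castL simp: cast_ok_def)
  moreover have "step v \<Gamma> (CFst (M\<langle>\<langle>i\<rangle>\<rangle>)) ((CFst M)\<langle>cfst i\<rangle>)"
    using 16 by (intro step.intros(6)[OF _ _ i]) auto
  ultimately show ?case by (rule good_stepL[rotated])
next
  case (17 \<Gamma> \<Gamma>' M T M' i')
  obtain A\<^sub>0' B\<^sub>0' l where i': "i' = (A\<^sub>0' \<^bold>\<times> B\<^sub>0' \<Rightarrow>\<^bsub>l\<^esub> A' \<^bold>\<times> B')"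
    using inert_cross 17 by metis
  have "good v \<Gamma> \<Gamma>' (CFst M) A (CFst M') A\<^sub>0'"
    using 17 by (auto simp: i')
  then have "good v \<Gamma> \<Gamma>' (CFst M) A ((CFst M')\<langle>cfst i'\<rangle>) A'"
    using ty_prec_inert_src[OF 17(5)] ty_prec_inert_tgt[OF 17(5)] 17(2,9) unfolding i'
    by (auto intro!: good_castR simp: cast_ok_def)
  moreover have "step v \<Gamma>' (CFst (M'\<langle>\<langle>i'\<rangle>\<rangle>)) ((CFst M')\<langle>cfst i'\<rangle>)"
    using 17 by (intro step.intros(6)[OF _ _ i']) auto
  ultimately show ?case by (rule good_stepR[rotated])
qed simp_all

lemma good_snd_value:
  assumes "v; \<Gamma>; \<Gamma>' \<turnstile> V : T \<sqsubseteq>\<^sup>C W : T'" "is_value v V" "is_value v W"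
    and "T = A \<^bold>\<times> B" "T' = A' \<^bold>\<times> B'"
  shows "good v \<Gamma> \<Gamma>' (CSnd V) B (CSnd W) B'"
  using assms
proof (induction arbitrary: A B A' B' rule: cprec.induct)
  case (1 k P)
  then show ?case by (cases P) auto
next
  case (6 \<Gamma> \<Gamma>' M C M' C' N D N' D')
  then show ?case
    by (auto intro!: good_steps[OF r_into_rtranclp r_into_rtranclp good_refl_value] step.intros(13))
next
  case (15 \<Gamma> \<Gamma>' M i M' i')
  obtain A\<^sub>0 B\<^sub>0 l where i: "i = (A\<^sub>0 \<^bold>\<times> B\<^sub>0 \<Rightarrow>\<^bsub>l\<^esub> A \<^bold>\<times> B)"
    using inert_cross 15 by metis
  obtain A\<^sub>0' B\<^sub>0' l' where i': "i' = (A\<^sub>0' \<^bold>\<times> B\<^sub>0' \<Rightarrow>\<^bsub>l'\<^esub> A' \<^bold>\<times> B')"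
    using inert_cross 15 by metis
  have "v; \<Gamma>; \<Gamma>' \<turnstile> CSnd M : B\<^sub>0 \<sqsubseteq>\<^sup>C CSnd M' : B\<^sub>0'"
    using 15(1) unfolding i i' by (auto intro: cprec.intros(8))
  then have "v; \<Gamma>; \<Gamma>' \<turnstile> (CSnd M)\<langle>csnd i\<rangle> : B \<sqsubseteq>\<^sup>C (CSnd M')\<langle>csnd i'\<rangle> : B'"
    using inert_prec_src[OF 15(6)] inert_prec_tgt[OF 15(6)] 15(2,3) unfolding i i'
    by (auto intro!: cprec_castLR simp: cast_ok_def)
  with 15 show ?case
    by (auto intro!: good_redex[OF step.intros(7) step.intros(7)] simp: i i')
next
  case (16 \<Gamma> \<Gamma>' M i M' T')
  obtain A\<^sub>0 B\<^sub>0 l where i: "i = (A\<^sub>0 \<^bold>\<times> B\<^sub>0 \<Rightarrow>\<^bsub>l\<^esub> A \<^bold>\<times> B)"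
    using inert_cross 16 by metis
  have "good v \<Gamma> \<Gamma>' (CSnd M) B\<^sub>0 (CSnd M') B'"
    using 16 by (auto simp: i)
  then have "good v \<Gamma> \<Gamma>' ((CSnd M)\<langle>csnd i\<rangle>) B (CSnd M') B'"
    using inert_prec_ty_src[OF 16(4)] inert_prec_ty_tgt[OF 16(4)] 16(2,9) unfolding i
    by (auto intro!: good_castL simp: cast_ok_def)
  moreover have "step v \<Gamma> (CSnd (M\<langle>\<langle>i\<rangle>\<rangle>)) ((CSnd M)\<langle>csnd i\<rangle>)"
    using 16 by (intro step.intros(7)[OF _ _ i]) auto
  ultimately show ?case by (rule good_stepL[rotated])
next
  case (17 \<Gamma> \<Gamma>' M T M' i')
  obtain A\<^sub>0' B\<^sub>0' l where i': "i' = (A\<^sub>0' \<^bold>\<times> B\<^sub>0' \<Rightarrow>\<^bsub>l\<^esub> A' \<^bold>\<times> B')"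
    using inert_cross 17 by metis
  have "good v \<Gamma> \<Gamma>' (CSnd M) B (CSnd M') B\<^sub>0'"
    using 17 by (auto simp: i')
  then have "good v \<Gamma> \<Gamma>' (CSnd M) B ((CSnd M')\<langle>csnd i'\<rangle>) B'"
    using ty_prec_inert_src[OF 17(5)] ty_prec_inert_tgt[OF 17(5)] 17(2,9) unfolding i'
    by (auto intro!: good_castR simp: cast_ok_def)
  moreover have "step v \<Gamma>' (CSnd (M'\<langle>\<langle>i'\<rangle>\<rangle>)) ((CSnd M')\<langle>csnd i'\<rangle>)"
    using 17 by (intro step.intros(7)[OF _ _ i']) auto
  ultimately show ?case by (rule good_stepR[rotated])
qed simp_all

lemma cprec_var0: "v; A # \<Gamma>; A' # \<Gamma>' \<turnstile> CVar 0 : A \<sqsubseteq>\<^sup>C CVar 0 : A'"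
  using cprec.intros(2)[of 0 "A # \<Gamma>" "A' # \<Gamma>'" v] by simp

text \<open>On the right, variable 0 is replaced by itself. That substitution is the identity, so
  \<open>cprec_sub_var0\<close> applies although only the left term changes.\<close>

lemma cprec_cast_var0L:
  assumes "v; A # \<Gamma>; A' # \<Gamma>' \<turnstile> M : B \<sqsubseteq>\<^sup>C M' : B'" "C \<sim> A" "C \<^bold>\<sqsubseteq> A'" "A \<^bold>\<sqsubseteq> A'"
  shows "v; C # \<Gamma>; A' # \<Gamma>' \<turnstile> cast_var0 (C \<Rightarrow>\<^bsub>l\<^esub> A) M : B \<sqsubseteq>\<^sup>C M' : B'"
  using cprec_sub_var0[OF assms(1) cprec_castL[OF cprec_var0 assms(2-)]]
  by (simp add: cast_var0_def case_nat_CVar sub_CVar)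

lemma cprec_cast_var0R:
  assumes "v; A # \<Gamma>; A' # \<Gamma>' \<turnstile> M : B \<sqsubseteq>\<^sup>C M' : B'" "C' \<sim> A'" "A \<^bold>\<sqsubseteq> C'" "A \<^bold>\<sqsubseteq> A'"
  shows "v; A # \<Gamma>; C' # \<Gamma>' \<turnstile> M : B \<sqsubseteq>\<^sup>C cast_var0 (C' \<Rightarrow>\<^bsub>l\<^esub> A') M' : B'"
  using cprec_sub_var0[OF assms(1) cprec_castR[OF cprec_var0 assms(2-)]]
  by (simp add: cast_var0_def case_nat_CVar sub_CVar)

lemma cprec_cast_var0LR:
  assumes "v; A # \<Gamma>; A' # \<Gamma>' \<turnstile> M : B \<sqsubseteq>\<^sup>C M' : B'" "C \<sim> A" "C' \<sim> A'" "C \<^bold>\<sqsubseteq> C'" "A \<^bold>\<sqsubseteq> A'"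
  shows "v; C # \<Gamma>; C' # \<Gamma>' \<turnstile> cast_var0 (C \<Rightarrow>\<^bsub>l\<^esub> A) M : B \<sqsubseteq>\<^sup>C cast_var0 (C' \<Rightarrow>\<^bsub>l'\<^esub> A') M' : B'"
  using cprec_sub_var0[OF assms(1) cprec_castLR[OF cprec_var0 assms(2-)]]
  by (simp add: cast_var0_def)

text \<open>Unlike for application and projection, unrolling a wrapper leaves no cast around the
  result: the component casts move into the branches. The branches and the bound types must
  therefore vary in the induction.\<close>

lemma good_case_value:
  assumes "v; \<Gamma>; \<Gamma>' \<turnstile> V : T \<sqsubseteq>\<^sup>C W : T'" "is_value v V" "is_value v W"
    and "T = A\<^sub>1 \<^bold>+ A\<^sub>2" "T' = A\<^sub>1' \<^bold>+ A\<^sub>2'" "A\<^sub>1 \<^bold>\<sqsubseteq> A\<^sub>1'" "A\<^sub>2 \<^bold>\<sqsubseteq> A\<^sub>2'"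
    and "v; A\<^sub>1 # \<Gamma>; A\<^sub>1' # \<Gamma>' \<turnstile> M : B \<sqsubseteq>\<^sup>C M' : B'" "v; A\<^sub>2 # \<Gamma>; A\<^sub>2' # \<Gamma>' \<turnstile> N : B \<sqsubseteq>\<^sup>C N' : B'"
  shows "good v \<Gamma> \<Gamma>' (CCase V M N) B (CCase W M' N') B'"
  using assms
proof (induction arbitrary: A\<^sub>1 A\<^sub>2 A\<^sub>1' A\<^sub>2' M M' N N' rule: cprec.induct)
  case (1 k P)
  then show ?case by (cases P) auto
next
  case (9 \<Gamma> \<Gamma>' V C W C' D D')
  then show ?case
    by (auto intro!: good_redex[OF step.intros(14) step.intros(14)] cprec_subst0)
next
  case (10 \<Gamma> \<Gamma>' V C W C' D D')
  then show ?case
    by (auto intro!: good_redex[OF step.intros(15) step.intros(15)] cprec_subst0)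
next
  case (15 \<Gamma> \<Gamma>' V i W i')
  obtain C\<^sub>1 C\<^sub>2 l where i: "i = (C\<^sub>1 \<^bold>+ C\<^sub>2 \<Rightarrow>\<^bsub>l\<^esub> A\<^sub>1 \<^bold>+ A\<^sub>2)"
    using inert_cross 15 by metis
  obtain C\<^sub>1' C\<^sub>2' l' where i': "i' = (C\<^sub>1' \<^bold>+ C\<^sub>2' \<Rightarrow>\<^bsub>l'\<^esub> A\<^sub>1' \<^bold>+ A\<^sub>2')"
    using inert_cross 15 by metis
  have prec: "C\<^sub>1 \<^bold>\<sqsubseteq> C\<^sub>1'" "C\<^sub>2 \<^bold>\<sqsubseteq> C\<^sub>2'"
    using inert_prec_src[OF 15(6)] i i' by auto
  have V: "v; \<Gamma>; \<Gamma>' \<turnstile> V : C\<^sub>1 \<^bold>+ C\<^sub>2 \<sqsubseteq>\<^sup>C W : C\<^sub>1' \<^bold>+ C\<^sub>2'"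
    using 15 by (simp add: i i')
  have "v; \<Gamma>; \<Gamma>' \<turnstile> CCase V (cast_var0 (cinl i) M) (cast_var0 (cinr i) N) : B
      \<sqsubseteq>\<^sup>C CCase W (cast_var0 (cinl i') M') (cast_var0 (cinr i') N') : B'"
    using 15(2,3,13-) prec unfolding i i'
    by (auto intro!: cprec.intros(11)[OF V[unfolded i i']] cprec_cast_var0LR simp: cast_ok_def)
  with 15 show ?case
    by (auto intro!: good_redex[OF step.intros(8) step.intros(8)] simp: i i')
next
  case (16 \<Gamma> \<Gamma>' V i W T')
  obtain C\<^sub>1 C\<^sub>2 l where i: "i = (C\<^sub>1 \<^bold>+ C\<^sub>2 \<Rightarrow>\<^bsub>l\<^esub> A\<^sub>1 \<^bold>+ A\<^sub>2)"
    using inert_cross 16 by metis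
  have prec: "C\<^sub>1 \<^bold>\<sqsubseteq> A\<^sub>1'" "C\<^sub>2 \<^bold>\<sqsubseteq> A\<^sub>2'"
    using inert_prec_ty_src[OF 16(4)] 16(9) i by auto
  have "good v \<Gamma> \<Gamma>' (CCase V (cast_var0 (cinl i) M) (cast_var0 (cinr i) N)) B (CCase W M' N') B'"
    using 16(2,3,6,7,9-) prec unfolding i
    by (intro 16(5)[of C\<^sub>1 C\<^sub>2 A\<^sub>1' A\<^sub>2']) (auto intro!: cprec_cast_var0L simp: i cast_ok_def)
  moreover have "step v \<Gamma> (CCase (V\<langle>\<langle>i\<rangle>\<rangle>) M N) (CCase V (cast_var0 (cinl i) M) (cast_var0 (cinr i) N))"
    using 16 by (intro step.intros(8)[OF _ _ i]) auto
  ultimately show ?case by (rule good_stepL[rotated])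
next
  case (17 \<Gamma> \<Gamma>' V T W i')
  obtain C\<^sub>1' C\<^sub>2' l where i': "i' = (C\<^sub>1' \<^bold>+ C\<^sub>2' \<Rightarrow>\<^bsub>l\<^esub> A\<^sub>1' \<^bold>+ A\<^sub>2')"
    using inert_cross 17 by metis
  have prec: "A\<^sub>1 \<^bold>\<sqsubseteq> C\<^sub>1'" "A\<^sub>2 \<^bold>\<sqsubseteq> C\<^sub>2'"
    using ty_prec_inert_src[OF 17(5)] 17(9) i' by auto
  have "good v \<Gamma> \<Gamma>' (CCase V M N) B (CCase W (cast_var0 (cinl i') M') (cast_var0 (cinr i') N')) B'"
    using 17(2,3,7-) prec unfolding i'
    by (intro 17(6)[of A\<^sub>1 A\<^sub>2 C\<^sub>1' C\<^sub>2']) (auto intro!: cprec_cast_var0R simp: i' cast_ok_def)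
  moreover have "step v \<Gamma>' (CCase (W\<langle>\<langle>i'\<rangle>\<rangle>) M' N')
      (CCase W (cast_var0 (cinl i') M') (cast_var0 (cinr i') N'))"
    using 17 by (intro step.intros(8)[OF _ _ i']) auto
  ultimately show ?case by (rule good_stepR[rotated])
qed simp_all

lemma good_if_value:
  assumes "v; \<Gamma>; \<Gamma>' \<turnstile> V : Base BoolB \<sqsubseteq>\<^sup>C W : Base BoolB" "is_value v V" "is_value v W"
    and "v; \<Gamma>; \<Gamma>' \<turnstile> M : B \<sqsubseteq>\<^sup>C M' : B'" "v; \<Gamma>; \<Gamma>' \<turnstile> N : B \<sqsubseteq>\<^sup>C N' : B'"
  shows "good v \<Gamma> \<Gamma>' (CIf V M N) B (CIf W M' N') B'"
proof -
  obtain u where u: "V = CConst (PBase BoolB) (KBase u)" "W = CConst (PBase BoolB) (KBase u)"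
    "u \<in> base_den BoolB"
    using assms(1-3) cprec_value_Base by metis
  then obtain b where b: "u = VBool b" by auto
  show ?thesis
  proof (cases b)
    case True
    then show ?thesis using assms(4) unfolding u b
      by (auto intro: good_redex[OF step.intros(10) step.intros(10)])
  next
    case False
    then show ?thesis using assms(5) unfolding u b
      by (auto intro: good_redex[OF step.intros(11) step.intros(11)])
  qed
qed

lemma cprec_good: "v; \<Gamma>; \<Gamma>' \<turnstile> M : A \<sqsubseteq>\<^sup>C N : A' \<Longrightarrow> good v \<Gamma> \<Gamma>' M A N A'"
proof (induction rule: cprec.induct)
  case (1 k P \<Gamma> \<Gamma>')
  then show ?case by (auto intro!: good_refl_value cprec.intros(1))
next
  case (2 x \<Gamma> \<Gamma>')
  \<comment> \<open>A variable is related to the same variable, so both sides are stuck with no step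
    made.\<close>
  show ?case by (rule good_stuck) (auto intro: stuck.intros(1))
next
  case (3 A \<Gamma> A' \<Gamma>' N B N' B')
  then show ?case by (auto intro!: good_refl_value cprec.intros(3))
next
  case (4 \<Gamma> \<Gamma>' L A B L' A' B' M M')
  from 4(3) show ?case
  proof (rule good_bind)
    fix V W :: "'a tm" assume VW: "is_value v V" "is_value v W" "v; \<Gamma>; \<Gamma>' \<turnstile> V : A \<^bold>\<rightarrow> B \<sqsubseteq>\<^sup>C W : A' \<^bold>\<rightarrow> B'"
    \<comment> \<open>The operands are run only after the operators have become values, because the
      frame around an operand requires a value on its left.\<close>
    from 4(4) show "good v \<Gamma> \<Gamma>' (CApp V M) B (CApp W M') B'"
      by (rule good_bind)
        (use VW cprec_typing[OF VW(3)] in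
          \<open>auto intro: eframeI frame.intros typing.intros cprec.intros(4) good_app_value\<close>)
  qed (use 4 cprec_typing[OF 4(2)] in \<open>auto intro: eframeI frame.intros typing.intros cprec.intros(4)\<close>)
next
  case (5 \<Gamma> \<Gamma>' L L' M A M' A' N N')
  from 5(4) show ?case
    by (rule good_bind)
      (use 5 cprec_typing[OF 5(2)] cprec_typing[OF 5(3)] in
        \<open>auto intro: eframeI frame.intros typing.intros cprec.intros(5) good_if_value\<close>)
next
  case (6 \<Gamma> \<Gamma>' M A M' A' N B N' B')
  from 6(3) show ?case
  proof (rule good_bind)
    fix V W :: "'a tm" assume VW: "is_value v V" "is_value v W" "v; \<Gamma>; \<Gamma>' \<turnstile> V : A \<sqsubseteq>\<^sup>C W : A'"
    from 6(4) show "good v \<Gamma> \<Gamma>' (CCons V N) (A \<^bold>\<times> B) (CCons W N') (A' \<^bold>\<times> B')"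
      by (rule good_bind)
        (use VW cprec_typing[OF VW(3)] in
          \<open>auto intro: eframeI frame.intros typing.intros cprec.intros(6) good_refl_value\<close>)
  qed (use 6 cprec_typing[OF 6(2)] in \<open>auto intro: eframeI frame.intros typing.intros cprec.intros(6)\<close>)
next
  case (7 \<Gamma> \<Gamma>' M A B M' A' B')
  from 7(2) show ?case
    by (rule good_bind) (auto intro: eframeI frame.intros typing.intros cprec.intros(7) good_fst_value)
next
  case (8 \<Gamma> \<Gamma>' M A B M' A' B')
  from 8(2) show ?case
    by (rule good_bind) (auto intro: eframeI frame.intros typing.intros cprec.intros(8) good_snd_value)
next
  case (9 \<Gamma> \<Gamma>' M A M' A' B B')
  from 9(3) show ?case
    by (rule good_bind)
      (use 9(2) in \<open>auto intro: eframeI frame.intros typing.intros cprec.intros(9) good_refl_value\<close>)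
next
  case (10 \<Gamma> \<Gamma>' M B M' B' A A')
  from 10(3) show ?case
    by (rule good_bind)
      (use 10(2) in \<open>auto intro: eframeI frame.intros typing.intros cprec.intros(10) good_refl_value\<close>)
next
  case (11 \<Gamma> \<Gamma>' L A\<^sub>1 A\<^sub>2 L' A\<^sub>1' A\<^sub>2' M B M' B' N N')
  from 11(6) show ?case
    by (rule good_bind)
      (use 11 cprec_typing[OF 11(4)] cprec_typing[OF 11(5)] in
        \<open>auto intro: eframeI frame.intros typing.intros cprec.intros(11) good_case_value\<close>)
next
  case (12 \<Gamma> \<Gamma>' M c M' c')
  then show ?case
    by (cases c; cases c') (auto intro: good_castLR simp: cast_ok_def)
next
  case (13 \<Gamma> \<Gamma>' M c M' A')
  then show ?case
    by (cases c) (auto intro: good_castL simp: cast_ok_def)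
next
  case (14 \<Gamma> \<Gamma>' M A M' c')
  then show ?case
    by (cases c') (auto intro: good_castR simp: cast_ok_def)
next
  case (15 \<Gamma> \<Gamma>' M i M' i')
  from 15(8) show ?case
    by (rule good_bind)
      (use 15(2-7) in \<open>auto intro!: eframeI frame.intros typing.intros cprec.intros(15) good_refl_value\<close>)
next
  case (16 \<Gamma> \<Gamma>' M i M' A')
  from 16(5) show ?case
    by (rule good_bind)
      (use 16(2-4) in \<open>auto intro!: eframeI frame.intros typing.intros cprec.intros(16) good_refl_value\<close>)
next
  case (17 \<Gamma> \<Gamma>' M A M' i')
  from 17(6) show ?case
    by (rule good_bind[where F = "\<lambda>X. X"])
      (use 17(2-5) in \<open>auto intro!: eframeI frame.intros typing.intros cprec.intros(17) good_refl_value\<close>)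
next
  case (18 \<Gamma> M A A' \<Gamma>' l)
  show ?case by (rule good_blame) (rule rtranclp.rtrancl_refl)
qed

section \<open>Compilation\<close>

lemma matches_consistent:
  "matches A c A\<^sub>1 A\<^sub>2 \<Longrightarrow> A \<sim> Bin c (match1 A) (match2 A) \<and> A\<^sub>1 = match1 A \<and> A\<^sub>2 = match2 A"
  by (auto simp: matches_def)

lemma match_mono:
  assumes "matches A c A\<^sub>1 A\<^sub>2" "matches A' c A\<^sub>1' A\<^sub>2'" "A \<^bold>\<sqsubseteq> A'"
  shows "A\<^sub>1 \<^bold>\<sqsubseteq> A\<^sub>1'" "A\<^sub>2 \<^bold>\<sqsubseteq> A\<^sub>2'"
  using assms by (auto simp: matches_def)

text \<open>Precision of the types is proved alongside because every cast inserted by compilation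
  needs it. It enters through the contexts at variables and is preserved by matching and by joins of
  consistent types.\<close>

lemma compile_prec:
  assumes "M \<sqsubseteq>\<^sup>G N" "\<Gamma> \<turnstile>\<^sub>G M : A" "\<Gamma>' \<turnstile>\<^sub>G N : B" "list_all2 (\<^bold>\<sqsubseteq>) \<Gamma> \<Gamma>'"
  shows "A \<^bold>\<sqsubseteq> B \<and> v; \<Gamma>; \<Gamma>' \<turnstile> compile \<Gamma> M : A \<sqsubseteq>\<^sup>C compile \<Gamma>' N : B"
  using assms
proof (induction arbitrary: \<Gamma> \<Gamma>' A B rule: gprec.induct)
  case (1 P k)
  then show ?case by (auto elim!: gtyping_inv intro: cprec.intros(1))
next
  case (2 x)
  then show ?case by (auto elim!: gtyping_inv intro: cprec.intros(2) simp: list_all2_nthD)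
next
  case (3 C C' M M')
  then show ?case by (auto 4 4 elim!: gtyping_inv intro: cprec.intros(3))
next
  case (4 L L' M M' l l')
  from 4(5) obtain C D A\<^sub>1 where L: "\<Gamma> \<turnstile>\<^sub>G L : C" "\<Gamma> \<turnstile>\<^sub>G M : D" "matches C Arr A\<^sub>1 A" "A\<^sub>1 \<sim> D"
    by (auto elim!: gtyping_inv)
  from 4(6) obtain C' D' A\<^sub>1' where
    L': "\<Gamma>' \<turnstile>\<^sub>G L' : C'" "\<Gamma>' \<turnstile>\<^sub>G M' : D'" "matches C' Arr A\<^sub>1' B" "A\<^sub>1' \<sim> D'"
    by (auto elim!: gtyping_inv)
  note IH = 4(3)[OF L(1) L'(1) 4(7)] 4(4)[OF L(2) L'(2) 4(7)]
  note prec = match_mono[OF L(3) L'(3) IH(1)[THEN conjunct1]]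
  show ?case
    using IH prec L(4) L'(4) matches_consistent[OF L(3)] matches_consistent[OF L'(3)]
    by (auto simp: gtype_eq[OF L(1)] gtype_eq[OF L(2)] gtype_eq[OF L'(1)] gtype_eq[OF L'(2)] Let_def
        dest: consistent_sym intro!: cprec_castLR cprec.intros(4)[of _ _ _ _ "match1 C" "match2 C" _ "match1 C'" "match2 C'"])
next
  case (5 L L' M M' N N' l l')
  from 5(7) obtain C D E where L: "\<Gamma> \<turnstile>\<^sub>G L : C" "\<Gamma> \<turnstile>\<^sub>G M : D" "\<Gamma> \<turnstile>\<^sub>G N : E"
    "C \<sim> Base BoolB" "D \<sim> E" "A = D \<^bold>\<squnion> E"
    by (auto elim!: gtyping_inv)
  from 5(8) obtain C' D' E' where L': "\<Gamma>' \<turnstile>\<^sub>G L' : C'" "\<Gamma>' \<turnstile>\<^sub>G M' : D'" "\<Gamma>' \<turnstile>\<^sub>G N' : E'"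
    "C' \<sim> Base BoolB" "D' \<sim> E'" "B = D' \<^bold>\<squnion> E'"
    by (auto elim!: gtyping_inv)
  note IH = 5(4)[OF L(1) L'(1) 5(9)] 5(5)[OF L(2) L'(2) 5(9)] 5(6)[OF L(3) L'(3) 5(9)]
  have "D \<^bold>\<squnion> E \<^bold>\<sqsubseteq> D' \<^bold>\<squnion> E'"
    using IH L(5) L'(5) by (auto intro: join_mono)
  then show ?case
    using IH L(4,5) L'(4,5)
    by (auto simp: gtype_eq[OF L(1)] gtype_eq[OF L(2)] gtype_eq[OF L(3)]
        gtype_eq[OF L'(1)] gtype_eq[OF L'(2)] gtype_eq[OF L'(3)] Let_def L(6) L'(6)
        intro!: cprec_castLR cprec.intros(5) intro: ty_prec_consistent join_upper)
next
  case (6 M M' N N')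
  then show ?case by (auto elim!: gtyping_inv intro!: cprec.intros(6))
next
  case (7 M M' l l')
  from 7(3) obtain C A\<^sub>2 where M: "\<Gamma> \<turnstile>\<^sub>G M : C" "matches C Times A A\<^sub>2"
    by (auto elim!: gtyping_inv)
  from 7(4) obtain C' A\<^sub>2' where M': "\<Gamma>' \<turnstile>\<^sub>G M' : C'" "matches C' Times B A\<^sub>2'"
    by (auto elim!: gtyping_inv)
  note IH = 7(2)[OF M(1) M'(1) 7(5)]
  note prec = match_mono[OF M(2) M'(2) IH[THEN conjunct1]]
  show ?case
    using IH prec matches_consistent[OF M(2)] matches_consistent[OF M'(2)]
    by (auto simp: gtype_eq[OF M(1)] gtype_eq[OF M'(1)] Let_def
        intro!: cprec_castLR cprec.intros(7)[of _ _ _ _ "match1 C" "match2 C" _ "match1 C'" "match2 C'"])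
next
  case (8 M M' l l')
  from 8(3) obtain C A\<^sub>1 where M: "\<Gamma> \<turnstile>\<^sub>G M : C" "matches C Times A\<^sub>1 A"
    by (auto elim!: gtyping_inv)
  from 8(4) obtain C' A\<^sub>1' where M': "\<Gamma>' \<turnstile>\<^sub>G M' : C'" "matches C' Times A\<^sub>1' B"
    by (auto elim!: gtyping_inv)
  note IH = 8(2)[OF M(1) M'(1) 8(5)]
  note prec = match_mono[OF M(2) M'(2) IH[THEN conjunct1]]
  show ?case
    using IH prec matches_consistent[OF M(2)] matches_consistent[OF M'(2)]
    by (auto simp: gtype_eq[OF M(1)] gtype_eq[OF M'(1)] Let_def
        intro!: cprec_castLR cprec.intros(8)[of _ _ _ _ "match1 C" "match2 C" _ "match1 C'" "match2 C'"])
next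
  case (9 C C' M M')
  then show ?case by (auto elim!: gtyping_inv intro!: cprec.intros(9))
next
  case (10 C C' M M')
  then show ?case by (auto elim!: gtyping_inv intro!: cprec.intros(10))
next
  case (11 B\<^sub>1 B\<^sub>1' C\<^sub>1 C\<^sub>1' L L' M M' N N' l l')
  from 11(9) obtain C D E where L: "\<Gamma> \<turnstile>\<^sub>G L : C" "B\<^sub>1 # \<Gamma> \<turnstile>\<^sub>G M : D" "C\<^sub>1 # \<Gamma> \<turnstile>\<^sub>G N : E"
    "C \<sim> B\<^sub>1 \<^bold>+ C\<^sub>1" "D \<sim> E" "A = D \<^bold>\<squnion> E"
    by (auto elim!: gtyping_inv)
  from 11(10) obtain C' D' E' where L': "\<Gamma>' \<turnstile>\<^sub>G L' : C'" "B\<^sub>1' # \<Gamma>' \<turnstile>\<^sub>G M' : D'" "C\<^sub>1' # \<Gamma>' \<turnstile>\<^sub>G N' : E'"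
    "C' \<sim> B\<^sub>1' \<^bold>+ C\<^sub>1'" "D' \<sim> E'" "B = D' \<^bold>\<squnion> E'"
    by (auto elim!: gtyping_inv)
  have "list_all2 (\<^bold>\<sqsubseteq>) (B\<^sub>1 # \<Gamma>) (B\<^sub>1' # \<Gamma>')" "list_all2 (\<^bold>\<sqsubseteq>) (C\<^sub>1 # \<Gamma>) (C\<^sub>1' # \<Gamma>')"
    using 11 by auto
  note IH = 11(6)[OF L(1) L'(1) 11(11)] 11(7)[OF L(2) L'(2) this(1)] 11(8)[OF L(3) L'(3) this(2)]
  have "D \<^bold>\<squnion> E \<^bold>\<sqsubseteq> D' \<^bold>\<squnion> E'"
    using IH L(5) L'(5) by (auto intro: join_mono)
  then show ?case
    using IH L(4,5) L'(4,5) 11(1,2)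
    by (auto simp: gtype_eq[OF L(1)] gtype_eq[OF L(2)] gtype_eq[OF L(3)]
        gtype_eq[OF L'(1)] gtype_eq[OF L'(2)] gtype_eq[OF L'(3)] Let_def L(6) L'(6)
        intro!: cprec_castLR cprec.intros(11)[of _ _ _ _ B\<^sub>1 C\<^sub>1 _ B\<^sub>1' C\<^sub>1']
        intro: ty_prec_consistent join_upper)
qed

section \<open>The gradual guarantee\<close>

text \<open>Each round may take several steps, but divergence is a sequence of single ones. The
  invariant \<open>?Q\<close> also admits the terms between two rounds, so it survives one step at a
  time; the clause for \<open>n = 0\<close> pins the starting term.\<close>

lemma diverges_coinduct:
  assumes "P M" and "\<And>M. P M \<Longrightarrow> \<exists>N. (step v \<Gamma>)\<^sup>+\<^sup>+ M N \<and> P N"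
  shows "diverges v \<Gamma> M"
proof -
  let ?Q = "\<lambda>M. \<exists>N. steps v \<Gamma> M N \<and> P N"
  have "\<exists>f. \<forall>n. (?Q (f n) \<and> (n = 0 \<longrightarrow> f n = M)) \<and> step v \<Gamma> (f n) (f (Suc n))"
  proof (rule dependent_nat_choice)
    show "\<exists>x. ?Q x \<and> (0 = (0::nat) \<longrightarrow> x = M)"
      using assms(1) by blast
  next
    fix x :: "'a tm" and n :: nat assume "?Q x \<and> (n = 0 \<longrightarrow> x = M)"
    then obtain N where "(step v \<Gamma>)\<^sup>+\<^sup>+ x N" "P N"
      by (meson assms(2) rtranclp_tranclp_tranclp)
    then show "\<exists>y. (?Q y \<and> (Suc n = 0 \<longrightarrow> y = M)) \<and> step v \<Gamma> x y"
      by (auto dest: tranclpD)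
  qed
  then show ?thesis unfolding diverges_def by metis
qed

lemma outcomes:
  assumes "v; \<Gamma>; \<Gamma>' \<turnstile> M : A \<sqsubseteq>\<^sup>C N : A'"
  obtains "diverges v \<Gamma> M" "diverges v \<Gamma>' N"
  | l where "steps v \<Gamma>' N (CBlame A' l)"
  | V W where "steps v \<Gamma> M V" "steps v \<Gamma>' N W" "is_value v V" "is_value v W"
      "v; \<Gamma>; \<Gamma>' \<turnstile> V : A \<sqsubseteq>\<^sup>C W : A'"
  | S S' where "steps v \<Gamma> M S" "steps v \<Gamma>' N S'" "stuck v S" "stuck v S'"
proof -
  let ?ends = "\<lambda>M N. (\<exists>l. steps v \<Gamma>' N (CBlame A' l))
    \<or> (\<exists>V W. steps v \<Gamma> M V \<and> steps v \<Gamma>' N W \<and> is_value v V \<and> is_value v W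
        \<and> v; \<Gamma>; \<Gamma>' \<turnstile> V : A \<sqsubseteq>\<^sup>C W : A')
    \<or> (\<exists>S S'. steps v \<Gamma> M S \<and> steps v \<Gamma>' N S' \<and> stuck v S \<and> stuck v S')"
  \<comment> \<open>Related pairs without a finite outcome. By \<open>cprec_good\<close> such a pair
    can only step, and finite outcomes are inherited backwards along reduction, so the new pair is
    again in \<open>D\<close>. Either projection of \<open>D\<close> then witnesses
    divergence.\<close>
  define D where "D = (\<lambda>(M :: 'a tm) N. v; \<Gamma>; \<Gamma>' \<turnstile> M : A \<sqsubseteq>\<^sup>C N : A' \<and> \<not> ?ends M N)"
  have step: "\<exists>M' N'. (step v \<Gamma>)\<^sup>+\<^sup>+ M M' \<and> (step v \<Gamma>')\<^sup>+\<^sup>+ N N' \<and> D M' N'" if D: "D M N" for M N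
  proof -
    from D have "good v \<Gamma> \<Gamma>' M A N A'" by (simp add: D_def cprec_good)
    then show ?thesis
    proof cases
      case (good_step M' N')
      have "\<not> ?ends M' N'"
      proof
        assume "?ends M' N'"
        then have "?ends M N"
          using good_step(1,2)[THEN tranclp_into_rtranclp] by (meson rtranclp_trans)
        with D show False unfolding D_def by blast
      qed
      with good_step show ?thesis unfolding D_def by blast
    qed (use D in \<open>unfold D_def, blast\<close>)+
  qed
  have "diverges v \<Gamma> M" "diverges v \<Gamma>' N" if "D M N"
    by (rule diverges_coinduct[of "\<lambda>M. \<exists>N. D M N"], use that step in blast,
        use step in blast)
      (rule diverges_coinduct[of "\<lambda>N. \<exists>M. D M N"], use that step in blast, use step in blast)
  with assms that show thesis unfolding D_def by blast
qed

section \<open>Uniqueness of outcomes of a single term\<close>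

definition normal :: "variant \<Rightarrow> ctx \<Rightarrow> 'l tm \<Rightarrow> bool" where
  "normal v \<Gamma> R \<longleftrightarrow> (\<forall>N. \<not> step v \<Gamma> R N)"

lemma value_normal: "is_value v V \<Longrightarrow> normal v \<Gamma> V"
  using value_no_step unfolding normal_def by blast

lemma stuck_normal: "stuck v S \<Longrightarrow> normal v \<Gamma> S"
  using stuck_no_step unfolding normal_def by blast

lemma blame_normal: "normal v \<Gamma> (CBlame A l)"
  by (simp add: normal_def blame_no_step)

lemma steps_normal_unique:
  assumes "steps v \<Gamma> M R" "normal v \<Gamma> R" "steps v \<Gamma> M R'" "normal v \<Gamma> R'"
  shows "R = R'"
  using assms(1,3)
proof (induction rule: converse_rtranclp_induct)
  case base
  then show ?case using assms(2) unfolding normal_def by (metis converse_rtranclpE)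
next
  case (step M M')
  then show ?case using assms(4) unfolding normal_def by (metis converse_rtranclpE step_deterministic)
qed

lemma steps_normal_not_diverges:
  assumes "steps v \<Gamma> M R" "normal v \<Gamma> R"
  shows "\<not> diverges v \<Gamma> M"
  using assms(1)
proof (induction rule: converse_rtranclp_induct)
  case base
  then show ?case using assms(2) unfolding diverges_def normal_def by metis
next
  case (step M M')
  show ?case
  proof
    assume "diverges v \<Gamma> M"
    then obtain f where f: "f 0 = M" "\<And>i. step v \<Gamma> (f i) (f (Suc i))"
      unfolding diverges_def by blast
    then have "f (Suc 0) = M'"
      using step(1) step_deterministic by metis
    then have "diverges v \<Gamma> M'"
      using f unfolding diverges_def by (intro exI[of _ "\<lambda>i. f (Suc i)"]) auto
    with step show False by blast
  qed
qed

theorem theorem69: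
  fixes v :: variant and \<Gamma> :: ctx and M N :: "'l gtm" and A B :: ty
  assumes "M \<sqsubseteq>\<^sup>G N" and "\<Gamma> \<turnstile>\<^sub>G M : A" and "\<Gamma> \<turnstile>\<^sub>G N : B"
  shows
    "(\<forall>W. steps v \<Gamma> (compile \<Gamma> N) W \<and> is_value v W \<longrightarrow>
        (\<exists>V. steps v \<Gamma> (compile \<Gamma> M) V \<and> is_value v V \<and> v; \<Gamma>; \<Gamma> \<turnstile> V : A \<sqsubseteq>\<^sup>C W : B))
   \<and> (diverges v \<Gamma> (compile \<Gamma> N) \<longrightarrow> diverges v \<Gamma> (compile \<Gamma> M))
   \<and> (\<forall>V. steps v \<Gamma> (compile \<Gamma> M) V \<and> is_value v V \<longrightarrow>
        (\<exists>W. steps v \<Gamma> (compile \<Gamma> N) W \<and> is_value v W \<and> v; \<Gamma>; \<Gamma> \<turnstile> V : A \<sqsubseteq>\<^sup>C W : B)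
        \<or> (\<exists>l. steps v \<Gamma> (compile \<Gamma> N) (CBlame B l)))
   \<and> (diverges v \<Gamma> (compile \<Gamma> M) \<longrightarrow>
        diverges v \<Gamma> (compile \<Gamma> N) \<or> (\<exists>l. steps v \<Gamma> (compile \<Gamma> N) (CBlame B l)))"
proof -
  let ?M = "compile \<Gamma> M" and ?N = "compile \<Gamma> N"
  have "list_all2 (\<^bold>\<sqsubseteq>) \<Gamma> \<Gamma>" by (simp add: list_all2_refl)
  with assms have "v; \<Gamma>; \<Gamma> \<turnstile> ?M : A \<sqsubseteq>\<^sup>C ?N : B"
    using compile_prec by blast
  then show ?thesis
  proof (cases rule: outcomes)
    case 1
    then have "\<not> is_value v V" if "steps v \<Gamma> ?M V \<or> steps v \<Gamma> ?N V" for V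
      using that steps_normal_not_diverges[OF _ value_normal] by blast
    then show ?thesis using 1 by blast
  next
    case (2 l)
    then have "\<not> diverges v \<Gamma> ?N"
      by (rule steps_normal_not_diverges) (rule blame_normal)
    moreover have "\<not> is_value v W" if "steps v \<Gamma> ?N W" for W
      using steps_normal_unique[OF that value_normal 2 blame_normal] by auto
    ultimately show ?thesis using 2 by blast
  next
    case (3 V W)
    have "V' = V" if "steps v \<Gamma> ?M V'" "is_value v V'" for V'
      by (rule steps_normal_unique[OF that(1) value_normal[OF that(2)] 3(1) value_normal[OF 3(3)]])
    moreover have "W' = W" if "steps v \<Gamma> ?N W'" "is_value v W'" for W'
      by (rule steps_normal_unique[OF that(1) value_normal[OF that(2)] 3(2) value_normal[OF 3(4)]])
    moreover have "\<not> diverges v \<Gamma> ?M" "\<not> diverges v \<Gamma> ?N"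
      using 3 steps_normal_not_diverges[OF _ value_normal] by blast+
    ultimately show ?thesis using 3 by blast
  next
    \<comment> \<open>All four claims are vacuous: neither side reaches a value or diverges.\<close>
    case (4 S S')
    have "\<not> is_value v V" if "steps v \<Gamma> ?M V" for V
      using steps_normal_unique[OF that value_normal 4(1) stuck_normal[OF 4(3)]]
        stuck_not_value[OF 4(3)] by auto
    moreover have "\<not> is_value v W" if "steps v \<Gamma> ?N W" for W
      using steps_normal_unique[OF that value_normal 4(2) stuck_normal[OF 4(4)]]
        stuck_not_value[OF 4(4)] by auto
    moreover have "\<not> diverges v \<Gamma> ?M" "\<not> diverges v \<Gamma> ?N"
      using 4 steps_normal_not_diverges[OF _ stuck_normal] by blast+
    ultimately show ?thesis by blast
  qed
qed

end
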